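(* Let $X, Y$ be complex Banach spaces. Let $A\colon \mathcal{H}L_0(B_X)\to \mathcal{H}L_0(B_Y)$ be a multiplicative linear mapping and consider the following statements. (1) $A$ is a composition operator. (2) There is a continuous linear map $T\colon \mathcal G_0(B_Y)\to \mathcal G_0(B_X)$ such that $A=T^*$. (3) $A$ is $\tau_0$-$\tau_0$-continuous. (4) $A$ is $\tau_p$-$\tau_p$-continuous. Then: - (1) implies (2), (3) and (4); - each of (3) and (4) implies (2). When $X$ has the bounded approximation property, the statements (1)-(4) are equivalent.
   Context: $B_X$ denotes the open unit ball of a complex Banach space $X$. For complex Banach spaces $X,Y$, $\mathcal{H}L_0(B_X,Y)$ is the Banach space of all holomorphic (complex Fréchet differentiable) Lipschitz maps $f\colon B_X\to Y$ with $f(0)=0$, normed by the Lipschitz constant $L(f)=\sup_{x\ne y}\|f(x)-f(y)\|/\|x-y\|$; $\mathcal{H}L_0(B_X)=\mathcal{H}L_0(B_X,\mathbb C)$, which is an algebra under pointwise product. For $x\in B_X$, $\delta(x)\in \mathcal{H}L_0(B_X)^*$ is the evaluation functional $f\mapsto f(x)$, and $\mathcal G_0(B_X)=\overline{\operatorname{span}}\,\{\delta(x):x\in B_X\}\subseteq \mathcal{H}L_0(B_X)^*$ (norm closure). The canonical duality pairing gives an isometric identification $\mathcal{H}L_0(B_X)=\mathcal G_0(B_X)^*$, and $A=T^*$ is understood through it, i.e. $\langle Af,\mu\rangle=\langle f,T\mu\rangle$ for all $f\in\mathcal{H}L_0(B_X)$, $\mu\in\mathcal G_0(B_Y)$. A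 mapping $A\colon\mathcal{H}L_0(B_X)\to\mathcal{H}L_0(B_Y)$ is multiplicative if $A(fg)=A(f)A(g)$ for all $f,g$. It is a composition operator if there is $\phi\in\mathcal{H}L_0(B_Y,X)$ with $\phi(B_Y)\subseteq B_X$ such that $A(f)=f\circ\phi$ for every $f\in\mathcal{H}L_0(B_X)$. $\tau_0$ is the topology of uniform convergence on compact subsets of the ball on which the functions are defined, and $\tau_p$ is the topology of pointwise convergence on that ball. $X$ has the bounded approximation property (BAP) if there is $\lambda>0$ such that the identity of $X$ can be approximated, uniformly on compact sets, by finite-rank operators of norm at most $\lambda$. *)

theory Defs
  imports "HOL-Analysis.Analysis"
begin

section \<open>Complex normed spaces\<close>

(* The distribution only has real normed spaces as a type class; a complex normed space is one
   carrying a compatible complex scalar multiplication. *)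
class complex_normed_vector = real_normed_vector +
  fixes scaleC :: "complex \<Rightarrow> 'a \<Rightarrow> 'a"  (infixr \<open>*\<^sub>C\<close> 75)
  assumes scaleC_add_right: "a *\<^sub>C (x + y) = a *\<^sub>C x + a *\<^sub>C y"
    and scaleC_add_left: "(a + b) *\<^sub>C x = a *\<^sub>C x + b *\<^sub>C x"
    and scaleC_scaleC: "a *\<^sub>C (b *\<^sub>C x) = (a * b) *\<^sub>C x"
    and scaleC_one: "1 *\<^sub>C x = x"
    and scaleR_scaleC: "r *\<^sub>R x = complex_of_real r *\<^sub>C x"
    and norm_scaleC: "norm (a *\<^sub>C x) = cmod a * norm x"

class cbanach = complex_normed_vector + banach

global_interpretation complex_vector: vector_space "scaleC :: complex \<Rightarrow> 'a \<Rightarrow> 'a::complex_normed_vector"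
  defines cspan = complex_vector.span
  by standard (simp_all add: scaleC_add_right scaleC_add_left scaleC_scaleC scaleC_one)

instantiation complex :: cbanach
begin

definition scaleC_complex :: "complex \<Rightarrow> complex \<Rightarrow> complex"
  where "scaleC_complex a x = a * x"

instance
  by standard (simp_all add: scaleC_complex_def algebra_simps norm_mult scaleR_conv_of_real)

end

definition clinear :: "('a::complex_normed_vector \<Rightarrow> 'b::complex_normed_vector) \<Rightarrow> bool"
  where "clinear f \<longleftrightarrow> Vector_Spaces.linear (*\<^sub>C) (*\<^sub>C) f"

definition bounded_clinear :: "('a::complex_normed_vector \<Rightarrow> 'b::complex_normed_vector) \<Rightarrow> bool"
  where "bounded_clinear f \<longleftrightarrow> clinear f \<and> bounded_linear f"

lemma clinear_iff:
  "clinear f \<longleftrightarrow> (\<forall>x y. f (x + y) = f x + f y) \<and> (\<forall>c x. f (c *\<^sub>C x) = c *\<^sub>C f x)"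
  unfolding clinear_def
  by (auto simp: Vector_Spaces.linear_iff complex_vector.vector_space_axioms)

lemma bounded_linear_scaleC: "bounded_linear (\<lambda>x. c *\<^sub>C (x::'a::complex_normed_vector))"
  by (rule bounded_linear_intro[where K = "cmod c"])
    (simp_all add: scaleC_add_right scaleR_scaleC scaleC_scaleC norm_scaleC mult.commute)

instantiation blinfun :: (real_normed_vector, complex_normed_vector) complex_normed_vector
begin

lift_definition scaleC_blinfun :: "complex \<Rightarrow> 'a \<Rightarrow>\<^sub>L 'b \<Rightarrow> 'a \<Rightarrow>\<^sub>L 'b"
  is "\<lambda>c f x. c *\<^sub>C f x"
  by (metis bounded_linear_compose bounded_linear_scaleC)

instance
proof
  fix a b :: complex and x y :: "'a \<Rightarrow>\<^sub>L 'b" and r :: real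
  show "a *\<^sub>C (x + y) = a *\<^sub>C x + a *\<^sub>C y" by transfer (simp add: scaleC_add_right)
  show "(a + b) *\<^sub>C x = a *\<^sub>C x + b *\<^sub>C x" by transfer (simp add: scaleC_add_left)
  show "a *\<^sub>C (b *\<^sub>C x) = (a * b) *\<^sub>C x" by transfer (simp add: scaleC_scaleC)
  show "1 *\<^sub>C x = x" by transfer (simp add: scaleC_one)
  show "r *\<^sub>R x = complex_of_real r *\<^sub>C x" by transfer (simp add: scaleR_scaleC)
  have le: "norm (c *\<^sub>C z) \<le> cmod c * norm z" for c and z :: "'a \<Rightarrow>\<^sub>L 'b"
    by (rule norm_blinfun_bound)
      (simp_all add: scaleC_blinfun.rep_eq norm_scaleC mult.assoc mult_left_mono norm_blinfun)
  show "norm (a *\<^sub>C x) = cmod a * norm x"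
  proof (cases "a = 0")
    case True
    then show ?thesis using le[of a x] by simp
  next
    case False
    have "x = inverse a *\<^sub>C (a *\<^sub>C x)"
      using False by transfer (simp add: scaleC_scaleC scaleC_one)
    then have "norm x \<le> cmod (inverse a) * norm (a *\<^sub>C x)" by (metis le)
    then have "cmod a * norm x \<le> norm (a *\<^sub>C x)"
      using False by (simp add: norm_inverse norm_divide divide_simps mult.commute)
    with le[of a x] show ?thesis by simp
  qed
qed

end

definition bounded_approximation_property :: "'x::cbanach itself \<Rightarrow> bool"
  where "bounded_approximation_property _ \<longleftrightarrow>
    (\<exists>M>0. \<forall>K::'x set. compact K \<longrightarrow>
      (\<forall>\<epsilon>>0. \<exists>S::'x \<Rightarrow> 'x. bounded_clinear S \<and> (\<exists>B. finite B \<and> range S \<subseteq> cspan B) \<and>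
        onorm S \<le> M \<and> (\<forall>x\<in>K. norm (S x - x) < \<epsilon>)))"


section \<open>Holomorphic Lipschitz maps on the unit ball\<close>

definition cfrechet_holomorphic_on ::
    "('a::complex_normed_vector \<Rightarrow> 'b::complex_normed_vector) \<Rightarrow> 'a set \<Rightarrow> bool"
  where "cfrechet_holomorphic_on f S \<longleftrightarrow>
    (\<forall>x\<in>S. \<exists>D. bounded_clinear D \<and> (f has_derivative D) (at x))"

(* Maps defined on the open unit ball are represented by total functions vanishing outside it,
   so that equality in the type is equality on the ball. *)
definition HL0_set :: "('a::complex_normed_vector \<Rightarrow> 'b::complex_normed_vector) set"
  where "HL0_set = {f. f 0 = 0 \<and> cfrechet_holomorphic_on f (ball 0 1) \<and>
    (\<exists>C. C-lipschitz_on (ball 0 1) f) \<and> (\<forall>x. x \<notin> ball 0 1 \<longrightarrow> f x = 0)}"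

lemma HL0_setI:
  assumes "f 0 = 0" "\<And>x. x \<in> ball 0 1 \<Longrightarrow> \<exists>D. bounded_clinear D \<and> (f has_derivative D) (at x)"
    "C-lipschitz_on (ball 0 1) f" "\<And>x. x \<notin> ball 0 1 \<Longrightarrow> f x = 0"
  shows "f \<in> HL0_set"
  using assms unfolding HL0_set_def cfrechet_holomorphic_on_def by blast

lemma HL0_set_derivative:
  assumes "f \<in> HL0_set" "x \<in> ball 0 1"
  obtains D where "bounded_clinear D" "(f has_derivative D) (at x)"
  using assms unfolding HL0_set_def cfrechet_holomorphic_on_def by blast

lemma bounded_clinear_zero: "bounded_clinear (\<lambda>x. 0)"
  by (simp add: bounded_clinear_def clinear_iff)

lemma bounded_clinear_add:
  "bounded_clinear f \<Longrightarrow> bounded_clinear g \<Longrightarrow> bounded_clinear (\<lambda>x. f x + g x)"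
  unfolding bounded_clinear_def clinear_iff
  by (simp add: scaleC_add_right bounded_linear_add)

lemma bounded_clinear_scaleC:
  "bounded_clinear f \<Longrightarrow> bounded_clinear (\<lambda>x. c *\<^sub>C f x)"
  unfolding bounded_clinear_def clinear_iff
  by (simp add: scaleC_add_right mult.commute bounded_linear_compose[OF bounded_linear_scaleC])

lemma HL0_set_zero: "(\<lambda>x. 0) \<in> HL0_set"
proof (rule HL0_setI[where C = 0])
  show "\<exists>D. bounded_clinear D \<and> ((\<lambda>x. 0 :: 'b) has_derivative D) (at x)" for x :: 'a
    using bounded_clinear_zero has_derivative_const by blast
qed (simp_all add: lipschitz_on_def)

lemma HL0_set_add:
  assumes "f \<in> HL0_set" "g \<in> HL0_set"
  shows "(\<lambda>x. f x + g x) \<in> HL0_set"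
proof -
  obtain C D where "C-lipschitz_on (ball 0 1) f" "D-lipschitz_on (ball 0 1) g"
    using assms by (auto simp: HL0_set_def)
  then have "(C + D)-lipschitz_on (ball 0 1) (\<lambda>x. f x + g x)"
    by (rule lipschitz_on_add)
  moreover have "\<exists>E. bounded_clinear E \<and> ((\<lambda>x. f x + g x) has_derivative E) (at x)"
    if x: "x \<in> ball 0 1" for x
  proof -
    obtain F where F: "bounded_clinear F" "(f has_derivative F) (at x)"
      using HL0_set_derivative[OF assms(1) x] .
    obtain G where G: "bounded_clinear G" "(g has_derivative G) (at x)"
      using HL0_set_derivative[OF assms(2) x] .
    show ?thesis
      using bounded_clinear_add[OF F(1) G(1)] has_derivative_add[OF F(2) G(2)] by blast
  qed
  ultimately show ?thesis
    using assms by (intro HL0_setI) (auto simp: HL0_set_def)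
qed

lemma HL0_set_scaleC:
  assumes "f \<in> HL0_set"
  shows "(\<lambda>x. c *\<^sub>C f x) \<in> HL0_set"
proof -
  obtain C where C: "C-lipschitz_on (ball 0 1) f"
    using assms by (auto simp: HL0_set_def)
  have "(cmod c * C)-lipschitz_on (ball 0 1) (\<lambda>x. c *\<^sub>C f x)"
  proof (rule lipschitz_onI)
    fix x y :: 'a assume "x \<in> ball 0 1" "y \<in> ball 0 1"
    then have "cmod c * dist (f x) (f y) \<le> cmod c * (C * dist x y)"
      by (intro mult_left_mono lipschitz_onD[OF C]) auto
    then show "dist (c *\<^sub>C f x) (c *\<^sub>C f y) \<le> cmod c * C * dist x y"
      by (simp add: dist_norm norm_scaleC mult.assoc flip: complex_vector.scale_right_diff_distrib)
  qed (simp add: lipschitz_on_nonneg[OF C])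
  moreover have "\<exists>E. bounded_clinear E \<and> ((\<lambda>x. c *\<^sub>C f x) has_derivative E) (at x)"
    if x: "x \<in> ball 0 1" for x
  proof -
    obtain F where F: "bounded_clinear F" "(f has_derivative F) (at x)"
      using HL0_set_derivative[OF assms x] .
    show ?thesis
      using bounded_clinear_scaleC[OF F(1)]
        bounded_linear.has_derivative[OF bounded_linear_scaleC F(2)] by blast
  qed
  ultimately show ?thesis
    using assms by (intro HL0_setI) (auto simp: HL0_set_def)
qed

lemma HL0_set_mult:
  fixes f g :: "'a::complex_normed_vector \<Rightarrow> complex"
  assumes "f \<in> HL0_set" "g \<in> HL0_set"
  shows "(\<lambda>x. f x * g x) \<in> HL0_set"
proof -
  obtain C D where C: "C-lipschitz_on (ball 0 1) f" and D: "D-lipschitz_on (ball 0 1) g"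
    using assms by (auto simp: HL0_set_def)
  have nonneg: "0 \<le> C" "0 \<le> D" using C D lipschitz_on_nonneg by auto
  have bound: "norm (h x) \<le> E"
    if "E-lipschitz_on (ball 0 1) h" "h 0 = 0" "x \<in> ball 0 1"
    for E and h :: "'a \<Rightarrow> complex" and x
  proof -
    have "norm (h x) \<le> E * norm x"
      using lipschitz_onD[OF that(1,3), of 0] that(2) by simp
    also have "\<dots> \<le> E"
      using that(3) lipschitz_on_nonneg[OF that(1)] mult_left_mono[of "norm x" 1 E] by simp
    finally show ?thesis .
  qed
  have "(C * D + C * D)-lipschitz_on (ball 0 1) (\<lambda>x. f x * g x)"
  proof (rule lipschitz_onI)
    fix x y :: 'a assume x: "x \<in> ball 0 1" and y: "y \<in> ball 0 1"
    have "f x * g x - f y * g y = f x * (g x - g y) + (f x - f y) * g y"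
      by (simp add: algebra_simps)
    then have "dist (f x * g x) (f y * g y) \<le> norm (f x) * dist (g x) (g y) + dist (f x) (f y) * norm (g y)"
      by (metis dist_norm norm_mult norm_triangle_ineq)
    also have "\<dots> \<le> C * (D * dist x y) + (C * dist x y) * D"
      using assms
      by (intro add_mono mult_mono lipschitz_onD[OF C] lipschitz_onD[OF D] bound[OF C] bound[OF D] x y)
        (auto simp: HL0_set_def nonneg)
    finally show "dist (f x * g x) (f y * g y) \<le> (C * D + C * D) * dist x y"
      by (simp add: algebra_simps)
  qed (simp add: nonneg)
  moreover have "\<exists>E. bounded_clinear E \<and> ((\<lambda>x. f x * g x) has_derivative E) (at x)"
    if x: "x \<in> ball 0 1" for x
  proof -
    obtain F where F: "bounded_clinear F" "(f has_derivative F) (at x)"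
      using HL0_set_derivative[OF assms(1) x] .
    obtain G where G: "bounded_clinear G" "(g has_derivative G) (at x)"
      using HL0_set_derivative[OF assms(2) x] .
    have "bounded_clinear (\<lambda>h. f x *\<^sub>C G h + g x *\<^sub>C F h)"
      by (intro bounded_clinear_add bounded_clinear_scaleC F G)
    then have "bounded_clinear (\<lambda>h. f x * G h + F h * g x)"
      by (simp add: scaleC_complex_def mult.commute)
    with has_derivative_mult[OF F(2) G(2)] show ?thesis by blast
  qed
  ultimately show ?thesis
    using assms by (intro HL0_setI) (auto simp: HL0_set_def)
qed

typedef (overloaded) ('a, 'b) HL0 =
    "HL0_set :: ('a::complex_normed_vector \<Rightarrow> 'b::complex_normed_vector) set"
  morphisms HL0_apply Abs_HL0
  using HL0_set_zero by blast

setup_lifting type_definition_HL0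

lemma HL0_apply_zero [simp]: "HL0_apply f 0 = 0"
  using HL0_apply[of f] by (simp add: HL0_set_def)

lemma HL0_apply_outside: "x \<notin> ball 0 1 \<Longrightarrow> HL0_apply f x = 0"
  using HL0_apply[of f] unfolding HL0_set_def by blast

lemma HL0_eqI:
  assumes "\<And>x. x \<in> ball 0 1 \<Longrightarrow> HL0_apply f x = HL0_apply g x"
  shows "f = g"
proof -
  have "HL0_apply f x = HL0_apply g x" for x
    using assms[of x] HL0_apply_outside[of x f] HL0_apply_outside[of x g] by argo
  then show ?thesis
    by (simp add: HL0_apply_inject[symmetric] fun_eq_iff)
qed

lemma HL0_lipschitz: obtains C where "C-lipschitz_on (ball 0 1) (HL0_apply f)"
  using HL0_apply[of f] by (auto simp: HL0_set_def)

instantiation HL0 :: (complex_normed_vector, complex_normed_vector) complex_normed_vector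
begin

lift_definition zero_HL0 :: "('a, 'b) HL0" is "\<lambda>x. 0"
  by (rule HL0_set_zero)

lift_definition plus_HL0 :: "('a, 'b) HL0 \<Rightarrow> ('a, 'b) HL0 \<Rightarrow> ('a, 'b) HL0" is "\<lambda>f g x. f x + g x"
  by (rule HL0_set_add)

lift_definition scaleC_HL0 :: "complex \<Rightarrow> ('a, 'b) HL0 \<Rightarrow> ('a, 'b) HL0" is "\<lambda>c f x. c *\<^sub>C f x"
  by (rule HL0_set_scaleC)

definition scaleR_HL0 :: "real \<Rightarrow> ('a, 'b) HL0 \<Rightarrow> ('a, 'b) HL0"
  where "scaleR_HL0 r f = complex_of_real r *\<^sub>C f"

definition uminus_HL0 :: "('a, 'b) HL0 \<Rightarrow> ('a, 'b) HL0"
  where "uminus_HL0 f = (- 1) *\<^sub>C f"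

definition minus_HL0 :: "('a, 'b) HL0 \<Rightarrow> ('a, 'b) HL0 \<Rightarrow> ('a, 'b) HL0"
  where "minus_HL0 f g = f + - g"

(* The Lipschitz constant; the pairs with x = y contribute 0 / 0 = 0, which only serves to make the
   supremum one over a nonempty set when the domain is the zero space. *)
definition norm_HL0 :: "('a, 'b) HL0 \<Rightarrow> real"
  where "norm_HL0 f = (SUP (x, y) \<in> ball 0 1 \<times> ball 0 1.
    norm (HL0_apply f x - HL0_apply f y) / norm (x - y))"

definition sgn_HL0 :: "('a, 'b) HL0 \<Rightarrow> ('a, 'b) HL0"
  where "sgn_HL0 f = inverse (norm f) *\<^sub>R f"

definition dist_HL0 :: "('a, 'b) HL0 \<Rightarrow> ('a, 'b) HL0 \<Rightarrow> real"
  where "dist_HL0 f g = norm (f - g)"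

definition uniformity_HL0 :: "(('a, 'b) HL0 \<times> ('a, 'b) HL0) filter"
  where "uniformity_HL0 = (INF e\<in>{0<..}. principal {(f, g). dist f g < e})"

definition open_HL0 :: "('a, 'b) HL0 set \<Rightarrow> bool"
  where "open_HL0 U = (\<forall>f\<in>U. \<forall>\<^sub>F (f', g) in uniformity. f' = f \<longrightarrow> g \<in> U)"

lemma HL0_apply_uminus: "HL0_apply (- (f :: ('a, 'b) HL0)) x = - HL0_apply f x"
  by (simp add: uminus_HL0_def scaleC_HL0.rep_eq)

lemma HL0_apply_minus: "HL0_apply (f - (g :: ('a, 'b) HL0)) x = HL0_apply f x - HL0_apply g x"
  by (simp add: minus_HL0_def plus_HL0.rep_eq HL0_apply_uminus)

lemma HL0_bdd_above:
  fixes f :: "('a, 'b) HL0"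
  shows "bdd_above ((\<lambda>(x, y). norm (HL0_apply f x - HL0_apply f y) / norm (x - y)) ` (ball 0 1 \<times> ball 0 1))"
proof -
  obtain C where C: "C-lipschitz_on (ball 0 1) (HL0_apply f)" by (rule HL0_lipschitz)
  show ?thesis
  proof (rule bdd_aboveI2[where M = C], clarify)
    fix x y :: 'a assume x: "x \<in> ball 0 1" and y: "y \<in> ball 0 1"
    from lipschitz_on_normD[OF C x y] lipschitz_on_nonneg[OF C]
    show "norm (HL0_apply f x - HL0_apply f y) / norm (x - y) \<le> C"
      by (cases "x = y") (auto simp: divide_le_eq)
  qed
qed

lemma HL0_norm_bound:
  fixes f :: "('a, 'b) HL0"
  assumes "x \<in> ball 0 1" "y \<in> ball 0 1"
  shows "norm (HL0_apply f x - HL0_apply f y) \<le> norm f * norm (x - y)"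
proof (cases "x = y")
  case False
  have "norm (HL0_apply f x - HL0_apply f y) / norm (x - y) \<le> norm f"
    unfolding norm_HL0_def
    using cSUP_upper[OF _ HL0_bdd_above[of f], of "(x, y)"] assms by auto
  with False show ?thesis by (simp add: divide_le_eq)
qed simp

lemma HL0_norm_le:
  fixes f :: "('a, 'b) HL0"
  assumes "0 \<le> C"
    and "\<And>x y. x \<in> ball 0 1 \<Longrightarrow> y \<in> ball 0 1 \<Longrightarrow>
      norm (HL0_apply f x - HL0_apply f y) \<le> C * norm (x - y)"
  shows "norm f \<le> C"
  unfolding norm_HL0_def
proof (rule cSUP_least)
  show "ball (0::'a) 1 \<times> ball (0::'a) 1 \<noteq> {}" by auto
  fix p :: "'a \<times> 'a" assume "p \<in> ball 0 1 \<times> ball 0 1"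
  then show "(case p of (x, y) \<Rightarrow> norm (HL0_apply f x - HL0_apply f y) / norm (x - y)) \<le> C"
    using assms by (cases "fst p = snd p") (auto simp: divide_le_eq)
qed

lemma HL0_norm_nonneg: "0 \<le> norm (f :: ('a, 'b) HL0)"
proof -
  have "norm (HL0_apply f 0 - HL0_apply f 0) / norm (0 - 0 :: 'a) \<le> norm f"
    unfolding norm_HL0_def
    using cSUP_upper[OF _ HL0_bdd_above[of f], of "(0, 0)"] by force
  then show ?thesis by simp
qed

lemma HL0_apply_bound: "norm (HL0_apply f x) \<le> norm (f :: ('a, 'b) HL0) * norm x"
proof (cases "x \<in> ball 0 1")
  case True
  then show ?thesis using HL0_norm_bound[of x 0 f] by simp
next
  case False
  have "HL0_apply f x = 0" using False by (rule HL0_apply_outside)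
  then show ?thesis by (simp add: HL0_norm_nonneg)
qed

lemma HL0_norm_scaleC_le: "norm (c *\<^sub>C f) \<le> cmod c * norm (f :: ('a, 'b) HL0)"
proof (rule HL0_norm_le)
  fix x y :: 'a assume xy: "x \<in> ball 0 1" "y \<in> ball 0 1"
  have "norm (HL0_apply (c *\<^sub>C f) x - HL0_apply (c *\<^sub>C f) y)
      = cmod c * norm (HL0_apply f x - HL0_apply f y)"
    by (simp add: scaleC_HL0.rep_eq norm_scaleC flip: complex_vector.scale_right_diff_distrib)
  also have "\<dots> \<le> cmod c * (norm f * norm (x - y))"
    by (intro mult_left_mono HL0_norm_bound xy norm_ge_zero)
  finally show "norm (HL0_apply (c *\<^sub>C f) x - HL0_apply (c *\<^sub>C f) y)
      \<le> cmod c * norm f * norm (x - y)"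
    by (simp only: mult.assoc)
qed (simp add: HL0_norm_nonneg)

instance
proof
  fix a b c :: "('a, 'b) HL0" and r s :: real and u v :: complex
  show "a + b + c = a + (b + c)" "a + b = b + a" "0 + a = a"
    by (transfer; simp add: algebra_simps)+
  show "- a + a = 0" by (rule HL0_eqI) (simp add: plus_HL0.rep_eq HL0_apply_uminus zero_HL0.rep_eq)
  show "a - b = a + - b" by (rule minus_HL0_def)
  show C1: "u *\<^sub>C (a + b) = u *\<^sub>C a + u *\<^sub>C b" for u and a b :: "('a, 'b) HL0"
    by transfer (simp add: scaleC_add_right)
  show C2: "(u + v) *\<^sub>C a = u *\<^sub>C a + v *\<^sub>C a" for u v and a :: "('a, 'b) HL0"
    by transfer (simp add: scaleC_add_left)
  show C3: "u *\<^sub>C (v *\<^sub>C a) = (u * v) *\<^sub>C a" for u v and a :: "('a, 'b) HL0"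
    by transfer (simp add: scaleC_scaleC)
  show C4: "1 *\<^sub>C a = a" for a :: "('a, 'b) HL0"
    by transfer (simp add: scaleC_one)
  show "r *\<^sub>R (a + b) = r *\<^sub>R a + r *\<^sub>R b" "(r + s) *\<^sub>R a = r *\<^sub>R a + s *\<^sub>R a"
    "r *\<^sub>R (s *\<^sub>R a) = (r * s) *\<^sub>R a" "1 *\<^sub>R a = a" "r *\<^sub>R a = complex_of_real r *\<^sub>C a"
    by (simp_all add: scaleR_HL0_def C1 C2 C3 C4)
  show "sgn a = inverse (norm a) *\<^sub>R a" by (rule sgn_HL0_def)
  show "dist a b = norm (a - b)" by (rule dist_HL0_def)
  show "(uniformity :: (('a, 'b) HL0 \<times> ('a, 'b) HL0) filter) = (INF e\<in>{0<..}. principal {(x, y). dist x y < e})"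
    by (rule uniformity_HL0_def)
  show "open U = (\<forall>x\<in>U. \<forall>\<^sub>F (x', y) in uniformity. x' = x \<longrightarrow> y \<in> U)" for U :: "('a, 'b) HL0 set"
    by (rule open_HL0_def)
  show "(norm a = 0) = (a = 0)"
  proof
    assume "norm a = 0"
    then show "a = 0"
      using HL0_apply_bound[of a] by (intro HL0_eqI) (simp add: zero_HL0.rep_eq)
  next
    assume "a = 0"
    then show "norm a = 0"
      by (intro antisym HL0_norm_nonneg HL0_norm_le) (simp_all add: zero_HL0.rep_eq)
  qed
  show "norm (a + b) \<le> norm a + norm b"
  proof (rule HL0_norm_le)
    fix x y :: 'a assume xy: "x \<in> ball 0 1" "y \<in> ball 0 1"
    have "norm (HL0_apply (a + b) x - HL0_apply (a + b) y)
        \<le> norm (HL0_apply a x - HL0_apply a y) + norm (HL0_apply b x - HL0_apply b y)"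
      by (simp add: plus_HL0.rep_eq add_diff_add norm_triangle_ineq)
    then show "norm (HL0_apply (a + b) x - HL0_apply (a + b) y) \<le> (norm a + norm b) * norm (x - y)"
      using HL0_norm_bound[OF xy, of a] HL0_norm_bound[OF xy, of b] by (simp add: algebra_simps)
  qed (simp add: HL0_norm_nonneg)
  show norm_C: "norm (u *\<^sub>C a) = cmod u * norm a" for u and a :: "('a, 'b) HL0"
  proof (cases "u = 0")
    case True
    then show ?thesis using HL0_norm_scaleC_le[of u a] HL0_norm_nonneg[of "u *\<^sub>C a"] by simp
  next
    case False
    have "norm a \<le> cmod (inverse u) * norm (u *\<^sub>C a)"
      using HL0_norm_scaleC_le[of "inverse u" "u *\<^sub>C a"] False by (simp add: C3 C4)
    then have "cmod u * norm a \<le> norm (u *\<^sub>C a)"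
      using False by (simp add: norm_inverse norm_divide divide_simps mult.commute)
    with HL0_norm_scaleC_le[of u a] show ?thesis by simp
  qed
  show "norm (r *\<^sub>R a) = \<bar>r\<bar> * norm a"
    by (simp add: scaleR_HL0_def norm_C)
qed

end

lift_definition HL0_mult ::
    "('a::complex_normed_vector, complex) HL0 \<Rightarrow> ('a, complex) HL0 \<Rightarrow> ('a, complex) HL0"
  is "\<lambda>f g x. f x * g x"
  by (rule HL0_set_mult)

(* Uniform convergence on compact subsets of the ball: the sets
   {g. \<forall>x\<in>K. norm (g x - f x) < e}, with K compact and e > 0, are a neighbourhood base at f. *)
definition openin_tau0 :: "('a::complex_normed_vector, complex) HL0 set \<Rightarrow> bool"
  where "openin_tau0 U \<longleftrightarrow> (\<forall>f\<in>U. \<exists>K e. compact K \<and> K \<subseteq> ball 0 1 \<and> 0 < e \<and>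
    {g. \<forall>x\<in>K. norm (HL0_apply g x - HL0_apply f x) < e} \<subseteq> U)"

definition tau0 :: "('a::complex_normed_vector, complex) HL0 topology"
  where "tau0 = topology openin_tau0"

lemma istopology_openin_tau0: "istopology openin_tau0"
  unfolding istopology_def
proof (intro conjI allI impI)
  fix S T :: "('a, complex) HL0 set"
  assume S: "openin_tau0 S" and T: "openin_tau0 T"
  show "openin_tau0 (S \<inter> T)"
    unfolding openin_tau0_def
  proof
    fix f assume f: "f \<in> S \<inter> T"
    obtain K e where K: "compact K" "K \<subseteq> ball 0 1" "0 < e"
      "{g. \<forall>x\<in>K. norm (HL0_apply g x - HL0_apply f x) < e} \<subseteq> S"
      using bspec[OF S[unfolded openin_tau0_def] IntD1[OF f]] by (elim exE conjE)
    obtain L d where L: "compact L" "L \<subseteq> ball 0 1" "0 < d"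
      "{g. \<forall>x\<in>L. norm (HL0_apply g x - HL0_apply f x) < d} \<subseteq> T"
      using bspec[OF T[unfolded openin_tau0_def] IntD2[OF f]] by (elim exE conjE)
    have "{g. \<forall>x\<in>K \<union> L. norm (HL0_apply g x - HL0_apply f x) < min e d} \<subseteq> S \<inter> T"
      using K(4) L(4) by auto
    moreover have "compact (K \<union> L)" "K \<union> L \<subseteq> ball 0 1" "0 < min e d"
      using K L by auto
    ultimately show "\<exists>K e. compact K \<and> K \<subseteq> ball 0 1 \<and> 0 < e \<and>
        {g. \<forall>x\<in>K. norm (HL0_apply g x - HL0_apply f x) < e} \<subseteq> S \<inter> T"
      by (intro exI conjI)
  qed
next
  fix \<U> :: "('a, complex) HL0 set set"
  assume U: "\<forall>U\<in>\<U>. openin_tau0 U"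
  show "openin_tau0 (\<Union>\<U>)"
    unfolding openin_tau0_def
  proof
    fix f assume "f \<in> \<Union>\<U>"
    then obtain S where S: "S \<in> \<U>" "f \<in> S" by (rule UnionE)
    obtain K e where K: "compact K" "K \<subseteq> ball 0 1" "0 < e"
      "{g. \<forall>x\<in>K. norm (HL0_apply g x - HL0_apply f x) < e} \<subseteq> S"
      using bspec[OF bspec[OF U S(1), unfolded openin_tau0_def] S(2)] by (elim exE conjE)
    have "{g. \<forall>x\<in>K. norm (HL0_apply g x - HL0_apply f x) < e} \<subseteq> \<Union>\<U>"
      using K(4) Union_upper[OF S(1)] by (rule subset_trans)
    with K(1-3) show "\<exists>K e. compact K \<and> K \<subseteq> ball 0 1 \<and> 0 < e \<and>
        {g. \<forall>x\<in>K. norm (HL0_apply g x - HL0_apply f x) < e} \<subseteq> \<Union>\<U>"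
      by (intro exI conjI)
  qed
qed

lemma openin_tau0_iff: "openin tau0 U \<longleftrightarrow> openin_tau0 U"
  by (simp add: tau0_def istopology_openin_tau0)

lemma topspace_tau0 [simp]: "topspace tau0 = UNIV"
proof -
  have "openin_tau0 UNIV"
    unfolding openin_tau0_def
  proof (intro ballI exI conjI)
    show "compact {}" "(0::real) < 1" by simp_all
  qed auto
  then have "openin tau0 UNIV" by (simp add: openin_tau0_iff)
  then have "UNIV \<subseteq> topspace tau0" by (rule openin_subset)
  then show ?thesis by (rule top.extremum_uniqueI)
qed

definition taup :: "('a::complex_normed_vector, complex) HL0 topology"
  where "taup = pullback_topology UNIV (\<lambda>f. restrict (HL0_apply f) (ball 0 1))
    (product_topology (\<lambda>_. euclidean) (ball 0 1))"

lemma topspace_taup [simp]: "topspace taup = UNIV"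
  by (auto simp: taup_def topspace_pullback_topology)


section \<open>The canonical predual\<close>

lift_definition delta ::
    "'a::complex_normed_vector \<Rightarrow> ('a, complex) HL0 \<Rightarrow>\<^sub>L complex"
  is "\<lambda>x f. HL0_apply f x"
proof -
  fix x :: 'a
  show "bounded_linear (\<lambda>f::('a, complex) HL0. HL0_apply f x)"
    by (rule bounded_linear_intro[where K = "norm x"])
      (simp_all add: plus_HL0.rep_eq scaleR_HL0_def scaleC_HL0.rep_eq scaleC_complex_def
        scaleR_conv_of_real HL0_apply_bound)
qed

(* The ambient space consists of the bounded real-linear maps into the complex numbers. The dual of
   HL0 (as a complex space) is its closed, isometrically embedded subspace of complex-linear maps;
   as all delta x are complex-linear, the closed span does not depend on which one is used. *)
definition G0 :: "(('a::complex_normed_vector, complex) HL0 \<Rightarrow>\<^sub>L complex) set"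
  where "G0 = closure (cspan (delta ` ball 0 1))"

lemma G0_clinear:
  fixes \<mu> :: "('a::complex_normed_vector, complex) HL0 \<Rightarrow>\<^sub>L complex"
  assumes "\<mu> \<in> G0"
  shows "clinear (blinfun_apply \<mu>)"
proof -
  let ?V = "{\<mu> :: ('a, complex) HL0 \<Rightarrow>\<^sub>L complex. \<forall>c f. \<mu> (c *\<^sub>C f) = c *\<^sub>C \<mu> f}"
  have "?V = (\<Inter>c. \<Inter>f. {\<mu>. blinfun_apply \<mu> (c *\<^sub>C f) = c * blinfun_apply \<mu> f})"
    by (auto simp: scaleC_complex_def)
  then have "closed ?V"
    by (auto intro!: closed_INT closed_Collect_eq continuous_intros)
  moreover have "cspan (delta ` ball 0 1) \<subseteq> ?V"
  proof (rule complex_vector.span_minimal)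
    show "delta ` ball 0 1 \<subseteq> ?V"
      by (auto simp: delta.rep_eq scaleC_HL0.rep_eq)
    show "complex_vector.subspace ?V"
      unfolding complex_vector.subspace_def
      by (simp add: blinfun.add_left scaleC_blinfun.rep_eq scaleC_complex_def algebra_simps)
  qed
  ultimately have "G0 \<subseteq> ?V"
    unfolding G0_def by (rule closure_minimal[rotated])
  with assms show ?thesis
    by (auto simp: clinear_iff blinfun.add_right)
qed


section \<open>The properties of the operator\<close>

definition HL0_multiplicative ::
    "(('x::complex_normed_vector, complex) HL0 \<Rightarrow> ('y::complex_normed_vector, complex) HL0) \<Rightarrow> bool"
  where "HL0_multiplicative A \<longleftrightarrow> (\<forall>f g. A (HL0_mult f g) = HL0_mult (A f) (A g))"

definition composition_operator ::
    "(('x::complex_normed_vector, complex) HL0 \<Rightarrow> ('y::complex_normed_vector, complex) HL0) \<Rightarrow> bool"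
  where "composition_operator A \<longleftrightarrow>
    (\<exists>\<phi> :: ('y, 'x) HL0. HL0_apply \<phi> ` ball 0 1 \<subseteq> ball 0 1 \<and>
      (\<forall>f. \<forall>y\<in>ball 0 1. HL0_apply (A f) y = HL0_apply f (HL0_apply \<phi> y)))"

(* T is a total function of which only the values on G0 matter. *)
definition continuous_linear_G0 ::
    "((('y::complex_normed_vector, complex) HL0 \<Rightarrow>\<^sub>L complex) \<Rightarrow>
      (('x::complex_normed_vector, complex) HL0 \<Rightarrow>\<^sub>L complex)) \<Rightarrow> bool"
  where "continuous_linear_G0 T \<longleftrightarrow> T ` G0 \<subseteq> G0 \<and> continuous_on G0 T \<and>
    (\<forall>\<mu>\<in>G0. \<forall>\<nu>\<in>G0. T (\<mu> + \<nu>) = T \<mu> + T \<nu>) \<and> (\<forall>c. \<forall>\<mu>\<in>G0. T (c *\<^sub>C \<mu>) = c *\<^sub>C T \<mu>)"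

(* A = T*, where f in HL0 is paired with \<mu> in G0 by evaluation of the functional \<mu> at f. *)
definition is_adjoint_of ::
    "(('x::complex_normed_vector, complex) HL0 \<Rightarrow> ('y::complex_normed_vector, complex) HL0) \<Rightarrow>
     ((('y, complex) HL0 \<Rightarrow>\<^sub>L complex) \<Rightarrow> (('x, complex) HL0 \<Rightarrow>\<^sub>L complex)) \<Rightarrow> bool"
  where "is_adjoint_of A T \<longleftrightarrow> (\<forall>f. \<forall>\<mu>\<in>G0. blinfun_apply \<mu> (A f) = blinfun_apply (T \<mu>) f)"

end

theory Submission
  imports Defs "HOL-Complex_Analysis.Conformal_Mappings"
begin

text \<open>
  Everything is reduced to one condition on \<open>A\<close>: for every \<open>y\<close> in the ball of \<open>Y\<close>, the functional
  \<open>f \<mapsto> (A f)(y)\<close> belongs to the predual of \<open>HL0\<close> of the ball of \<open>X\<close>.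

  Being an adjoint \<open>T\<^sup>*\<close> is equivalent to this condition (\<open>adjoint_iff_evaluations_in_G0\<close>): \<open>T\<close> sends
  \<open>\<delta> y\<close> to the functional in question, and conversely \<open>\<mu> \<mapsto> \<mu> \<circ> A\<close> is an operator on the predual as soon
  as \<open>A\<close> is bounded, which the uniform boundedness principle provides. Continuity of \<open>A\<close> for \<open>\<tau>\<^sub>0\<close> or
  \<open>\<tau>\<^sub>p\<close> bounds \<open>(A f)(y)\<close> by a multiple of the supremum of \<open>f\<close> over a compact set \<open>K\<close> inside the ball.
  Functions of Lipschitz constant at most 1 are controlled on \<open>K\<close> by their values on a finite net, so
  by the Hahn-Banach theorem the functional is a norm limit of combinations of point evaluations
  (\<open>G0_if_bounded_on_compact\<close>). A composition operator turns \<open>\<delta> y\<close> into \<open>\<delta> (\<phi> y)\<close>, and its continuity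
  for both topologies is immediate.

  The bounded approximation property enters in the passage back to composition operators. Let \<open>\<nu>\<close> be
  the multiplicative functional \<open>f \<mapsto> (A f)(y)\<close> in the predual. It has a barycentre \<open>\<phi> y\<close> in \<open>X\<close>, the
  point at which every bounded linear functional \<open>w\<close> takes the value \<open>\<nu> w\<close> (\<open>G0_barycenter\<close>). The
  claim is that \<open>\<nu> f = f (\<phi> y)\<close>.
  Three facts are combined (\<open>G0_character_is_evaluation\<close>). An element of the predual respects pointwise
  limits of bounded sequences (\<open>G0_tendsto\<close>), so dilations reduce the claim for \<open>f\<close> to its
  homogeneous Taylor terms \<open>P\<close>, which again are Lipschitz on the ball with constant at most that of \<open>f\<close>.
  If \<open>S\<close> has finite rank, then \<open>P \<circ> S\<close> is a polynomial in finitely many linear functionals, and there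
  the claim follows from multiplicativity and the definition of the barycentre. Finally, if \<open>S\<close> runs
  through finite rank operators of bounded norm that approximate the identity, then the maps \<open>P \<circ> S\<close>
  remain bounded in \<open>HL0\<close> and converge to \<open>P\<close>; their Lipschitz constants stay bounded because \<open>P\<close> is
  defined on the whole space and is Lipschitz on every ball, however large the bound on \<open>S\<close> is.

  It remains to see that \<open>\<phi>\<close> is a map as required. Multiplicativity forces \<open>|A w| \<le> 1\<close> for functionals
  \<open>w\<close> of norm at most 1, since powers \<open>w\<^sup>n\<close> have Lipschitz constant at most \<open>n\<close>; the Schwarz lemma
  then gives \<open>\<parallel>\<phi> y\<parallel> \<le> \<kappa> \<parallel>y\<parallel>\<close> for every \<open>\<kappa> > 1\<close>, so that \<open>\<phi> y\<close> is in the open ball and \<open>\<phi> 0 = 0\<close>.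
  As \<open>w \<circ> \<phi> = A w\<close>, the map \<open>\<phi>\<close> is weakly holomorphic and Lipschitz, hence holomorphic and Lipschitz
  (\<open>weakly_HL0\<close>).

  A quadratic bound for the first order Taylor remainder, uniform over bounded sets of \<open>HL0\<close>
  (\<open>HL0_quadratic_remainder\<close>), is what makes Frechet differentiability pass to weak and to pointwise
  limits. It follows from the Schwarz lemma on complex lines.
\<close>

section \<open>Extension of linear functionals\<close>

definition sublinear :: "('a::real_vector \<Rightarrow> real) \<Rightarrow> bool"
  where "sublinear p \<longleftrightarrow> (\<forall>x y. p (x + y) \<le> p x + p y) \<and> (\<forall>r\<ge>0. \<forall>x. p (r *\<^sub>R x) = r * p x)"

lemma sublinear_add: "sublinear p \<Longrightarrow> p (x + y) \<le> p x + p y"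
  and sublinear_scale: "sublinear p \<Longrightarrow> 0 \<le> r \<Longrightarrow> p (r *\<^sub>R x) = r * p x"
  by (simp_all add: sublinear_def)

lemma sublinear_zero: "sublinear p \<Longrightarrow> p 0 = 0"
  using sublinear_scale[of p 0 0] by simp

lemma sublinear_uminus: "sublinear p \<Longrightarrow> - p (- x) \<le> p x"
  using sublinear_add[of p x "- x"] sublinear_zero[of p] by simp

text \<open>The infimum \<open>\<lambda>x. INF n\<in>C. p (x + n) - f n\<close> is the largest sublinear function below \<open>p\<close> whose linear
minorants dominate \<open>f\<close> on the cone \<open>C\<close>. It is used for a subspace, where it encodes an extension
problem, and for a single ray, where it shows that minimal sublinear functions are linear.\<close>

lemma sublinear_minorant_cone:
  fixes p f :: "'a::real_vector \<Rightarrow> real"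
  assumes p: "sublinear p" and "0 \<in> C"
    and add: "\<And>m n. m \<in> C \<Longrightarrow> n \<in> C \<Longrightarrow> m + n \<in> C \<and> f (m + n) = f m + f n"
    and scale: "\<And>r n. 0 \<le> r \<Longrightarrow> n \<in> C \<Longrightarrow> r *\<^sub>R n \<in> C \<and> f (r *\<^sub>R n) = r * f n"
    and le: "\<And>n. n \<in> C \<Longrightarrow> f n \<le> p n"
  obtains q where "sublinear q" "\<And>x. q x \<le> p x" "\<And>n. n \<in> C \<Longrightarrow> q (- n) \<le> - f n"
proof
  define q where "q x = (INF n\<in>C. p (x + n) - f n)" for x
  have f0: "f 0 = 0"
    using scale[of 0 0] \<open>0 \<in> C\<close> by simp
  have below: "- p (- x) \<le> p (x + n) - f n" if "n \<in> C" for x n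
    using sublinear_add[OF p, of "x + n" "- x"] le[OF that] by simp
  have lower: "q x \<le> p (x + n) - f n" if "n \<in> C" for x n
    unfolding q_def by (rule cINF_lower) (use below that in \<open>auto intro!: bdd_belowI2\<close>)
  have greatest: "c \<le> q x" if "\<And>n. n \<in> C \<Longrightarrow> c \<le> p (x + n) - f n" for c x
    unfolding q_def by (rule cINF_greatest) (use that \<open>0 \<in> C\<close> in auto)
  have half: "q (r *\<^sub>R x) \<le> r * q x" if "0 < r" for r x
  proof -
    have "q (r *\<^sub>R x) / r \<le> q x"
    proof (rule greatest)
      fix n assume n: "n \<in> C"
      have "q (r *\<^sub>R x) \<le> p (r *\<^sub>R x + r *\<^sub>R n) - f (r *\<^sub>R n)"
        using scale[of r n] n that by (intro lower) auto
      also have "\<dots> = r * (p (x + n) - f n)"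
        using scale[of r n] n that sublinear_scale[OF p, of r "x + n"]
        by (simp add: scaleR_add_right algebra_simps)
      finally show "q (r *\<^sub>R x) / r \<le> p (x + n) - f n"
        using that by (simp add: divide_le_eq mult.commute)
    qed
    then show ?thesis using that by (simp add: divide_le_eq mult.commute)
  qed
  have zero: "q 0 = 0"
    using lower[OF \<open>0 \<in> C\<close>, of 0] greatest[of 0 0] le sublinear_zero[OF p] f0 by force
  show "sublinear q"
    unfolding sublinear_def
  proof (intro conjI allI impI)
    fix x y
    have "q (x + y) - q y \<le> q x"
    proof (rule greatest)
      fix m assume m: "m \<in> C"
      have "q (x + y) - (p (x + m) - f m) \<le> q y"
      proof (rule greatest)
        fix n assume n: "n \<in> C"
        have "q (x + y) \<le> p ((x + m) + (y + n)) - f (m + n)"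
          using lower[of "m + n" "x + y"] add[OF m n] by (simp add: algebra_simps)
        also have "\<dots> \<le> p (x + m) + p (y + n) - (f m + f n)"
          using sublinear_add[OF p, of "x + m" "y + n"] add[OF m n] by simp
        finally show "q (x + y) - (p (x + m) - f m) \<le> p (y + n) - f n" by simp
      qed
      then show "q (x + y) - q y \<le> p (x + m) - f m" by simp
    qed
    then show "q (x + y) \<le> q x + q y" by simp
  next
    fix r x assume "(0::real) \<le> r"
    show "q (r *\<^sub>R x) = r * q x"
    proof (cases "r = 0")
      case False
      with \<open>0 \<le> r\<close> have r: "0 < r" by simp
      have "q x \<le> inverse r * q (r *\<^sub>R x)"
        using half[of "inverse r" "r *\<^sub>R x"] r by simp
      then have "r * q x \<le> q (r *\<^sub>R x)"
        using r by (simp add: field_simps)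
      with half[OF r, of x] show ?thesis by simp
    qed (simp add: zero)
  qed
  show "q x \<le> p x" for x
    using lower[OF \<open>0 \<in> C\<close>, of x] f0 by simp
  show "q (- n) \<le> - f n" if "n \<in> C" for n
    using lower[OF that, of "- n"] sublinear_zero[OF p] by simp
qed

text \<open>By Zorn's lemma: the pointwise infimum of a chain of sublinear functions below \<open>p\<close> is sublinear, and it
is finite since each member \<open>q\<close> satisfies \<open>q x \<ge> - p (- x)\<close>.\<close>

lemma sublinear_minimal_below:
  fixes p :: "'a::real_vector \<Rightarrow> real"
  assumes p: "sublinear p"
  obtains q where "sublinear q" "\<And>x. q x \<le> p x"
    "\<And>q'. sublinear q' \<Longrightarrow> (\<And>x. q' x \<le> q x) \<Longrightarrow> q' = q"
proof -
  define S where "S = {q. sublinear q \<and> q \<le> p}"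
  have "\<exists>m\<in>S. \<forall>a\<in>S. a \<le> m \<longrightarrow> a = m"
  proof (rule predicate_Zorn)
    show "partial_order_on S (relation_of (\<lambda>x y. y \<le> x) S)"
      by (rule partial_order_on_relation_ofI) auto
    fix \<C> assume \<C>: "\<C> \<in> Chains (relation_of (\<lambda>x y. y \<le> x) S)"
    then have sub: "\<C> \<subseteq> S"
      by (rule Chains_relation_of)
    have chain: "a \<le> b \<or> b \<le> a" if "a \<in> \<C>" "b \<in> \<C>" for a b
      using \<C> that by (auto simp: Chains_def relation_of_def)
    show "\<exists>u\<in>S. \<forall>a\<in>\<C>. u \<le> a"
    proof (cases "\<C> = {}")
      case True
      then show ?thesis using p by (auto simp: S_def)
    next
      case False
      define u where "u x = (INF q\<in>\<C>. q x)" for x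
      have bound: "- p (- x) \<le> q x" if "q \<in> \<C>" for q x
        using sublinear_uminus[of q x] that sub le_funD[of q p "- x"] by (force simp: S_def)
      have lower: "u x \<le> q x" if "q \<in> \<C>" for q x
        unfolding u_def by (rule cINF_lower) (use bound that in \<open>auto intro!: bdd_belowI2\<close>)
      have greatest: "c \<le> u x" if "\<And>q. q \<in> \<C> \<Longrightarrow> c \<le> q x" for c x
        unfolding u_def by (rule cINF_greatest) (use that False in auto)
      have sl: "sublinear q" if "q \<in> \<C>" for q
        using that sub by (auto simp: S_def)
      have half: "u (r *\<^sub>R x) \<le> r * u x" if "0 < r" for r x
      proof -
        have "u (r *\<^sub>R x) / r \<le> u x"
        proof (rule greatest)
          fix q assume q: "q \<in> \<C>"
          show "u (r *\<^sub>R x) / r \<le> q x"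
            using lower[OF q, of "r *\<^sub>R x"] sublinear_scale[OF sl[OF q], of r x] that
            by (simp add: divide_le_eq mult.commute)
        qed
        then show ?thesis using that by (simp add: divide_le_eq mult.commute)
      qed
      have "sublinear u"
        unfolding sublinear_def
      proof (intro conjI allI impI)
        fix x y
        have "u (x + y) - u y \<le> u x"
        proof (rule greatest)
          fix a assume a: "a \<in> \<C>"
          have "u (x + y) - a x \<le> u y"
          proof (rule greatest)
            fix b assume b: "b \<in> \<C>"
            obtain c where c: "c \<in> \<C>" "c \<le> a" "c \<le> b"
              using chain[OF a b] a b by auto
            have "u (x + y) \<le> c x + c y"
              using lower[OF c(1), of "x + y"] sublinear_add[OF sl[OF c(1)], of x y] by simp
            also have "\<dots> \<le> a x + b y"
              by (intro add_mono le_funD[OF c(2)] le_funD[OF c(3)])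
            finally show "u (x + y) - a x \<le> b y" by simp
          qed
          then show "u (x + y) - u y \<le> a x" by simp
        qed
        then show "u (x + y) \<le> u x + u y" by simp
      next
        fix r x assume "(0::real) \<le> r"
        show "u (r *\<^sub>R x) = r * u x"
        proof (cases "r = 0")
          case True
          then show ?thesis
            using False by (simp add: u_def sublinear_zero[OF sl] cong: INF_cong)
        next
          case False
          with \<open>0 \<le> r\<close> have r: "0 < r" by simp
          have "u x \<le> inverse r * u (r *\<^sub>R x)"
            using half[of "inverse r" "r *\<^sub>R x"] r by simp
          then have "r * u x \<le> u (r *\<^sub>R x)"
            using r by (simp add: field_simps)
          with half[OF r, of x] show ?thesis by simp
        qed
      qed
      moreover have "u \<le> p"
      proof (rule le_funI)
        fix x
        obtain q where "q \<in> \<C>" using False by blast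
        then show "u x \<le> p x" using lower[of q x] sub le_funD[of q p x] by (force simp: S_def)
      qed
      ultimately show ?thesis
        using lower by (auto simp: S_def le_fun_def)
    qed
  qed
  then obtain m where m: "m \<in> S" "\<And>a. a \<in> S \<Longrightarrow> a \<le> m \<Longrightarrow> a = m"
    by blast
  show ?thesis
  proof (rule that[of m])
    show "sublinear m" "m x \<le> p x" for x
      using m(1) by (auto simp: S_def le_fun_def)
    fix q' assume "sublinear q'" "\<And>x. q' x \<le> m x"
    then show "q' = m"
      using m(1) by (intro m(2)) (auto simp: S_def le_fun_def intro: order_trans)
  qed
qed

text \<open>A minimal sublinear function \<open>q\<close> is linear: lowering it along the ray spanned by \<open>y\<close> must not change it,
which says \<open>q (- y) = - q y\<close>. So a minimal sublinear function below the one of the previous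
construction has all required properties. Working with total functions avoids partial extensions.\<close>

lemma Hahn_Banach_cone:
  fixes p f :: "'a::real_vector \<Rightarrow> real"
  assumes p: "sublinear p" and "0 \<in> C"
    and "\<And>m n. m \<in> C \<Longrightarrow> n \<in> C \<Longrightarrow> m + n \<in> C \<and> f (m + n) = f m + f n"
    and "\<And>r n. 0 \<le> r \<Longrightarrow> n \<in> C \<Longrightarrow> r *\<^sub>R n \<in> C \<and> f (r *\<^sub>R n) = r * f n"
    and "\<And>n. n \<in> C \<Longrightarrow> f n \<le> p n"
  obtains q where "linear q" "\<And>x. q x \<le> p x" "\<And>n. n \<in> C \<Longrightarrow> f n \<le> q n"
proof -
  obtain p' where p': "sublinear p'" "\<And>x. p' x \<le> p x" "\<And>n. n \<in> C \<Longrightarrow> p' (- n) \<le> - f n"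
    using sublinear_minorant_cone[OF assms] by blast
  obtain q where q: "sublinear q" "\<And>x. q x \<le> p' x"
    and minimal: "\<And>q'. sublinear q' \<Longrightarrow> (\<And>x. q' x \<le> q x) \<Longrightarrow> q' = q"
    using sublinear_minimal_below[OF p'(1)] by blast
  have uminus: "q (- y) = - q y" for y
  proof -
    let ?C = "(\<lambda>t. t *\<^sub>R y) ` {0..}"
    obtain q' where q': "sublinear q'" "\<And>x. q' x \<le> q x" "\<And>n. n \<in> ?C \<Longrightarrow> q' (- n) \<le> - q n"
    proof (rule sublinear_minorant_cone[OF q(1), of ?C q])
      show "m + n \<in> ?C \<and> q (m + n) = q m + q n" if mn: "m \<in> ?C" "n \<in> ?C" for m n
      proof -
        obtain s t where st: "m = s *\<^sub>R y" "n = t *\<^sub>R y" "0 \<le> s" "0 \<le> t"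
          using mn by auto
        then have "m + n = (s + t) *\<^sub>R y" by (simp add: scaleR_add_left)
        with st show ?thesis
          using sublinear_scale[OF q(1), of "s + t" y] sublinear_scale[OF q(1), of s y]
            sublinear_scale[OF q(1), of t y] by (auto simp: distrib_right)
      qed
    qed (auto simp: sublinear_scale[OF q(1)])
    have "y \<in> ?C" by (rule image_eqI[of _ _ 1]) auto
    with q' minimal[of q'] have "q (- y) \<le> - q y" by auto
    moreover have "- q (- y) \<le> q y" by (rule sublinear_uminus[OF q(1)])
    ultimately show ?thesis by simp
  qed
  have "linear q"
  proof (rule linearI)
    fix x y
    have "q x \<le> q (x + y) + q (- y)"
      using sublinear_add[OF q(1), of "x + y" "- y"] by simp
    with uminus sublinear_add[OF q(1), of x y] show "q (x + y) = q x + q y" by simp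
  next
    fix r x
    show "q (r *\<^sub>R x) = r *\<^sub>R q x"
    proof (cases "0 \<le> r")
      case False
      then have "q (- (r *\<^sub>R x)) = - r * q x"
        using sublinear_scale[OF q(1), of "- r" x] by simp
      then show ?thesis using uminus[of "r *\<^sub>R x"] by simp
    qed (simp add: sublinear_scale[OF q(1)])
  qed
  then show ?thesis
  proof (rule that)
    show "q x \<le> p x" for x using q(2) p'(2) by (rule order_trans)
    show "f n \<le> q n" if "n \<in> C" for n
      using p'(3)[OF that] q(2)[of "- n"] uminus[of n] by simp
  qed
qed

lemma clinear_add: "clinear u \<Longrightarrow> u (x + y) = u x + u y"
  and clinear_scaleC: "clinear u \<Longrightarrow> u (c *\<^sub>C x) = c *\<^sub>C u x"
  by (simp_all add: clinear_iff)

lemma clinear_scaleR: "clinear u \<Longrightarrow> u (r *\<^sub>R x) = r *\<^sub>R u x"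
  by (simp add: scaleR_scaleC clinear_scaleC)

lemma clinear_zero: "clinear u \<Longrightarrow> u 0 = 0"
  using clinear_scaleR[of u 0 0] by simp

lemma clinear_uminus: "clinear u \<Longrightarrow> u (- x) = - u x"
  using clinear_scaleR[of u "- 1" x] by simp

lemma clinear_diff: "clinear u \<Longrightarrow> u (x - y) = u x - u y"
  using clinear_add[of u x "- y"] by (simp add: clinear_uminus)

lemma bounded_clinearI:
  assumes "clinear u" "\<And>x. norm (u x) \<le> c * norm x"
  shows "bounded_clinear u"
  unfolding bounded_clinear_def
  using assms by (auto intro!: bounded_linear_intro[where K = c] simp: clinear_add clinear_scaleR mult.commute)

text \<open>The usual complexification: a real-linear \<open>q\<close> that extends \<open>Re \<circ> u\<close> is the real part of the complex-linear
map \<open>x \<mapsto> q x - \<i> q (\<i> x)\<close>, and rotating \<open>x\<close> so that its image becomes a nonnegative real transfers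
the bound from \<open>q\<close> to the modulus.\<close>

theorem complex_Hahn_Banach:
  fixes u :: "'a::complex_normed_vector \<Rightarrow> complex"
  assumes u: "clinear u" and N: "complex_vector.subspace N" and "0 \<le> c"
    and le: "\<And>x. x \<in> N \<Longrightarrow> norm (u x) \<le> c * norm x"
  obtains w where "clinear w" "\<And>x. norm (w x) \<le> c * norm x" "\<And>x. x \<in> N \<Longrightarrow> w x = u x"
proof -
  have zero: "0 \<in> N" and Nadd: "\<And>x y. x \<in> N \<Longrightarrow> y \<in> N \<Longrightarrow> x + y \<in> N"
    and NC: "\<And>a x. x \<in> N \<Longrightarrow> a *\<^sub>C x \<in> N"
    using N by (auto simp: complex_vector.subspace_def)
  obtain q where q: "linear q" "\<And>x. q x \<le> c * norm x" "\<And>x. x \<in> N \<Longrightarrow> Re (u x) \<le> q x"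
  proof (rule Hahn_Banach_cone[of "\<lambda>x. c * norm x" N "\<lambda>x. Re (u x)"])
    show "sublinear (\<lambda>x::'a. c * norm x)"
      unfolding sublinear_def
    proof (intro conjI allI impI)
      fix x y :: 'a
      show "c * norm (x + y) \<le> c * norm x + c * norm y"
        using mult_left_mono[OF norm_triangle_ineq[of x y] \<open>0 \<le> c\<close>] by (simp add: algebra_simps)
    qed simp
    show "Re (u n) \<le> c * norm n" if "n \<in> N" for n
      using le[OF that] complex_Re_le_cmod[of "u n"] by linarith
    show "r *\<^sub>R n \<in> N \<and> Re (u (r *\<^sub>R n)) = r * Re (u n)" if "n \<in> N" for r n
      using NC[OF that] by (simp add: scaleR_scaleC clinear_scaleC[OF u] scaleC_complex_def)
  qed (use zero Nadd in \<open>auto simp: clinear_add[OF u]\<close>)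
  have eq: "q x = Re (u x)" if "x \<in> N" for x
  proof -
    have "- x \<in> N" using NC[OF that, of "-1"] by simp
    from q(3)[OF this] q(3)[OF that] show ?thesis
      by (simp add: linear_neg[OF q(1)] clinear_uminus[OF u])
  qed
  define w where "w x = Complex (q x) (- q (\<i> *\<^sub>C x))" for x
  have qadd: "q (x + y) = q x + q y" and qR: "q (r *\<^sub>R x) = r * q x" for x y r
    using q(1) by (simp_all add: linear_add linear_scale)
  have "clinear w"
    unfolding clinear_iff
  proof (intro conjI allI)
    fix x y show "w (x + y) = w x + w y"
      by (simp add: w_def qadd scaleC_add_right complex_eq_iff)
  next
    fix a x
    have *: "q (b *\<^sub>C x) = Re b * q x + Im b * q (\<i> *\<^sub>C x)" for b
    proof -
      have "b *\<^sub>C x = Re b *\<^sub>R x + Im b *\<^sub>R (\<i> *\<^sub>C x)"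
        by (simp add: scaleR_scaleC scaleC_scaleC flip: scaleC_add_left)
          (metis complex_eq mult.commute)
      then show ?thesis by (simp add: qadd qR)
    qed
    show "w (a *\<^sub>C x) = a *\<^sub>C w x"
      using *[of a] *[of "\<i> * a"] by (simp add: w_def scaleC_complex_def complex_eq_iff scaleC_scaleC)
  qed
  moreover have "norm (w x) \<le> c * norm x" for x
  proof -
    \<comment> \<open>Rotation that makes the value at \<open>x\<close> a nonnegative real.\<close>
    define b where "b = cnj (sgn (w x))"
    have "b * w x = norm (w x)"
      by (cases "w x = 0") (simp_all add: b_def sgn_eq mult.commute complex_norm_square power2_eq_square flip: complex_norm_square)
    then have "w (b *\<^sub>C x) = norm (w x)"
      by (simp add: clinear_scaleC[OF \<open>clinear w\<close>] scaleC_complex_def)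
    then have "norm (w x) = q (b *\<^sub>C x)"
      by (simp add: w_def complex_eq_iff)
    also have "\<dots> \<le> c * (cmod b * norm x)"
      using q(2)[of "b *\<^sub>C x"] by (simp add: norm_scaleC)
    also have "\<dots> \<le> c * (1 * norm x)"
      using \<open>0 \<le> c\<close> by (intro mult_left_mono mult_right_mono) (auto simp: b_def norm_sgn)
    finally show ?thesis by simp
  qed
  moreover have "w x = u x" if "x \<in> N" for x
    using that by (simp add: w_def eq NC[OF that] clinear_scaleC[OF u] scaleC_complex_def complex_eq_iff)
  ultimately show ?thesis by (rule that)
qed

text \<open>Extend the functional that maps \<open>v\<close> to its norm from the line spanned by \<open>v\<close>.\<close>

lemma norming_functional:
  fixes v :: "'a::complex_normed_vector"
  obtains w :: "'a \<Rightarrow> complex" where "clinear w" "\<And>x. norm (w x) \<le> norm x" "w v = norm v"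
proof (cases "v = 0")
  case True
  show ?thesis
    by (rule that[of "\<lambda>_. 0"]) (simp_all add: True clinear_iff)
next
  case False
  interpret vector_space_pair "scaleC :: complex \<Rightarrow> 'a \<Rightarrow> 'a" "scaleC :: complex \<Rightarrow> complex \<Rightarrow> complex"
    by (simp add: vector_space_pair_def complex_vector.vector_space_axioms)
  have "\<exists>g. Vector_Spaces.linear scaleC scaleC g \<and> (\<forall>x\<in>{v}. g x = complex_of_real (norm v))"
    by (rule linear_independent_extend) (simp add: False complex_vector.dependent_single)
  then obtain g :: "'a \<Rightarrow> complex" where g: "clinear g" "g v = norm v"
    by (auto simp: clinear_def)
  have "norm (g x) \<le> 1 * norm x" if x: "x \<in> cspan {v}" for x
  proof -
    obtain a where "x = a *\<^sub>C v"
      using x by (auto simp: complex_vector.span_singleton)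
    then show ?thesis
      by (simp add: clinear_scaleC[OF g(1)] g(2) scaleC_complex_def norm_mult norm_scaleC)
  qed
  then obtain w where "clinear w" "\<And>x. norm (w x) \<le> 1 * norm x" "\<And>x. x \<in> cspan {v} \<Longrightarrow> w x = g x"
    using complex_Hahn_Banach[OF g(1) complex_vector.subspace_span, of 1] by auto
  with g(2) complex_vector.span_base[of v "{v}"] show ?thesis
    by (intro that[of w]) auto
qed

lemma norming_functional_bound:
  fixes v :: "'a::complex_normed_vector"
  assumes "\<And>w::'a \<Rightarrow> complex. clinear w \<Longrightarrow> (\<And>x. norm (w x) \<le> norm x) \<Longrightarrow> norm (w v) \<le> c"
  shows "norm v \<le> c"
proof -
  obtain w :: "'a \<Rightarrow> complex" where "clinear w" "\<And>x. norm (w x) \<le> norm x" "w v = norm v"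
    using norming_functional[of v] by blast
  with assms[of w] show ?thesis by simp
qed

section \<open>Membership in the predual\<close>

text \<open>Induction on \<open>F\<close>: if some \<open>e\<close> is killed by \<open>F\<close> but not by the new functional \<open>v\<close>, subtract from \<open>\<mu>\<close> the
multiple of \<open>v\<close> with the same value at \<open>e\<close>; the difference vanishes on the common kernel of \<open>F\<close>.\<close>

lemma in_cspan_if_common_kernel:
  fixes \<mu> :: "'e::complex_normed_vector \<Rightarrow>\<^sub>L complex"
  assumes "finite F" "clinear (blinfun_apply \<mu>)" "\<And>\<phi>. \<phi> \<in> F \<Longrightarrow> clinear (blinfun_apply \<phi>)"
    and "\<And>f. (\<And>\<phi>. \<phi> \<in> F \<Longrightarrow> blinfun_apply \<phi> f = 0) \<Longrightarrow> blinfun_apply \<mu> f = 0"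
  shows "\<mu> \<in> cspan F"
  using assms
proof (induction F arbitrary: \<mu> rule: finite_induct)
  case empty
  then have "\<mu> = 0" by (intro blinfun_eqI) simp
  then show ?case by (simp add: complex_vector.span_zero)
next
  case (insert v F)
  have v: "clinear (blinfun_apply v)" using insert.prems by blast
  show ?case
  proof (cases "\<exists>e. (\<forall>\<phi>\<in>F. blinfun_apply \<phi> e = 0) \<and> blinfun_apply v e \<noteq> 0")
    case False
    then have "\<mu> \<in> cspan F"
      using insert.prems by (intro insert.IH) auto
    then show ?thesis
      using complex_vector.span_mono[of F "insert v F"] by blast
  next
    case True
    then obtain e where e: "\<And>\<phi>. \<phi> \<in> F \<Longrightarrow> blinfun_apply \<phi> e = 0" "blinfun_apply v e \<noteq> 0" by blast
    define c where "c = blinfun_apply \<mu> e / blinfun_apply v e"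
    have "\<mu> - c *\<^sub>C v \<in> cspan F"
    proof (rule insert.IH)
      show "clinear (blinfun_apply (\<mu> - c *\<^sub>C v))"
        using insert.prems(1) v
        by (auto simp: clinear_iff blinfun.diff_left scaleC_blinfun.rep_eq scaleC_complex_def algebra_simps)
      fix f assume f: "\<And>\<phi>. \<phi> \<in> F \<Longrightarrow> blinfun_apply \<phi> f = 0"
      define g where "g = f - (blinfun_apply v f / blinfun_apply v e) *\<^sub>C e"
      have "blinfun_apply \<mu> g = 0"
      proof (rule insert.prems(3))
        fix \<phi> assume "\<phi> \<in> insert v F"
        moreover have "blinfun_apply v g = 0"
          using e(2) by (simp add: g_def clinear_diff[OF v] clinear_scaleC[OF v] scaleC_complex_def)
        moreover have "blinfun_apply \<phi> g = 0" if "\<phi> \<in> F"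
          using insert.prems(2)[of \<phi>] that e(1) f
          by (simp add: g_def clinear_diff clinear_scaleC)
        ultimately show "blinfun_apply \<phi> g = 0" by blast
      qed
      then show "blinfun_apply (\<mu> - c *\<^sub>C v) f = 0"
        using insert.prems(1)
        by (simp add: g_def clinear_diff clinear_scaleC scaleC_complex_def c_def
            blinfun.diff_left scaleC_blinfun.rep_eq mult.commute)
    qed (use insert.prems in auto)
    then have "\<mu> - c *\<^sub>C v \<in> cspan (insert v F)"
      using complex_vector.span_mono[of F "insert v F"] by blast
    moreover have "c *\<^sub>C v \<in> cspan (insert v F)"
      by (intro complex_vector.span_scale complex_vector.span_base) simp
    ultimately have "(\<mu> - c *\<^sub>C v) + c *\<^sub>C v \<in> cspan (insert v F)"
      by (rule complex_vector.span_add)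
    then show ?thesis by simp
  qed
qed

lemma clinear_delta: "clinear (blinfun_apply (delta x))"
  by (simp add: clinear_iff delta.rep_eq plus_HL0.rep_eq scaleC_HL0.rep_eq)

text \<open>On the functions that vanish on a \<open>d\<close>-net \<open>F\<close> of \<open>K\<close>, the supremum over \<open>K\<close> is at most \<open>d\<close> times the
Lipschitz constant, so the restriction of \<open>\<mu>\<close> to this subspace has norm at most \<open>c * d\<close>. A
Hahn-Banach extension \<open>\<omega>\<close> of this restriction is small in norm, and \<open>\<mu> - \<omega>\<close> is a
combination of the evaluations at the points of \<open>F\<close>.\<close>

lemma G0_if_bounded_on_compact:
  fixes \<mu> :: "('a::complex_normed_vector, complex) HL0 \<Rightarrow>\<^sub>L complex"
  assumes \<mu>: "clinear (blinfun_apply \<mu>)" and K: "compact K" "K \<subseteq> ball 0 1" and "0 \<le> c"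
    and bound: "\<And>f s. (\<And>x. x \<in> K \<Longrightarrow> norm (HL0_apply f x) \<le> s) \<Longrightarrow> 0 \<le> s \<Longrightarrow>
      norm (blinfun_apply \<mu> f) \<le> c * s"
  shows "\<mu> \<in> G0"
  unfolding G0_def closure_approachable
proof (intro allI impI)
  fix e :: real assume "0 < e"
  \<comment> \<open>The summand 1 keeps the quotient defined when \<open>c = 0\<close>.\<close>
  define d where "d = e / (c + 1)"
  have d: "0 < d" "c * d < e"
    using \<open>0 < e\<close> \<open>0 \<le> c\<close> by (auto simp: d_def field_simps)
  have "\<exists>F. finite F \<and> F \<subseteq> K \<and> K \<subseteq> (\<Union>x\<in>F. ball x d)"
    using seq_compact_imp_totally_bounded[of K] K(1) d(1)
    by (auto simp: compact_eq_seq_compact_metric)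
  then obtain F where F: "finite F" "F \<subseteq> K" "K \<subseteq> (\<Union>x\<in>F. ball x d)" by blast
  define N where "N = {f :: ('a, complex) HL0. \<forall>x\<in>F. HL0_apply f x = 0}"
  have "complex_vector.subspace N"
    by (auto simp: complex_vector.subspace_def N_def zero_HL0.rep_eq plus_HL0.rep_eq scaleC_HL0.rep_eq)
  moreover have "norm (blinfun_apply \<mu> f) \<le> (c * d) * norm f" if f: "f \<in> N" for f
  proof -
    have "norm (blinfun_apply \<mu> f) \<le> c * (d * norm f)"
    proof (rule bound)
      fix x assume x: "x \<in> K"
      then obtain z where z: "z \<in> F" "dist z x < d" using F(3) by auto
      then have "norm (HL0_apply f x) = norm (HL0_apply f x - HL0_apply f z)"
        using f by (simp add: N_def)
      also have "\<dots> \<le> norm f * norm (x - z)"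
        using x z F(2) K(2) by (intro HL0_norm_bound) auto
      also have "\<dots> \<le> norm f * d"
        using z by (intro mult_left_mono) (auto simp: dist_norm norm_minus_commute)
      finally show "norm (HL0_apply f x) \<le> d * norm f" by (simp add: mult.commute)
    qed (use d in auto)
    then show ?thesis by (simp add: mult.assoc)
  qed
  ultimately obtain w where w: "clinear w" "\<And>f. norm (w f) \<le> (c * d) * norm f"
    "\<And>f. f \<in> N \<Longrightarrow> w f = blinfun_apply \<mu> f"
    using complex_Hahn_Banach[OF \<mu>, of N "c * d"] d(1) \<open>0 \<le> c\<close> by auto
  define \<omega> where "\<omega> = Blinfun w"
  have "bounded_linear w"
    using bounded_clinearI[OF w(1,2)] by (simp add: bounded_clinear_def)
  then have \<omega>: "blinfun_apply \<omega> f = w f" for f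
    by (simp add: \<omega>_def bounded_linear_Blinfun_apply)
  have "\<mu> - \<omega> \<in> cspan (delta ` F)"
  proof (rule in_cspan_if_common_kernel)
    show "clinear (blinfun_apply (\<mu> - \<omega>))"
      using \<mu> w(1) by (auto simp: clinear_iff blinfun.diff_left \<omega> scaleC_complex_def algebra_simps)
    fix f assume "\<And>\<phi>. \<phi> \<in> delta ` F \<Longrightarrow> blinfun_apply \<phi> f = 0"
    then have "blinfun_apply (delta x) f = 0" if "x \<in> F" for x using that by blast
    then have "f \<in> N" by (simp add: N_def delta.rep_eq)
    then show "blinfun_apply (\<mu> - \<omega>) f = 0"
      by (simp add: blinfun.diff_left \<omega> w(3))
  qed (use F clinear_delta in auto)
  moreover have "cspan (delta ` F) \<subseteq> cspan (delta ` ball 0 1)"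
    using F(2) K(2) by (intro complex_vector.span_mono) auto
  moreover have "norm \<omega> \<le> c * d"
    using w(2) d(1) \<open>0 \<le> c\<close> by (intro norm_blinfun_bound) (auto simp: \<omega>)
  ultimately show "\<exists>\<nu>\<in>cspan (delta ` ball 0 1). dist \<nu> \<mu> < e"
    using d(2) by (intro bexI[of _ "\<mu> - \<omega>"]) (auto simp: dist_norm)
qed

lemma cspan_delta_bound:
  assumes "\<mu> \<in> cspan (delta ` ball (0::'a::complex_normed_vector) 1)"
  shows "\<exists>F c. finite F \<and> F \<subseteq> ball 0 1 \<and> 0 \<le> c \<and>
    (\<forall>f s. 0 \<le> s \<longrightarrow> (\<forall>x\<in>F. norm (HL0_apply f x) \<le> s) \<longrightarrow> norm (blinfun_apply \<mu> f) \<le> c * s)"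
  using assms
proof (induction rule: complex_vector.span_induct_alt)
  case base
  show ?case by (rule exI[of _ "{}"], rule exI[of _ 0]) simp
next
  case (step a \<phi> \<mu>)
  obtain z where z: "\<phi> = delta z" "z \<in> ball 0 1" using step(1) by auto
  obtain F c where F: "finite F" "F \<subseteq> ball 0 1" "0 \<le> c"
    "\<And>f s. 0 \<le> s \<Longrightarrow> (\<And>x. x \<in> F \<Longrightarrow> norm (HL0_apply f x) \<le> s) \<Longrightarrow> norm (blinfun_apply \<mu> f) \<le> c * s"
    using step(2) by metis
  have "norm (blinfun_apply (a *\<^sub>C \<phi> + \<mu>) f) \<le> (cmod a + c) * s"
    if "0 \<le> s" "\<forall>x\<in>insert z F. norm (HL0_apply f x) \<le> s" for f s
  proof -
    have "norm (blinfun_apply (a *\<^sub>C \<phi> + \<mu>) f) \<le> cmod a * norm (HL0_apply f z) + norm (blinfun_apply \<mu> f)"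
      by (simp add: blinfun.add_left scaleC_blinfun.rep_eq z scaleC_complex_def delta.rep_eq
          norm_triangle_le norm_mult)
    also have "\<dots> \<le> cmod a * s + c * s"
      using that by (intro add_mono mult_left_mono F(4)) auto
    finally show ?thesis by (simp add: algebra_simps)
  qed
  then show ?case
    using F z by (intro exI[of _ "insert z F"] exI[of _ "cmod a + c"]) auto
qed

text \<open>On bounded sets of \<open>HL0\<close>, an element of the predual is continuous for pointwise convergence: it is
within small norm of a finite combination of evaluations.\<close>

lemma G0_pointwise_small:
  fixes \<nu> :: "('a::complex_normed_vector, complex) HL0 \<Rightarrow>\<^sub>L complex"
  assumes \<nu>: "\<nu> \<in> G0" and "0 < e" "0 \<le> C"
  obtains F d where "finite F" "F \<subseteq> ball 0 1" "0 < d"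
    "\<And>f. norm f \<le> C \<Longrightarrow> (\<And>x. x \<in> F \<Longrightarrow> norm (HL0_apply f x) \<le> d) \<Longrightarrow> norm (blinfun_apply \<nu> f) < e"
proof -
  define e' where "e' = e / (2 * (C + 1))"
  have e': "0 < e'" "e' * C < e / 2"
    using \<open>0 < e\<close> \<open>0 \<le> C\<close> by (auto simp: e'_def field_simps)
  obtain \<mu> where \<mu>: "\<mu> \<in> cspan (delta ` ball 0 1)" "dist \<mu> \<nu> < e'"
    using \<nu> e'(1) unfolding G0_def closure_approachable by blast
  obtain F c where F: "finite F" "F \<subseteq> ball 0 1" "0 \<le> c"
    "\<And>f s. 0 \<le> s \<Longrightarrow> (\<And>x. x \<in> F \<Longrightarrow> norm (HL0_apply f x) \<le> s) \<Longrightarrow> norm (blinfun_apply \<mu> f) \<le> c * s"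
    using cspan_delta_bound[OF \<mu>(1)] by metis
  define d where "d = e / (2 * (c + 1))"
  have d: "0 < d" "c * d < e / 2"
    using \<open>0 < e\<close> \<open>0 \<le> c\<close> by (auto simp: d_def field_simps)
  show ?thesis
  proof (rule that[of F d])
    fix f :: "('a, complex) HL0" assume f: "norm f \<le> C" "\<And>x. x \<in> F \<Longrightarrow> norm (HL0_apply f x) \<le> d"
    have "norm (blinfun_apply (\<nu> - \<mu>) f) \<le> norm (\<nu> - \<mu>) * norm f"
      by (rule norm_blinfun)
    also have "\<dots> \<le> e' * C"
      using \<mu>(2) f(1) e' by (intro mult_mono) (auto simp: dist_norm norm_minus_commute)
    also have "\<dots> < e / 2" by (rule e')
    finally have "norm (blinfun_apply (\<nu> - \<mu>) f) < e / 2" .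
    moreover have "norm (blinfun_apply \<mu> f) < e / 2"
      using F(4)[of d f] d f(2) by force
    ultimately show "norm (blinfun_apply \<nu> f) < e"
      using norm_triangle_ineq[of "blinfun_apply (\<nu> - \<mu>) f" "blinfun_apply \<mu> f"]
      by (simp add: blinfun.diff_left)
  qed (use F d in auto)
qed

lemma HL0_norm_le_pointwise_limit:
  fixes f :: "('a::complex_normed_vector, 'b::complex_normed_vector) HL0"
  assumes "\<And>n. norm (F n) \<le> C"
    and "\<And>x. x \<in> ball 0 1 \<Longrightarrow> (\<lambda>n. HL0_apply (F n) x) \<longlonglongrightarrow> HL0_apply f x"
  shows "norm f \<le> C"
proof (rule HL0_norm_le)
  show "0 \<le> C" using assms(1)[of 0] HL0_norm_nonneg[of "F 0"] by linarith
  fix x y :: 'a assume xy: "x \<in> ball 0 1" "y \<in> ball 0 1"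
  have "(\<lambda>n. norm (HL0_apply (F n) x - HL0_apply (F n) y)) \<longlonglongrightarrow> norm (HL0_apply f x - HL0_apply f y)"
    by (intro tendsto_intros assms xy)
  moreover have "norm (HL0_apply (F n) x - HL0_apply (F n) y) \<le> C * norm (x - y)" for n
    using HL0_norm_bound[OF xy, of "F n"] mult_right_mono[OF assms(1)[of n] norm_ge_zero[of "x - y"]]
    by linarith
  ultimately show "norm (HL0_apply f x - HL0_apply f y) \<le> C * norm (x - y)"
    by (intro LIMSEQ_le_const2) auto
qed

lemma G0_tendsto:
  fixes \<nu> :: "('a::complex_normed_vector, complex) HL0 \<Rightarrow>\<^sub>L complex"
  assumes \<nu>: "\<nu> \<in> G0" and C: "\<And>n. norm (F n) \<le> C"
    and lim: "\<And>x. x \<in> ball 0 1 \<Longrightarrow> (\<lambda>n. HL0_apply (F n) x) \<longlonglongrightarrow> HL0_apply f x"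
  shows "(\<lambda>n. blinfun_apply \<nu> (F n)) \<longlonglongrightarrow> blinfun_apply \<nu> f"
proof (rule LIMSEQ_I)
  fix e :: real assume "0 < e"
  have f: "norm f \<le> C" by (rule HL0_norm_le_pointwise_limit[OF C lim])
  then have "0 \<le> 2 * C" using HL0_norm_nonneg[of f] by linarith
  then obtain S d where S: "finite S" "S \<subseteq> ball 0 1" "0 < d"
    "\<And>g. norm g \<le> 2 * C \<Longrightarrow> (\<And>x. x \<in> S \<Longrightarrow> norm (HL0_apply g x) \<le> d) \<Longrightarrow> norm (blinfun_apply \<nu> g) < e"
    using G0_pointwise_small[OF \<nu> \<open>0 < e\<close>] by metis
  have "\<forall>\<^sub>F n in sequentially. dist (HL0_apply (F n) x) (HL0_apply f x) < d" if "x \<in> S" for x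
    using lim[of x] that S by (intro tendstoD) auto
  then have "\<forall>\<^sub>F n in sequentially. \<forall>x\<in>S. dist (HL0_apply (F n) x) (HL0_apply f x) < d"
    using S(1) by (simp add: eventually_ball_finite)
  then obtain N where N: "\<And>n x. n \<ge> N \<Longrightarrow> x \<in> S \<Longrightarrow> dist (HL0_apply (F n) x) (HL0_apply f x) < d"
    by (auto simp: eventually_sequentially)
  have "norm (blinfun_apply \<nu> (F n) - blinfun_apply \<nu> f) < e" if "n \<ge> N" for n
  proof -
    have "norm (F n - f) \<le> 2 * C"
      using norm_triangle_ineq4[of "F n" f] C[of n] f by linarith
    then have "norm (blinfun_apply \<nu> (F n - f)) < e"
      using N[OF that] by (intro S(4)) (auto simp: HL0_apply_minus dist_norm less_imp_le)
    then show ?thesis by (simp add: blinfun.diff_right)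
  qed
  then show "\<exists>N. \<forall>n\<ge>N. norm (blinfun_apply \<nu> (F n) - blinfun_apply \<nu> f) < e" by blast
qed

section \<open>Holomorphy along complex lines\<close>

lemma bounded_linear_scaleC_left: "bounded_linear (\<lambda>t. t *\<^sub>C (b::'a::complex_normed_vector))"
  by (rule bounded_linear_intro[where K = "norm b"])
    (simp_all add: scaleC_add_left scaleR_scaleC scaleC_scaleC norm_scaleC scaleR_conv_of_real scaleC_complex_def)

lemma line_has_field_derivative:
  fixes g :: "'a::complex_normed_vector \<Rightarrow> complex"
  assumes "(g has_derivative D) (at (a + t *\<^sub>C b))" "clinear D"
  shows "((\<lambda>t. g (a + t *\<^sub>C b)) has_field_derivative D b) (at t)"
proof -
  have "((\<lambda>t. a + t *\<^sub>C b) has_derivative (\<lambda>s. 0 + s *\<^sub>C b)) (at t)"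
    by (rule has_derivative_add[OF has_derivative_const
          bounded_linear.has_derivative[OF bounded_linear_scaleC_left has_derivative_ident]])
  then have "((\<lambda>t. g (a + t *\<^sub>C b)) has_derivative (\<lambda>s. D (0 + s *\<^sub>C b))) (at t)"
    by (rule has_derivative_compose) (rule assms)
  then show ?thesis
    unfolding has_field_derivative_def
    by (rule has_derivative_eq_rhs) (simp add: fun_eq_iff clinear_scaleC[OF assms(2)] scaleC_complex_def mult.commute)
qed

lemma line_holomorphic:
  fixes g :: "'a::complex_normed_vector \<Rightarrow> complex"
  assumes "cfrechet_holomorphic_on g S" "\<And>t. t \<in> T \<Longrightarrow> a + t *\<^sub>C b \<in> S"
  shows "(\<lambda>t. g (a + t *\<^sub>C b)) holomorphic_on T"
proof -
  have "\<exists>f'. ((\<lambda>t. g (a + t *\<^sub>C b)) has_field_derivative f') (at t)" if t: "t \<in> T" for t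
  proof -
    obtain D where "bounded_clinear D" "(g has_derivative D) (at (a + t *\<^sub>C b))"
      using assms t unfolding cfrechet_holomorphic_on_def by blast
    then show ?thesis
      using line_has_field_derivative unfolding bounded_clinear_def by blast
  qed
  then show ?thesis
    by (auto simp: holomorphic_on_def field_differentiable_def intro: has_field_derivative_at_within)
qed

lemma HL0_holomorphic: "cfrechet_holomorphic_on (HL0_apply f) (ball 0 1)"
  using HL0_apply[of f] by (simp add: HL0_set_def)

lemma norm_line_in_ball:
  assumes "norm a + r * norm b \<le> 1" "t \<in> ball 0 r" "b \<noteq> 0"
  shows "a + t *\<^sub>C b \<in> ball 0 (1::real)"
proof -
  have "norm (a + t *\<^sub>C b) \<le> norm a + cmod t * norm b"
    by (metis norm_triangle_ineq norm_scaleC)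
  also have "\<dots> < norm a + r * norm b" using assms by simp
  finally show ?thesis using assms by simp
qed

text \<open>Difference quotients along a complex line are bounded by the Lipschitz constant.\<close>

lemma HL0_derivative_bound:
  fixes f :: "('a::complex_normed_vector, complex) HL0"
  assumes y: "y \<in> ball 0 1" and D: "(HL0_apply f has_derivative D) (at y)" "clinear D"
  shows "norm (D v) \<le> norm f * norm v"
proof -
  let ?w = "\<lambda>t. HL0_apply f (y + t *\<^sub>C v)"
  have "(?w has_field_derivative D v) (at 0)"
    by (rule line_has_field_derivative) (use D in simp_all)
  then have lim: "((\<lambda>t. (?w t - ?w 0) / (t - 0)) \<longlongrightarrow> D v) (at 0)"
    by (simp add: has_field_derivative_iff)
  have "((\<lambda>t. y + t *\<^sub>C v) \<longlongrightarrow> y + 0 *\<^sub>C v) (at 0)"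
    by (rule tendsto_add[OF tendsto_const bounded_linear.tendsto[OF bounded_linear_scaleC_left tendsto_ident_at]])
  then have "\<forall>\<^sub>F t in at 0. y + t *\<^sub>C v \<in> ball 0 1"
    using y by (intro topological_tendstoD) auto
  then have "\<forall>\<^sub>F t in at 0. norm ((?w t - ?w 0) / (t - 0)) \<le> norm f * norm v"
  proof (rule eventually_rev_mp, intro eventuallyI impI)
    fix t assume t: "y + t *\<^sub>C v \<in> ball 0 1"
    have "norm (?w t - ?w 0) \<le> norm f * (cmod t * norm v)"
      using HL0_norm_bound[OF t, of y f] y by (simp add: norm_scaleC)
    then show "norm ((?w t - ?w 0) / (t - 0)) \<le> norm f * norm v"
      by (cases "t = 0") (simp_all add: norm_divide divide_le_eq mult_ac HL0_norm_nonneg)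
  qed
  with lim show ?thesis
    by (rule Lim_norm_ubound[rotated]) simp
qed

text \<open>On a complex line through \<open>y\<close> the difference quotient of \<open>f\<close> at \<open>y\<close> is a holomorphic function on a disc
of radius \<open>1 - norm y\<close>, bounded by the Lipschitz constant. The Schwarz lemma, applied to its deviation
from the value at the centre, bounds that deviation linearly. The strict inequality for \<open>L\<close> matches
the strict bound in the hypothesis of the Schwarz lemma.\<close>

lemma HL0_quadratic_remainder:
  fixes f :: "('a::complex_normed_vector, complex) HL0"
  assumes y: "y \<in> ball 0 1" and D: "(HL0_apply f has_derivative D) (at y)" "clinear D"
    and L: "norm f < L" and h: "norm h < 1 - norm y"
  shows "norm (HL0_apply f (y + h) - HL0_apply f y - D h) \<le> 2 * L / (1 - norm y) * (norm h)\<^sup>2"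
proof (cases "h = 0")
  case True
  then show ?thesis by (simp add: clinear_zero[OF D(2)])
next
  case False
  define R where "R = 1 - norm y"
  \<comment> \<open>Direction of \<open>h\<close>, scaled so that the open unit disc parametrizes the part of the line inside the ball around \<open>y\<close> of radius \<open>R\<close>.\<close>
  define u where "u = (R / norm h) *\<^sub>R h"
  have R: "0 < R" and "0 < L"
    using y le_less_trans[OF HL0_norm_nonneg L] by (simp_all add: R_def)
  have u: "norm u = R" using False R by (simp add: u_def)
  then have "u \<noteq> 0" using R by auto
  have inball: "y + t *\<^sub>C u \<in> ball 0 1" if "t \<in> ball 0 1" for t
    by (rule norm_line_in_ball[OF _ that \<open>u \<noteq> 0\<close>]) (simp add: u R_def)
  define w where "w t = HL0_apply f (y + t *\<^sub>C u) - HL0_apply f y" for t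
  have w: "w holomorphic_on ball 0 1"
    unfolding w_def by (intro holomorphic_intros line_holomorphic[OF HL0_holomorphic] inball)
  have w_bound: "norm (w t) \<le> norm f * (cmod t * R)" if "t \<in> ball 0 1" for t
    using HL0_norm_bound[OF inball[OF that] y, of f] by (simp add: w_def norm_scaleC u)
  have "((\<lambda>t. HL0_apply f (y + t *\<^sub>C u)) has_field_derivative D u) (at 0)"
    by (rule line_has_field_derivative) (use D in simp_all)
  then have "(w has_field_derivative D u) (at 0)"
    unfolding w_def by (auto intro!: derivative_eq_intros)
  then have dw: "deriv w 0 = D u" by (rule DERIV_imp_deriv)
  define F where "F t = (if t = 0 then D u else w t / t)" for t
  have F: "F holomorphic_on ball 0 1"
    by (rule pole_theorem_0[OF w, of 0]) (auto simp: F_def dw, simp add: w_def)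
  have F_bound: "norm (F t) \<le> norm f * R" if "t \<in> ball 0 1" for t
    using w_bound[OF that] HL0_derivative_bound[OF y D, of u] u
    by (auto simp: F_def norm_divide divide_le_eq mult_ac)
  define G where "G t = (F t - F 0) / of_real (2 * L * R)" for t
  have "norm (F t - F 0) < 2 * L * R" if "norm t < 1" for t
  proof -
    have "norm (F t - F 0) \<le> norm f * R + norm f * R"
      using F_bound[of t] F_bound[of 0] that
      by (intro order_trans[OF norm_triangle_ineq4] add_mono) (auto simp del: zero_le_mult_iff)
    also have "\<dots> < L * R + L * R"
      using L R by (intro add_strict_mono mult_strict_right_mono)
    finally show ?thesis by (simp add: algebra_simps)
  qed
  then have G_bound: "norm (G t) < 1" if "norm t < 1" for t
    using that R \<open>0 < L\<close> by (simp add: G_def norm_divide norm_mult)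
  have G: "G holomorphic_on ball 0 1"
    unfolding G_def by (intro holomorphic_intros F) (use R \<open>0 < L\<close> in auto)
  define t where "t = complex_of_real (norm h / R)"
  have t: "norm t = norm h / R" "norm t < 1" "t \<noteq> 0"
    using R h False unfolding t_def norm_of_real R_def[symmetric] by auto
  have tu: "t *\<^sub>C u = h"
    using False R unfolding t_def u_def scaleR_scaleC[symmetric] by simp
  have "norm (G t) \<le> norm t"
    by (rule Schwarz_Lemma(1)[OF G _ G_bound t(2)]) (simp add: G_def)
  then have "norm (F t - F 0) \<le> 2 * L * R * norm t"
    using R \<open>0 < L\<close> by (simp add: G_def norm_divide norm_mult divide_le_eq mult_ac)
  then have "norm t * norm (F t - F 0) \<le> norm t * (2 * L * R * norm t)"
    by (rule mult_left_mono) simp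
  also have "\<dots> = 2 * L / R * (norm h)\<^sup>2"
    using R by (simp add: t(1) power2_eq_square)
  also have "norm t * norm (F t - F 0) = norm (w t - t * D u)"
    using t(3) by (simp add: F_def right_diff_distrib flip: norm_mult)
  also have "w t - t * D u = HL0_apply f (y + h) - HL0_apply f y - D h"
    using clinear_scaleC[OF D(2), of t u] by (simp add: w_def tu scaleC_complex_def)
  finally show ?thesis by (simp add: R_def)
qed

lemma has_derivative_if_quadratic_remainder:
  assumes D: "bounded_linear D" and "0 < R"
    and rem: "\<And>h. norm h < R \<Longrightarrow> norm (g (y + h) - g y - D h) \<le> K * (norm h)\<^sup>2"
  shows "(g has_derivative D) (at y)"
proof (rule has_derivativeI_sandwich[OF \<open>0 < R\<close> D, where H = "\<lambda>z. K * norm (z - y)"])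
  fix z assume z: "z \<noteq> y" "dist z y < R"
  have "norm (g (y + (z - y)) - g y - D (z - y)) \<le> K * (norm (z - y))\<^sup>2"
    using z by (intro rem) (simp add: dist_norm)
  then show "norm (g z - g y - D (z - y)) / norm (z - y) \<le> K * norm (z - y)"
    using z by (simp add: divide_le_eq power2_eq_square mult.assoc)
next
  have "((\<lambda>z. K * norm (z - y)) \<longlongrightarrow> K * norm (y - y)) (at y)"
    by (intro tendsto_intros)
  then show "((\<lambda>z. K * norm (z - y)) \<longlongrightarrow> 0) (at y)" by simp
qed

text \<open>Functions are turned into elements of the type by cutting them off outside the ball; differentiability
at points of the ball is unaffected because the ball is open.\<close>

definition HL0_of :: "('a::complex_normed_vector \<Rightarrow> 'b::complex_normed_vector) \<Rightarrow> ('a, 'b) HL0"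
  where "HL0_of g = Abs_HL0 (\<lambda>x. if x \<in> ball 0 1 then g x else 0)"

lemma HL0_of_Lipschitz_holomorphic:
  fixes g :: "'a::complex_normed_vector \<Rightarrow> 'b::complex_normed_vector"
  assumes "g 0 = 0" "0 \<le> C"
    and lip: "\<And>x y. x \<in> ball 0 1 \<Longrightarrow> y \<in> ball 0 1 \<Longrightarrow> norm (g x - g y) \<le> C * norm (x - y)"
    and hol: "cfrechet_holomorphic_on g (ball 0 1)"
  shows "x \<in> ball 0 1 \<Longrightarrow> HL0_apply (HL0_of g) x = g x" and "norm (HL0_of g) \<le> C"
proof -
  have "(\<lambda>x. if x \<in> ball 0 1 then g x else 0) \<in> HL0_set"
  proof (rule HL0_setI[where C = C])
    show "C-lipschitz_on (ball 0 1) (\<lambda>x. if x \<in> ball 0 1 then g x else 0)"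
      using lip \<open>0 \<le> C\<close> by (intro lipschitz_onI) (auto simp: dist_norm)
    fix x :: 'a assume x: "x \<in> ball 0 1"
    obtain D where D: "bounded_clinear D" "(g has_derivative D) (at x)"
      using hol x unfolding cfrechet_holomorphic_on_def by blast
    have "((\<lambda>x. if x \<in> ball 0 1 then g x else 0) has_derivative D) (at x)"
      by (rule has_derivative_transform_within_open[OF D(2) open_ball x]) simp
    with D(1) show "\<exists>D. bounded_clinear D \<and> ((\<lambda>x. if x \<in> ball 0 1 then g x else 0) has_derivative D) (at x)"
      by blast
  qed (use assms in auto)
  then have eq: "HL0_apply (HL0_of g) = (\<lambda>x. if x \<in> ball 0 1 then g x else 0)"
    by (simp add: HL0_of_def Abs_HL0_inverse)
  show "x \<in> ball 0 1 \<Longrightarrow> HL0_apply (HL0_of g) x = g x"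
    by (simp add: eq)
  show "norm (HL0_of g) \<le> C"
    by (rule HL0_norm_le) (use \<open>0 \<le> C\<close> lip in \<open>auto simp: eq\<close>)
qed

section \<open>Bounded pointwise limits and uniform boundedness\<close>

text \<open>By the uniform quadratic remainder, derivatives of the \<open>F n\<close> at a point are approximated by difference
quotients at a rate that does not depend on \<open>n\<close>. As the difference quotients converge with \<open>n\<close>, so do
the derivatives, and the limit satisfies the same remainder estimate.\<close>

lemma HL0_pointwise_limit:
  fixes F :: "nat \<Rightarrow> ('a::complex_normed_vector, complex) HL0"
  assumes C: "\<And>n. norm (F n) \<le> C"
    and lim: "\<And>x. x \<in> ball 0 1 \<Longrightarrow> (\<lambda>n. HL0_apply (F n) x) \<longlonglongrightarrow> g x"
  obtains f where "\<And>x. x \<in> ball 0 1 \<Longrightarrow> HL0_apply f x = g x" "norm f \<le> C"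
proof -
  have "0 \<le> C" using C[of 0] HL0_norm_nonneg[of "F 0"] by linarith
  have "cfrechet_holomorphic_on g (ball 0 1)"
    unfolding cfrechet_holomorphic_on_def
  proof
    fix y :: 'a assume y: "y \<in> ball 0 1"
    define R where "R = 1 - norm y"
    have R: "0 < R" using y by (simp add: R_def)
    define K where "K = 2 * (C + 1) / R"
    have K: "0 < K" using R \<open>0 \<le> C\<close> by (simp add: K_def)
    have "\<exists>D. bounded_clinear D \<and> (HL0_apply (F n) has_derivative D) (at y)" for n
      using HL0_holomorphic y unfolding cfrechet_holomorphic_on_def by blast
    then obtain D where D: "\<And>n. bounded_clinear (D n)" "\<And>n. (HL0_apply (F n) has_derivative D n) (at y)"
      by metis
    have lin: "clinear (D n)" for n using D(1) by (simp add: bounded_clinear_def)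
    have rem: "norm (HL0_apply (F n) (y + h) - HL0_apply (F n) y - D n h) \<le> K * (norm h)\<^sup>2"
      if "norm h < R" for n h
      unfolding K_def R_def
      by (rule HL0_quadratic_remainder[OF y D(2) lin]) (use C[of n] that in \<open>auto simp: R_def\<close>)
    have near: "norm h < R \<Longrightarrow> y + h \<in> ball 0 1" for h
      using norm_triangle_ineq[of y h] by (simp add: R_def)
    have "Cauchy (\<lambda>n. D n h)" for h
    proof (rule metric_CauchyI)
      fix e :: real assume "0 < e"
      \<comment> \<open>The step is small enough to stay in the ball and to make the remainder, divided by the step, at most a quarter of \<open>e\<close>.\<close>
      define t where "t = min (R / (norm h + 1) / 2) (e / (4 * K * ((norm h)\<^sup>2 + 1)) )"
      have t: "0 < t" using R K \<open>0 < e\<close> by (simp add: t_def add_nonneg_pos)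
      have "t * norm h \<le> R / (norm h + 1) / 2 * norm h"
        by (intro mult_right_mono) (auto simp: t_def)
      also have "\<dots> < R"
        using R by (simp add: divide_simps add_nonneg_pos)
      finally have th: "norm (t *\<^sub>R h) < R" using t by simp
      have "t * (4 * K * ((norm h)\<^sup>2 + 1)) \<le> e / (4 * K * ((norm h)\<^sup>2 + 1)) * (4 * K * ((norm h)\<^sup>2 + 1))"
        using K by (intro mult_right_mono) (auto simp: t_def)
      also have "\<dots> = e" using K by (simp add: add_nonneg_eq_0_iff)
      finally have te: "4 * K * t * (norm h)\<^sup>2 < e"
        using mult_pos_pos[OF K t] by (simp add: algebra_simps)
      let ?s = "\<lambda>n. (HL0_apply (F n) (y + t *\<^sub>R h) - HL0_apply (F n) y) /\<^sub>R t"
      have slope: "dist (?s n) (D n h) \<le> e / 4" for n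
      proof -
        have "?s n - D n h = (HL0_apply (F n) (y + t *\<^sub>R h) - HL0_apply (F n) y - D n (t *\<^sub>R h)) /\<^sub>R t"
          using t by (simp add: clinear_scaleR[OF lin] scaleR_diff_right)
        then have "dist (?s n) (D n h) \<le> K * (norm (t *\<^sub>R h))\<^sup>2 / t"
          using rem[OF th, of n] t by (simp add: dist_norm divide_inverse mult.commute)
        also have "\<dots> = K * t * (norm h)\<^sup>2"
          using t by (simp add: power2_eq_square)
        finally show ?thesis using te by simp
      qed
      have "?s \<longlonglongrightarrow> (g (y + t *\<^sub>R h) - g y) /\<^sub>R t"
        by (intro tendsto_intros lim near th y)
      then have "Cauchy ?s" by (rule LIMSEQ_imp_Cauchy)
      then obtain N where N: "\<And>m n. m \<ge> N \<Longrightarrow> n \<ge> N \<Longrightarrow> dist (?s m) (?s n) < e / 4"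
        using \<open>0 < e\<close> by (meson metric_CauchyD zero_less_divide_iff zero_less_numeral)
      have "dist (D m h) (D n h) < e" if "m \<ge> N" "n \<ge> N" for m n
        using N[OF that] slope[of m] slope[of n] \<open>0 < e\<close>
          dist_triangle[of "D m h" "D n h" "?s m"] dist_triangle[of "?s m" "D n h" "?s n"]
          dist_commute[of "D m h" "?s m"] by linarith
      then show "\<exists>N. \<forall>m\<ge>N. \<forall>n\<ge>N. dist (D m h) (D n h) < e" by blast
    qed
    then have "\<exists>l. (\<lambda>n. D n h) \<longlonglongrightarrow> l" for h
      by (simp add: Cauchy_convergent_iff convergent_def)
    then obtain E where E: "\<And>h. (\<lambda>n. D n h) \<longlonglongrightarrow> E h" by metis
    have "bounded_clinear E"
    proof (rule bounded_clinearI[where c = C])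
      have "E (a + b) = E a + E b" for a b
        using tendsto_add[OF E[of a] E[of b]] E[of "a + b"]
        by (intro LIMSEQ_unique[OF E]) (simp add: clinear_add[OF lin])
      moreover have "E (c *\<^sub>C a) = c *\<^sub>C E a" for c a
        using bounded_linear.tendsto[OF bounded_linear_scaleC[of c] E[of a]]
        by (intro LIMSEQ_unique[OF E]) (simp add: clinear_scaleC[OF lin])
      ultimately show "clinear E" by (simp add: clinear_iff)
      show "norm (E h) \<le> C * norm h" for h
      proof (rule LIMSEQ_le_const2[OF tendsto_norm[OF E]], intro exI allI impI)
        fix n
        show "norm (D n h) \<le> C * norm h"
          using HL0_derivative_bound[OF y D(2) lin, of n h] mult_right_mono[OF C[of n] norm_ge_zero[of h]]
          by linarith
      qed
    qed
    moreover have "(g has_derivative E) (at y)"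
    proof (rule has_derivative_if_quadratic_remainder[OF _ R])
      show "bounded_linear E" using \<open>bounded_clinear E\<close> by (simp add: bounded_clinear_def)
      fix h :: 'a assume h: "norm h < R"
      have "(\<lambda>n. norm (HL0_apply (F n) (y + h) - HL0_apply (F n) y - D n h)) \<longlonglongrightarrow> norm (g (y + h) - g y - E h)"
        by (intro tendsto_intros lim near h y E)
      then show "norm (g (y + h) - g y - E h) \<le> K * (norm h)\<^sup>2"
        by (rule LIMSEQ_le_const2) (use rem[OF h] in blast)
    qed
    ultimately show "\<exists>D. bounded_clinear D \<and> (g has_derivative D) (at y)" by blast
  qed
  moreover have "norm (g x - g y) \<le> C * norm (x - y)" if xy: "x \<in> ball 0 1" "y \<in> ball 0 1" for x y
  proof (rule LIMSEQ_le_const2)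
    show "(\<lambda>n. norm (HL0_apply (F n) x - HL0_apply (F n) y)) \<longlonglongrightarrow> norm (g x - g y)"
      by (intro tendsto_intros lim xy)
    have "norm (HL0_apply (F n) x - HL0_apply (F n) y) \<le> C * norm (x - y)" for n
      using HL0_norm_bound[OF xy, of "F n"] mult_right_mono[OF C[of n] norm_ge_zero[of "x - y"]] by linarith
    then show "\<exists>N. \<forall>n\<ge>N. norm (HL0_apply (F n) x - HL0_apply (F n) y) \<le> C * norm (x - y)"
      by blast
  qed
  moreover have "g 0 = 0"
    using lim[of 0] by (simp add: LIMSEQ_const_iff)
  ultimately show ?thesis
    using HL0_of_Lipschitz_holomorphic[of g C] \<open>0 \<le> C\<close> by (intro that[of "HL0_of g"]) auto
qed

lemma HL0_complete: "complete (UNIV :: ('a::complex_normed_vector, complex) HL0 set)"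
proof (rule completeI)
  fix F :: "nat \<Rightarrow> ('a, complex) HL0" assume F: "Cauchy F"
  have "\<exists>l. (\<lambda>n. HL0_apply (F n) x) \<longlonglongrightarrow> l" for x
  proof -
    have "Cauchy (\<lambda>n. blinfun_apply (delta x) (F n))"
      by (rule bounded_linear.Cauchy[OF blinfun.bounded_linear_right F])
    then show ?thesis by (simp add: delta.rep_eq Cauchy_convergent_iff convergent_def)
  qed
  then obtain g where g: "\<And>x. (\<lambda>n. HL0_apply (F n) x) \<longlonglongrightarrow> g x" by metis
  obtain C where "\<And>n. norm (F n) \<le> C"
    using Cauchy_Bseq[OF F] unfolding Bseq_def by blast
  from HL0_pointwise_limit[OF this g]
  obtain f where f: "\<And>x. x \<in> ball 0 1 \<Longrightarrow> HL0_apply f x = g x" by blast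
  have "F \<longlonglongrightarrow> f"
  proof (rule LIMSEQ_I)
    fix e :: real assume "0 < e"
    obtain N where N: "\<And>m n. m \<ge> N \<Longrightarrow> n \<ge> N \<Longrightarrow> norm (F m - F n) < e / 2"
      using CauchyD[OF F, of "e / 2"] \<open>0 < e\<close> by auto
    have "norm (F m - f) \<le> e / 2" if "m \<ge> N" for m
    proof (rule HL0_norm_le_pointwise_limit[where F = "\<lambda>n. F m - F (n + N)"])
      show "norm (F m - F (n + N)) \<le> e / 2" for n using N[OF that, of "n + N"] by simp
      fix x :: 'a assume x: "x \<in> ball 0 1"
      show "(\<lambda>n. HL0_apply (F m - F (n + N)) x) \<longlonglongrightarrow> HL0_apply (F m - f) x"
        unfolding HL0_apply_minus f[OF x]
        by (intro tendsto_intros LIMSEQ_ignore_initial_segment[OF g])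
    qed
    then show "\<exists>N. \<forall>n\<ge>N. norm (F n - f) < e"
      using \<open>0 < e\<close> by (intro exI[of _ N]) force
  qed
  then show "\<exists>l\<in>UNIV. F \<longlonglongrightarrow> l" by blast
qed

text \<open>Uniform boundedness: the norm of \<open>A f\<close> is a supremum of continuous functions of \<open>f\<close>, so its sublevel
sets are closed, and by Baire's theorem one of them contains a ball.\<close>

lemma clinear_bounded_if_pointwise_bounded:
  fixes A :: "('a::complex_normed_vector, complex) HL0 \<Rightarrow> ('b::complex_normed_vector, complex) HL0"
  assumes A: "clinear A" and cont: "\<And>y. y \<in> ball 0 1 \<Longrightarrow> continuous_on UNIV (\<lambda>f. HL0_apply (A f) y)"
  obtains c where "0 \<le> c" "\<And>f. norm (A f) \<le> c * norm f"
proof -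
  define E where "E n = {f. norm (A f) \<le> real n}" for n
  have closed: "closed (E n)" for n
  proof -
    have "E n = (\<Inter>x\<in>ball 0 1. \<Inter>y\<in>ball 0 1.
        {f. norm (HL0_apply (A f) x - HL0_apply (A f) y) \<le> real n * norm (x - y)})" (is "_ = ?I")
    proof (intro set_eqI iffI)
      fix f assume f: "f \<in> E n"
      have "norm (HL0_apply (A f) x - HL0_apply (A f) y) \<le> real n * norm (x - y)"
        if xy: "x \<in> ball 0 1" "y \<in> ball 0 1" for x y
        using HL0_norm_bound[OF xy, of "A f"] f mult_right_mono[of "norm (A f)" "real n" "norm (x - y)"]
        by (simp add: E_def)
      then show "f \<in> ?I" by blast
    next
      fix f assume "f \<in> ?I"
      then have "norm (A f) \<le> real n" by (intro HL0_norm_le) auto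
      then show "f \<in> E n" by (simp add: E_def)
    qed
    also have "closed ?I"
      by (intro closed_INT ballI closed_Collect_le continuous_intros cont)
    finally show ?thesis .
  qed
  have cover: "\<Union>(range E) = UNIV"
    using real_arch_simple by (fastforce simp: E_def)
  have "\<exists>n. interior (E n) \<noteq> {}"
  proof (rule ccontr)
    assume *: "\<not> (\<exists>n. interior (E n) \<noteq> {})"
    have "completely_metrizable_space (euclidean :: ('a, complex) HL0 topology)"
      using Met_TC.completely_metrizable_space_mtopology HL0_complete by auto
    then have "euclidean interior_of \<Union>(range E) = {}"
      using * closed by (intro Baire_category_alt) auto
    then show False by (simp add: cover)
  qed
  then obtain n f0 r where r: "0 < r" "ball f0 r \<subseteq> E n"
    by (meson ex_in_conv mem_interior)
  have "norm (A f) \<le> (4 * n / r) * norm f" for f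
  proof (cases "f = 0")
    case True
    then show ?thesis by (simp add: clinear_zero[OF A])
  next
    case False
    define s where "s = r / (2 * norm f)"
    have s: "0 < s" using r False by (simp add: s_def)
    have "norm (s *\<^sub>R f) < r" using r False by (simp add: s_def)
    then have "f0 + s *\<^sub>R f \<in> E n" "f0 \<in> E n"
      using r by (auto simp: dist_norm subset_eq)
    moreover have "A (s *\<^sub>R f) = A (f0 + s *\<^sub>R f) - A f0"
      by (simp add: clinear_add[OF A])
    ultimately have "norm (A (s *\<^sub>R f)) \<le> 2 * n"
      using norm_triangle_ineq4[of "A (f0 + s *\<^sub>R f)" "A f0"] by (simp add: E_def)
    then have "s * norm (A f) \<le> 2 * n"
      using s by (simp add: clinear_scaleR[OF A])
    then show ?thesis using s r False by (simp add: s_def field_simps)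
  qed
  then show ?thesis using r by (intro that[of "4 * n / r"]) auto
qed

section \<open>Weakly holomorphic maps\<close>

text \<open>The remainder estimate holds for \<open>w \<circ> \<phi>\<close> uniformly over all functionals \<open>w\<close> of norm at most 1. Norming
functionals turn it into an estimate in norm: the difference quotients of \<open>\<phi>\<close> are Cauchy, their
limit is linear since it is so after applying any \<open>w\<close>, and it is the Frechet derivative.\<close>

lemma weakly_HL0:
  fixes \<phi> :: "'b::complex_normed_vector \<Rightarrow> 'a::cbanach"
  assumes "\<phi> 0 = 0" and "0 \<le> c"
    and weak: "\<And>w. clinear w \<Longrightarrow> (\<And>x. norm (w x) \<le> norm x) \<Longrightarrow>
      \<exists>f :: ('b, complex) HL0. norm f \<le> c \<and> (\<forall>y\<in>ball 0 1. HL0_apply f y = w (\<phi> y))"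
  obtains \<Phi> :: "('b, 'a) HL0" where "\<And>y. y \<in> ball 0 1 \<Longrightarrow> HL0_apply \<Phi> y = \<phi> y"
proof -
  have lip: "norm (\<phi> x - \<phi> y) \<le> c * norm (x - y)" if xy: "x \<in> ball 0 1" "y \<in> ball 0 1" for x y
  proof (rule norming_functional_bound)
    fix w :: "'a \<Rightarrow> complex" assume w: "clinear w" "\<And>x. norm (w x) \<le> norm x"
    obtain f :: "('b, complex) HL0" where f: "norm f \<le> c" "\<And>y. y \<in> ball 0 1 \<Longrightarrow> HL0_apply f y = w (\<phi> y)"
      using weak[OF w] by auto
    have "norm (w (\<phi> x - \<phi> y)) = norm (HL0_apply f x - HL0_apply f y)"
      by (simp add: f(2)[OF xy(1)] f(2)[OF xy(2)] clinear_diff[OF w(1)])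
    also have "\<dots> \<le> norm f * norm (x - y)" by (rule HL0_norm_bound[OF xy])
    also have "\<dots> \<le> c * norm (x - y)" using f(1) by (rule mult_right_mono) simp
    finally show "norm (w (\<phi> x - \<phi> y)) \<le> c * norm (x - y)" .
  qed
  have "cfrechet_holomorphic_on \<phi> (ball 0 1)"
    unfolding cfrechet_holomorphic_on_def
  proof
    fix y :: 'b assume y: "y \<in> ball 0 1"
    define R where "R = 1 - norm y"
    have R: "0 < R" using y by (simp add: R_def)
    have near: "norm h < R \<Longrightarrow> y + h \<in> ball 0 1" for h
      using norm_triangle_ineq[of y h] by (simp add: R_def)
    define K where "K = 2 * (c + 1) / R"
    have K: "0 < K" using R \<open>0 \<le> c\<close> by (simp add: K_def)
    have weak_derivative: "\<exists>D. clinear D \<and> (\<forall>h. norm (D h) \<le> c * norm h) \<and>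
        (\<forall>h. norm h < R \<longrightarrow> norm (w (\<phi> (y + h) - \<phi> y) - D h) \<le> K * (norm h)\<^sup>2)"
      if w: "clinear w" "\<And>x. norm (w x) \<le> norm x" for w :: "'a \<Rightarrow> complex"
    proof -
      obtain f :: "('b, complex) HL0" where f: "norm f \<le> c" "\<And>y. y \<in> ball 0 1 \<Longrightarrow> HL0_apply f y = w (\<phi> y)"
        using weak[OF w] by auto
      obtain D where D: "bounded_clinear D" "(HL0_apply f has_derivative D) (at y)"
        using HL0_holomorphic y unfolding cfrechet_holomorphic_on_def by blast
      have "clinear D" using D(1) by (simp add: bounded_clinear_def)
      moreover have "norm (D h) \<le> c * norm h" for h
        using HL0_derivative_bound[OF y D(2) \<open>clinear D\<close>, of h] mult_right_mono[OF f(1) norm_ge_zero[of h]]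
        by linarith
      moreover have "norm (w (\<phi> (y + h) - \<phi> y) - D h) \<le> K * (norm h)\<^sup>2" if h: "norm h < R" for h
        using HL0_quadratic_remainder[OF y D(2) \<open>clinear D\<close>, of "c + 1" h] f h near[OF h] y
        by (simp add: clinear_diff[OF w(1)] K_def R_def)
      ultimately show ?thesis by blast
    qed
    define s where "s h n = (\<phi> (y + inverse (real (Suc n)) *\<^sub>R h) - \<phi> y) /\<^sub>R inverse (real (Suc n))" for h n
    have small: "\<exists>N. \<forall>n\<ge>N. norm (inverse (real (Suc n)) *\<^sub>R h) < R" for h :: 'b
    proof -
      have "(\<lambda>n. norm (inverse (real (Suc n)) *\<^sub>R h)) \<longlonglongrightarrow> norm (0 *\<^sub>R h)"
        by (intro tendsto_intros LIMSEQ_inverse_real_of_nat)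
      then show ?thesis
        using order_tendstoD(2)[of _ _ _ R] R by (fastforce simp: eventually_sequentially)
    qed
    have slope: "norm (w (s h n) - D h) \<le> K * (norm h)\<^sup>2 * inverse (real (Suc n))"
      if n: "norm (inverse (real (Suc n)) *\<^sub>R h) < R" and w: "clinear w" and D: "clinear D"
        "\<And>h. norm h < R \<Longrightarrow> norm (w (\<phi> (y + h) - \<phi> y) - D h) \<le> K * (norm h)\<^sup>2" for w :: "'a \<Rightarrow> complex" and D h n
    proof -
      let ?t = "inverse (real (Suc n))"
      have t: "0 < ?t" by simp
      have "w (s h n) - D h = (w (\<phi> (y + ?t *\<^sub>R h) - \<phi> y) - D (?t *\<^sub>R h)) /\<^sub>R ?t"
      proof -
        have "w (s h n) = w (\<phi> (y + ?t *\<^sub>R h) - \<phi> y) /\<^sub>R ?t"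
          unfolding s_def by (rule clinear_scaleR[OF w])
        moreover have "D h = D (?t *\<^sub>R h) /\<^sub>R ?t"
          by (simp add: clinear_scaleR[OF D(1)] del: of_nat_Suc)
        ultimately show ?thesis by (simp only: scaleR_diff_right)
      qed
      then have "norm (w (s h n) - D h) \<le> K * (norm (?t *\<^sub>R h))\<^sup>2 / ?t"
        using D(2)[OF n] t by (simp add: divide_inverse mult.commute del: of_nat_Suc)
      also have "\<dots> = K * (norm h)\<^sup>2 * ?t"
        using t by (simp add: power2_eq_square del: of_nat_Suc)
      finally show ?thesis .
    qed
    have "Cauchy (s h)" for h
    proof (rule metric_CauchyI)
      fix e :: real assume "0 < e"
      obtain N1 where N1: "\<And>n. n \<ge> N1 \<Longrightarrow> norm (inverse (real (Suc n)) *\<^sub>R h) < R"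
        using small by blast
      have "(\<lambda>n. K * (norm h)\<^sup>2 * inverse (real (Suc n))) \<longlonglongrightarrow> K * (norm h)\<^sup>2 * 0"
        by (intro tendsto_intros LIMSEQ_inverse_real_of_nat)
      then obtain N2 where N2: "\<And>n. n \<ge> N2 \<Longrightarrow> K * (norm h)\<^sup>2 * inverse (real (Suc n)) < e / 3"
        using order_tendstoD(2)[of _ _ _ "e / 3"] \<open>0 < e\<close> by (fastforce simp: eventually_sequentially)
      have "dist (s h m) (s h n) < e" if mn: "m \<ge> max N1 N2" "n \<ge> max N1 N2" for m n
      proof -
        have "norm (s h m - s h n) \<le> e / 3 + e / 3"
        proof (rule norming_functional_bound)
          fix w :: "'a \<Rightarrow> complex" assume w: "clinear w" "\<And>x. norm (w x) \<le> norm x"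
          obtain D where D: "clinear D"
            "\<And>h. norm h < R \<Longrightarrow> norm (w (\<phi> (y + h) - \<phi> y) - D h) \<le> K * (norm h)\<^sup>2"
            using weak_derivative[OF w] by blast
          have "norm (w (s h m) - D h) \<le> e / 3" "norm (w (s h n) - D h) \<le> e / 3"
            using slope[OF N1 w(1) D, of m] slope[OF N1 w(1) D, of n] N2[of m] N2[of n] mn by fastforce+
          then show "norm (w (s h m - s h n)) \<le> e / 3 + e / 3"
            using norm_triangle_ineq4[of "w (s h m) - D h" "w (s h n) - D h"]
            by (simp add: clinear_diff[OF w(1)])
        qed
        then show ?thesis using \<open>0 < e\<close> by (simp add: dist_norm)
      qed
      then show "\<exists>M. \<forall>m\<ge>M. \<forall>n\<ge>M. dist (s h m) (s h n) < e" by blast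
    qed
    then have "\<exists>l. s h \<longlonglongrightarrow> l" for h
      by (simp add: Cauchy_convergent_iff convergent_def)
    then obtain E where E: "\<And>h. s h \<longlonglongrightarrow> E h" by metis
    have wE: "w (E h) = D h"
      if w: "clinear w" "\<And>x. norm (w x) \<le> norm x" and D: "clinear D"
        "\<And>h. norm h < R \<Longrightarrow> norm (w (\<phi> (y + h) - \<phi> y) - D h) \<le> K * (norm h)\<^sup>2" for w :: "'a \<Rightarrow> complex" and D h
    proof (rule LIMSEQ_unique)
      have "bounded_linear w"
        using bounded_clinearI[OF w(1), of 1] w(2) by (simp add: bounded_clinear_def)
      then show "(\<lambda>n. w (s h n)) \<longlonglongrightarrow> w (E h)"
        by (rule bounded_linear.tendsto) (rule E)
      obtain N where N: "\<And>n. n \<ge> N \<Longrightarrow> norm (inverse (real (Suc n)) *\<^sub>R h) < R"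
        using small by blast
      have "(\<lambda>n. K * (norm h)\<^sup>2 * inverse (real (Suc n))) \<longlonglongrightarrow> K * (norm h)\<^sup>2 * 0"
        by (intro tendsto_intros LIMSEQ_inverse_real_of_nat)
      then have "(\<lambda>n. K * (norm h)\<^sup>2 * inverse (real (Suc n))) \<longlonglongrightarrow> 0" by simp
      moreover have "\<forall>\<^sub>F n in sequentially. norm (w (s h n) - D h) \<le> K * (norm h)\<^sup>2 * inverse (real (Suc n))"
        unfolding eventually_sequentially using slope[OF N w(1) D] by blast
      ultimately have "(\<lambda>n. w (s h n) - D h) \<longlonglongrightarrow> 0"
        by (rule Lim_null_comparison[rotated])
      then show "(\<lambda>n. w (s h n)) \<longlonglongrightarrow> D h"
        by (rule LIM_zero_cancel)
    qed
    have eqI: "u = v" if "\<And>w::'a \<Rightarrow> complex. clinear w \<Longrightarrow> (\<And>x. norm (w x) \<le> norm x) \<Longrightarrow> w u = w v" for u v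
    proof -
      have "norm (u - v) \<le> 0"
        by (rule norming_functional_bound) (use that in \<open>simp add: clinear_diff\<close>)
      then show ?thesis by simp
    qed
    have "clinear E"
      unfolding clinear_iff
    proof (intro conjI allI; rule eqI)
      fix a b k and w :: "'a \<Rightarrow> complex" assume w: "clinear w" "\<And>x. norm (w x) \<le> norm x"
      obtain D where D: "clinear D"
        "\<And>h. norm h < R \<Longrightarrow> norm (w (\<phi> (y + h) - \<phi> y) - D h) \<le> K * (norm h)\<^sup>2"
        using weak_derivative[OF w] by blast
      show "w (E (a + b)) = w (E a + E b)"
        by (simp add: wE[OF w D] clinear_add[OF w(1)] clinear_add[OF D(1)])
      show "w (E (k *\<^sub>C a)) = w (k *\<^sub>C E a)"
        by (simp add: wE[OF w D] clinear_scaleC[OF w(1)] clinear_scaleC[OF D(1)])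
    qed
    moreover have "norm (E h) \<le> c * norm h" for h
    proof (rule norming_functional_bound)
      fix w :: "'a \<Rightarrow> complex" assume w: "clinear w" "\<And>x. norm (w x) \<le> norm x"
      obtain D where "clinear D" "\<And>h. norm (D h) \<le> c * norm h"
        "\<And>h. norm h < R \<Longrightarrow> norm (w (\<phi> (y + h) - \<phi> y) - D h) \<le> K * (norm h)\<^sup>2"
        using weak_derivative[OF w] by blast
      then show "norm (w (E h)) \<le> c * norm h"
        by (simp add: wE[OF w])
    qed
    ultimately have E_bounded: "bounded_clinear E" by (rule bounded_clinearI)
    moreover have "(\<phi> has_derivative E) (at y)"
    proof (rule has_derivative_if_quadratic_remainder[OF _ R])
      show "bounded_linear E" using E_bounded by (simp add: bounded_clinear_def)
      fix h :: 'b assume h: "norm h < R"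
      show "norm (\<phi> (y + h) - \<phi> y - E h) \<le> K * (norm h)\<^sup>2"
      proof (rule norming_functional_bound)
        fix w :: "'a \<Rightarrow> complex" assume w: "clinear w" "\<And>x. norm (w x) \<le> norm x"
        obtain D where D: "clinear D"
          "\<And>h. norm h < R \<Longrightarrow> norm (w (\<phi> (y + h) - \<phi> y) - D h) \<le> K * (norm h)\<^sup>2"
          using weak_derivative[OF w] by blast
        from D(2)[OF h] show "norm (w (\<phi> (y + h) - \<phi> y - E h)) \<le> K * (norm h)\<^sup>2"
          by (simp add: clinear_diff[OF w(1)] wE[OF w D])
      qed
    qed
    ultimately show "\<exists>D. bounded_clinear D \<and> (\<phi> has_derivative D) (at y)" by blast
  qed
  then show ?thesis
    using HL0_of_Lipschitz_holomorphic(1)[of \<phi> c] assms(1,2) lip by (intro that[of "HL0_of \<phi>"]) auto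
qed

section \<open>Adjoints of operators on the predual\<close>

lemma delta_in_G0: "x \<in> ball 0 1 \<Longrightarrow> delta x \<in> G0"
  unfolding G0_def by (intro subsetD[OF closure_subset] complex_vector.span_base imageI)

lemma G0_add: "\<mu> \<in> G0 \<Longrightarrow> \<nu> \<in> G0 \<Longrightarrow> \<mu> + \<nu> \<in> G0"
  and G0_scaleC: "\<mu> \<in> G0 \<Longrightarrow> c *\<^sub>C \<mu> \<in> G0"
proof -
  assume \<mu>: "\<mu> \<in> G0"
  then obtain m where m: "\<And>n. m n \<in> cspan (delta ` ball 0 1)" "m \<longlonglongrightarrow> \<mu>"
    unfolding G0_def closure_sequential by blast
  show "c *\<^sub>C \<mu> \<in> G0"
    unfolding G0_def closure_sequential
    using m by (intro exI[of _ "\<lambda>n. c *\<^sub>C m n"] conjI allI complex_vector.span_scale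
        bounded_linear.tendsto[OF bounded_linear_scaleC])
  assume \<nu>: "\<nu> \<in> G0"
  then obtain k where k: "\<And>n. k n \<in> cspan (delta ` ball 0 1)" "k \<longlonglongrightarrow> \<nu>"
    unfolding G0_def closure_sequential by blast
  show "\<mu> + \<nu> \<in> G0"
    unfolding G0_def closure_sequential
    using m k by (intro exI[of _ "\<lambda>n. m n + k n"] conjI allI complex_vector.span_add tendsto_add)
qed

text \<open>The composition \<open>\<mu> \<mapsto> \<mu> \<circ> A\<close> is linear and continuous, and the predual is the closed span of the
evaluations, so it suffices that evaluations are sent into the predual.\<close>

lemma adjoint_iff_evaluations_in_G0:
  fixes A :: "('x::complex_normed_vector, complex) HL0 \<Rightarrow> ('y::complex_normed_vector, complex) HL0"
  assumes A: "clinear A"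
  shows "(\<exists>T. continuous_linear_G0 T \<and> is_adjoint_of A T) \<longleftrightarrow>
    (\<forall>y\<in>ball 0 1. \<exists>\<nu>\<in>G0. \<forall>f. HL0_apply (A f) y = blinfun_apply \<nu> f)"
proof
  assume "\<exists>T. continuous_linear_G0 T \<and> is_adjoint_of A T"
  then obtain T where T: "continuous_linear_G0 T" "is_adjoint_of A T" by blast
  show "\<forall>y\<in>ball 0 1. \<exists>\<nu>\<in>G0. \<forall>f. HL0_apply (A f) y = blinfun_apply \<nu> f"
  proof
    fix y :: 'y assume "y \<in> ball 0 1"
    then have y: "delta y \<in> G0" by (rule delta_in_G0)
    then have "T (delta y) \<in> G0" using T(1) by (auto simp: continuous_linear_G0_def)
    moreover have "HL0_apply (A f) y = blinfun_apply (T (delta y)) f" for f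
      using T(2) y unfolding is_adjoint_of_def by (metis delta.rep_eq)
    ultimately show "\<exists>\<nu>\<in>G0. \<forall>f. HL0_apply (A f) y = blinfun_apply \<nu> f" by blast
  qed
next
  assume ev: "\<forall>y\<in>ball 0 1. \<exists>\<nu>\<in>G0. \<forall>f. HL0_apply (A f) y = blinfun_apply \<nu> f"
  have "continuous_on UNIV (\<lambda>f. HL0_apply (A f) y)" if y: "y \<in> ball 0 1" for y
  proof -
    obtain \<nu> where "\<And>f. HL0_apply (A f) y = blinfun_apply \<nu> f" using bspec[OF ev y] by metis
    then have "(\<lambda>f. HL0_apply (A f) y) = blinfun_apply \<nu>" by (rule ext)
    then show ?thesis by (simp add: linear_continuous_on blinfun.bounded_linear_right)
  qed
  then obtain c where c: "\<And>f. norm (A f) \<le> c * norm f"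
    using clinear_bounded_if_pointwise_bounded[OF A] by blast
  have bl: "bounded_linear A"
    using bounded_clinearI[OF A c] by (simp add: bounded_clinear_def)
  define T where "T \<mu> = blinfun_compose \<mu> (Blinfun A)" for \<mu> :: "('y, complex) HL0 \<Rightarrow>\<^sub>L complex"
  have T: "blinfun_apply (T \<mu>) f = blinfun_apply \<mu> (A f)" for \<mu> f
    by (simp add: T_def bounded_linear_Blinfun_apply[OF bl])
  have Tadd: "T (\<mu> + \<nu>) = T \<mu> + T \<nu>" for \<mu> \<nu>
    by (rule blinfun_eqI) (simp add: T blinfun.add_left)
  have TC: "T (a *\<^sub>C \<mu>) = a *\<^sub>C T \<mu>" for a \<mu>
    by (rule blinfun_eqI) (simp add: T scaleC_blinfun.rep_eq)
  have cont: "continuous_on S T" for S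
    unfolding T_def by (intro continuous_intros)
  have "T ` cspan (delta ` ball 0 1) \<subseteq> G0"
  proof -
    have "complex_vector.subspace {\<mu>. T \<mu> \<in> G0}"
      unfolding complex_vector.subspace_def
    proof (intro conjI)
      have "T 0 = 0 *\<^sub>C delta 0" by (simp add: T_def)
      then show "0 \<in> {\<mu>. T \<mu> \<in> G0}"
        using G0_scaleC[OF delta_in_G0, of 0 0] by simp
    qed (auto simp: Tadd TC intro: G0_add G0_scaleC)
    moreover have "T (delta y) \<in> G0" if y: "y \<in> ball 0 1" for y
    proof -
      obtain \<nu> where "\<nu> \<in> G0" "\<And>f. HL0_apply (A f) y = blinfun_apply \<nu> f" using bspec[OF ev y] by metis
      moreover have "T (delta y) = \<nu>"
        by (rule blinfun_eqI) (simp add: T delta.rep_eq calculation(2))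
      ultimately show ?thesis by simp
    qed
    ultimately show ?thesis
      using complex_vector.span_minimal[of "delta ` ball 0 1" "{\<mu>. T \<mu> \<in> G0}"] by blast
  qed
  then have "T ` G0 \<subseteq> G0"
    unfolding G0_def[where 'a = 'y]
    by (intro image_closure_subset cont) (simp_all add: G0_def)
  then have "continuous_linear_G0 T \<and> is_adjoint_of A T"
    by (simp add: continuous_linear_G0_def is_adjoint_of_def cont Tadd TC T)
  then show "\<exists>T. continuous_linear_G0 T \<and> is_adjoint_of A T" by blast
qed

text \<open>Scaling \<open>f\<close> into the neighbourhood shows that \<open>(A f)(y)\<close> is at most \<open>2 / e\<close> times any bound of \<open>f\<close> on
\<open>K\<close>. This covers both topologies, since a neighbourhood for \<open>\<tau>\<^sub>p\<close> is given by a finite set \<open>K\<close>.\<close>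

lemma evaluation_in_G0_if_nbhd:
  fixes A :: "('x::complex_normed_vector, complex) HL0 \<Rightarrow> ('y::complex_normed_vector, complex) HL0"
  assumes A: "clinear A" and K: "compact K" "K \<subseteq> ball 0 1" and "0 < e"
    and nbhd: "\<And>g. (\<And>x. x \<in> K \<Longrightarrow> norm (HL0_apply g x) < e) \<Longrightarrow> norm (HL0_apply (A g) y) < 1"
  shows "\<exists>\<nu>\<in>G0. \<forall>f. HL0_apply (A f) y = blinfun_apply \<nu> f"
proof -
  have bound: "norm (HL0_apply (A f) y) \<le> 2 / e * s"
    if s: "\<And>x. x \<in> K \<Longrightarrow> norm (HL0_apply f x) \<le> s" "0 \<le> s" for f s
  proof (rule field_le_epsilon)
    fix d :: real assume "0 < d"
    define s' where "s' = s + d * e / 2"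
    have s': "s < s'" using \<open>0 < d\<close> \<open>0 < e\<close> by (simp add: s'_def)
    define a where "a = e / (2 * s')"
    have a: "0 < a" using \<open>0 < e\<close> s' s(2) by (simp add: a_def)
    have apply_a: "HL0_apply (a *\<^sub>R g) x = a *\<^sub>R HL0_apply g x" for g :: "('z::complex_normed_vector, complex) HL0" and x
      by (simp add: scaleR_scaleC scaleC_HL0.rep_eq)
    have "norm (HL0_apply (A (a *\<^sub>R f)) y) < 1"
    proof (rule nbhd)
      fix x assume "x \<in> K"
      then have "a * norm (HL0_apply f x) \<le> a * s" using s a by (intro mult_left_mono) auto
      also have "\<dots> \<le> a * s'" using a s' by simp
      also have "\<dots> < e" using s' s(2) \<open>0 < e\<close> by (simp add: a_def)
      finally show "norm (HL0_apply (a *\<^sub>R f) x) < e" using a by (simp add: apply_a)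
    qed
    then have "a * norm (HL0_apply (A f) y) < 1"
      using a by (simp add: clinear_scaleR[OF A] apply_a)
    then have "norm (HL0_apply (A f) y) < 2 / e * s'"
      using \<open>0 < e\<close> s' s(2) by (simp add: a_def field_simps)
    also have "\<dots> = 2 / e * s + d" using \<open>0 < e\<close> by (simp add: s'_def field_simps)
    finally show "norm (HL0_apply (A f) y) \<le> 2 / e * s + d" by simp
  qed
  define u where "u f = HL0_apply (A f) y" for f
  have u: "clinear u"
    by (simp add: u_def clinear_iff clinear_add[OF A] clinear_scaleC[OF A] plus_HL0.rep_eq scaleC_HL0.rep_eq)
  have "norm (u f) \<le> 2 / e * norm f" for f
    unfolding u_def
  proof (rule bound)
    fix x assume "x \<in> K"
    then have "norm f * norm x \<le> norm f * 1" using K(2) by (intro mult_left_mono) auto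
    then show "norm (HL0_apply f x) \<le> norm f" using HL0_apply_bound[of f x] by simp
  qed simp
  then have "bounded_linear u"
    using bounded_clinearI[OF u, of "2 / e"] by (simp add: bounded_clinear_def)
  then have ap: "blinfun_apply (Blinfun u) = u" by (rule bounded_linear_Blinfun_apply)
  have "Blinfun u \<in> G0"
  proof (rule G0_if_bounded_on_compact[OF _ K])
    show "norm (blinfun_apply (Blinfun u) f) \<le> 2 / e * s"
      if "\<And>x. x \<in> K \<Longrightarrow> norm (HL0_apply f x) \<le> s" "0 \<le> s" for f s
      unfolding ap u_def using that by (rule bound)
  qed (use u \<open>0 < e\<close> in \<open>simp_all add: ap\<close>)
  then show ?thesis by (intro bexI[of _ "Blinfun u"]) (simp_all add: ap, simp add: u_def)
qed

lemma evaluation_in_G0_if_tau0_continuous: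
  fixes A :: "('x::complex_normed_vector, complex) HL0 \<Rightarrow> ('y::complex_normed_vector, complex) HL0"
  assumes A: "clinear A" and cont: "continuous_map tau0 tau0 A" and y: "y \<in> ball 0 1"
  shows "\<exists>\<nu>\<in>G0. \<forall>f. HL0_apply (A f) y = blinfun_apply \<nu> f"
proof -
  let ?U = "{h :: ('y, complex) HL0. norm (HL0_apply h y) < 1}"
  have "openin_tau0 ?U"
    unfolding openin_tau0_def
  proof
    fix h assume h: "h \<in> ?U"
    have "g \<in> ?U" if "norm (HL0_apply g y - HL0_apply h y) < 1 - norm (HL0_apply h y)" for g
      using that norm_triangle_ineq2[of "HL0_apply g y" "HL0_apply h y"] by simp
    then show "\<exists>K e. compact K \<and> K \<subseteq> ball 0 1 \<and> 0 < e \<and>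
        {g. \<forall>x\<in>K. norm (HL0_apply g x - HL0_apply h x) < e} \<subseteq> ?U"
      using h y by (intro exI[of _ "{y}"] exI[of _ "1 - norm (HL0_apply h y)"]) auto
  qed
  then have "openin tau0 {f \<in> topspace tau0. A f \<in> ?U}"
    using openin_continuous_map_preimage[OF cont, of ?U] by (simp add: openin_tau0_iff)
  then have U: "openin_tau0 {f. A f \<in> ?U}" by (simp add: openin_tau0_iff)
  have zero: "0 \<in> {f. A f \<in> ?U}" by (simp add: clinear_zero[OF A] zero_HL0.rep_eq)
  obtain K e where K: "compact K" "K \<subseteq> ball 0 1" "0 < e"
    "{g. \<forall>x\<in>K. norm (HL0_apply g x - HL0_apply 0 x) < e} \<subseteq> {f. A f \<in> ?U}"
    using bspec[OF U[unfolded openin_tau0_def] zero] by (elim exE conjE)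
  show ?thesis
    by (rule evaluation_in_G0_if_nbhd[OF A K(1-3)]) (use K(4) in \<open>auto simp: zero_HL0.rep_eq\<close>)
qed

lemma evaluation_in_G0_if_taup_continuous:
  fixes A :: "('x::complex_normed_vector, complex) HL0 \<Rightarrow> ('y::complex_normed_vector, complex) HL0"
  assumes A: "clinear A" and cont: "continuous_map taup taup A" and y: "y \<in> ball 0 1"
  shows "\<exists>\<nu>\<in>G0. \<forall>f. HL0_apply (A f) y = blinfun_apply \<nu> f"
proof -
  let ?P = "product_topology (\<lambda>_::'x. euclidean :: complex topology) (ball 0 1)"
  have "continuous_map taup euclidean ((\<lambda>g. g y) \<circ> (\<lambda>f :: ('y, complex) HL0. restrict (HL0_apply f) (ball 0 1)))"
    unfolding taup_def using y by (intro continuous_map_pullback continuous_map_product_projection)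
  then have "continuous_map taup euclidean (\<lambda>h :: ('y, complex) HL0. HL0_apply h y)"
    using y by (simp add: comp_def)
  from continuous_map_compose[OF cont this]
  have "continuous_map taup euclidean (\<lambda>f. HL0_apply (A f) y)"
    by (simp add: comp_def)
  then have "openin taup {f \<in> topspace taup. HL0_apply (A f) y \<in> ball 0 1}"
    by (rule openin_continuous_map_preimage) simp
  then have "openin taup {f. HL0_apply (A f) y \<in> ball 0 1}" by simp
  then obtain V where V: "openin ?P V"
    "{f. HL0_apply (A f) y \<in> ball 0 1} = (\<lambda>f. restrict (HL0_apply f) (ball 0 1)) -` V"
    by (auto simp only: taup_def openin_pullback_topology Int_UNIV_right)
  have "restrict (HL0_apply (0 :: ('x, complex) HL0)) (ball 0 1) \<in> V"
  proof -
    have "0 \<in> {f. HL0_apply (A f) y \<in> ball 0 1}" by (simp add: clinear_zero[OF A] zero_HL0.rep_eq)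
    then show ?thesis unfolding V(2) by simp
  qed
  from product_topology_open_contains_basis[OF V(1) this]
  obtain X where X: "restrict (HL0_apply (0 :: ('x, complex) HL0)) (ball 0 1) \<in> (\<Pi>\<^sub>E i\<in>ball 0 1. X i)"
    "\<And>i. open (X i)" "finite {i. X i \<noteq> UNIV}" "(\<Pi>\<^sub>E i\<in>ball 0 1. X i) \<subseteq> V"
    by auto
  define K where "K = {i \<in> ball 0 1. X i \<noteq> UNIV}"
  have K: "finite K" "K \<subseteq> ball 0 1"
    using X(3) by (auto simp: K_def)
  have "\<exists>e>0. ball 0 e \<subseteq> X i" if "i \<in> K" for i
  proof -
    have "i \<in> ball 0 1" using that K(2) by blast
    with PiE_mem[OF X(1), of i] have "0 \<in> X i" by (simp add: zero_HL0.rep_eq)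
    then show ?thesis by (rule openE[OF X(2)]) blast
  qed
  then obtain r where r: "\<And>i. i \<in> K \<Longrightarrow> 0 < r i" "\<And>i. i \<in> K \<Longrightarrow> ball 0 (r i) \<subseteq> X i" by metis
  define e where "e = Min (insert 1 (r ` K))"
  have e: "0 < e" "\<And>i. i \<in> K \<Longrightarrow> e \<le> r i"
    using K(1) r(1) by (auto simp: e_def)
  show ?thesis
  proof (rule evaluation_in_G0_if_nbhd[OF A finite_imp_compact[OF K(1)] K(2) e(1)])
    fix g :: "('x, complex) HL0" assume g: "\<And>x. x \<in> K \<Longrightarrow> norm (HL0_apply g x) < e"
    have "HL0_apply g i \<in> X i" if i: "i \<in> ball 0 1" for i
    proof (cases "i \<in> K")
      case True
      then show ?thesis using g[OF True] e(2)[OF True] r(2)[OF True] by (auto simp: subset_eq)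
    next
      case False
      then show ?thesis using i by (auto simp: K_def)
    qed
    then have "restrict (HL0_apply g) (ball 0 1) \<in> V"
      using X(4) by (auto simp: PiE_iff)
    then have "g \<in> {f. HL0_apply (A f) y \<in> ball 0 1}"
      unfolding V(2) by simp
    then show "norm (HL0_apply (A g) y) < 1" by simp
  qed
qed

lemma composition_operator_continuity:
  fixes A :: "('x::complex_normed_vector, complex) HL0 \<Rightarrow> ('y::complex_normed_vector, complex) HL0"
  assumes "composition_operator A"
  shows "\<forall>y\<in>ball 0 1. \<exists>\<nu>\<in>G0. \<forall>f. HL0_apply (A f) y = blinfun_apply \<nu> f"
    and "continuous_map tau0 tau0 A" and "continuous_map taup taup A"
proof -
  obtain \<phi> :: "('y, 'x) HL0" where \<phi>: "\<And>y. y \<in> ball 0 1 \<Longrightarrow> HL0_apply \<phi> y \<in> ball 0 1"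
    and A: "\<And>f y. y \<in> ball 0 1 \<Longrightarrow> HL0_apply (A f) y = HL0_apply f (HL0_apply \<phi> y)"
    using assms unfolding composition_operator_def by blast
  show "\<forall>y\<in>ball 0 1. \<exists>\<nu>\<in>G0. \<forall>f. HL0_apply (A f) y = blinfun_apply \<nu> f"
    using delta_in_G0 \<phi> A by (metis delta.rep_eq)
  have cont: "continuous_on (ball 0 1) (HL0_apply \<phi>)"
    using HL0_lipschitz lipschitz_on_continuous_on by metis
  show "continuous_map tau0 tau0 A"
    unfolding continuous_map_def
  proof (intro conjI allI impI)
    fix U :: "('y, complex) HL0 set" assume "openin tau0 U"
    then have U: "openin_tau0 U" by (simp add: openin_tau0_iff)
    have "openin_tau0 {f. A f \<in> U}"
      unfolding openin_tau0_def
    proof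
      fix f assume "f \<in> {f. A f \<in> U}"
      then have Af: "A f \<in> U" by simp
      obtain K e where K: "compact K" "K \<subseteq> ball 0 1" "0 < e"
        "{g. \<forall>x\<in>K. norm (HL0_apply g x - HL0_apply (A f) x) < e} \<subseteq> U"
        using bspec[OF U[unfolded openin_tau0_def] Af] by (elim exE conjE)
      have "compact (HL0_apply \<phi> ` K)"
        using K(1,2) cont by (intro compact_continuous_image continuous_on_subset[OF cont])
      moreover have "HL0_apply \<phi> ` K \<subseteq> ball 0 1" using \<phi> K(2) by blast
      moreover have "{g. \<forall>x\<in>HL0_apply \<phi> ` K. norm (HL0_apply g x - HL0_apply f x) < e} \<subseteq> {f. A f \<in> U}"
        using K(2,4) by (auto simp: A subset_eq)
      ultimately show "\<exists>K e. compact K \<and> K \<subseteq> ball 0 1 \<and> 0 < e \<and>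
          {g. \<forall>x\<in>K. norm (HL0_apply g x - HL0_apply f x) < e} \<subseteq> {f. A f \<in> U}"
        using K(3) by blast
    qed
    then show "openin tau0 {f \<in> topspace tau0. A f \<in> U}" by (simp add: openin_tau0_iff)
  qed simp
  show "continuous_map taup taup A"
    unfolding taup_def[where 'a = 'y]
  proof (rule continuous_map_pullback')
    have "continuous_map taup euclidean (\<lambda>f. HL0_apply (A f) y)" if y: "y \<in> ball 0 1" for y
    proof -
      have "continuous_map taup euclidean ((\<lambda>g. g (HL0_apply \<phi> y)) \<circ> (\<lambda>f :: ('x, complex) HL0. restrict (HL0_apply f) (ball 0 1)))"
        unfolding taup_def using \<phi>[OF y] by (intro continuous_map_pullback continuous_map_product_projection)
      then show ?thesis using \<phi>[OF y] by (simp add: comp_def A[OF y])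
    qed
    then show "continuous_map taup (product_topology (\<lambda>_. euclidean) (ball 0 1))
        ((\<lambda>f. restrict (HL0_apply f) (ball 0 1)) \<circ> A)"
      by (auto simp: continuous_map_componentwise comp_def)
  qed simp
qed

section \<open>Taylor expansion at the origin\<close>

lemma cfrechet_holomorphic_on_compose_clinear:
  assumes g: "cfrechet_holomorphic_on g U" and S: "bounded_clinear S" and "\<And>z. z \<in> V \<Longrightarrow> S z \<in> U"
  shows "cfrechet_holomorphic_on (\<lambda>z. g (S z)) V"
  unfolding cfrechet_holomorphic_on_def
proof
  fix z assume "z \<in> V"
  then have "S z \<in> U" by (rule assms)
  then obtain D where D: "bounded_clinear D" "(g has_derivative D) (at (S z))"
    using g unfolding cfrechet_holomorphic_on_def by metis
  have "bounded_clinear (\<lambda>h. D (S h))"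
    using D(1) S by (auto simp: bounded_clinear_def clinear_iff intro: bounded_linear_compose)
  moreover have "(S has_derivative S) (at z)"
    using S by (simp add: bounded_clinear_def bounded_linear_imp_has_derivative)
  then have "((\<lambda>z. g (S z)) has_derivative (\<lambda>h. D (S h))) (at z)"
    using D(2) by (rule has_derivative_compose)
  ultimately show "\<exists>D. bounded_clinear D \<and> ((\<lambda>z. g (S z)) has_derivative D) (at z)" by blast
qed

lemma bounded_clinear_scale: "bounded_clinear (\<lambda>x. c *\<^sub>C (x :: 'a::complex_normed_vector))"
  by (auto simp: bounded_clinear_def clinear_iff scaleC_add_right scaleC_scaleC mult.commute bounded_linear_scaleC)

lemma HL0_dilation:
  fixes f :: "('a::complex_normed_vector, complex) HL0"
  assumes "norm c \<le> 1"
  obtains g where "\<And>z. z \<in> ball 0 1 \<Longrightarrow> HL0_apply g z = HL0_apply f (c *\<^sub>C z)" "norm g \<le> norm f"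
proof -
  have inball: "c *\<^sub>C z \<in> ball 0 1" if "z \<in> ball 0 1" for z :: 'a
    using mult_right_mono[OF assms norm_ge_zero[of z]] that by (simp add: norm_scaleC)
  have "norm (HL0_apply f (c *\<^sub>C x) - HL0_apply f (c *\<^sub>C y)) \<le> norm f * norm (x - y)"
    if xy: "x \<in> ball 0 1" "y \<in> ball 0 1" for x y
  proof -
    have "norm (HL0_apply f (c *\<^sub>C x) - HL0_apply f (c *\<^sub>C y)) \<le> norm f * norm (c *\<^sub>C x - c *\<^sub>C y)"
      by (rule HL0_norm_bound[OF inball[OF xy(1)] inball[OF xy(2)]])
    also have "norm (c *\<^sub>C x - c *\<^sub>C y) \<le> norm (x - y)"
      using mult_right_mono[OF assms norm_ge_zero[of "x - y"]]
      by (simp add: norm_scaleC flip: complex_vector.scale_right_diff_distrib)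
    finally show ?thesis by (simp add: mult_left_mono HL0_norm_nonneg)
  qed
  moreover have "cfrechet_holomorphic_on (\<lambda>z. HL0_apply f (c *\<^sub>C z)) (ball 0 1)"
    by (rule cfrechet_holomorphic_on_compose_clinear[OF HL0_holomorphic bounded_clinear_scale inball])
  ultimately show ?thesis
    using HL0_of_Lipschitz_holomorphic[of "\<lambda>z. HL0_apply f (c *\<^sub>C z)" "norm f"]
    by (intro that[of "HL0_of (\<lambda>z. HL0_apply f (c *\<^sub>C z))"]) (auto simp: HL0_norm_nonneg)
qed

lemma HL0_apply_sum:
  fixes h :: "'i \<Rightarrow> ('a::complex_normed_vector, complex) HL0"
  shows "HL0_apply (sum h S) x = (\<Sum>i\<in>S. HL0_apply (h i) x)"
  using blinfun.sum_right[of "delta x" h S] by (simp add: delta.rep_eq)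

definition taylor_term :: "('a::complex_normed_vector, complex) HL0 \<Rightarrow> nat \<Rightarrow> 'a \<Rightarrow> complex"
  where "taylor_term f n z = (deriv ^^ n) (\<lambda>t. HL0_apply f (t *\<^sub>C z)) 0 / fact n"

lemma slice_in_ball:
  assumes "t \<in> ball 0 r" "r * norm z \<le> 1"
  shows "t *\<^sub>C z \<in> ball 0 (1::real)"
proof (cases "z = 0")
  case False
  then have "cmod t * norm z < r * norm z" using assms(1) by simp
  with assms(2) show ?thesis by (simp add: norm_scaleC)
qed simp

lemma slice_holomorphic:
  fixes f :: "('a::complex_normed_vector, complex) HL0"
  assumes "r * norm z \<le> 1"
  shows "(\<lambda>t. HL0_apply f (t *\<^sub>C z)) holomorphic_on ball 0 r"
  using line_holomorphic[OF HL0_holomorphic, of "ball 0 r" 0 z f] slice_in_ball[OF _ assms] by simp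

lemma taylor_term_sums:
  fixes f :: "('a::complex_normed_vector, complex) HL0"
  assumes "z \<in> ball 0 1" "norm s \<le> 1"
  shows "(\<lambda>n. s ^ n * taylor_term f n z) sums HL0_apply f (s *\<^sub>C z)"
proof -
  define r where "r = 2 / (1 + norm z)"
  have pos: "0 < 1 + norm z" by (simp add: add_pos_nonneg)
  have r: "r * norm z \<le> 1" "1 < r"
    using assms(1) pos by (simp_all add: r_def divide_le_eq less_divide_eq)
  have "s \<in> ball 0 r" using r(2) assms(2) by simp
  from holomorphic_power_series[OF slice_holomorphic[OF r(1), of f] this]
  show ?thesis by (simp add: taylor_term_def mult.commute)
qed

lemma taylor_term_zero: "taylor_term f n 0 = 0"
  by (simp add: taylor_term_def)

lemma taylor_term_scale:
  fixes f :: "('a::complex_normed_vector, complex) HL0"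
  shows "taylor_term f n (c *\<^sub>C z) = c ^ n * taylor_term f n z"
proof (cases "c = 0")
  case True
  then show ?thesis
    by (cases n) (simp_all add: taylor_term_zero, simp add: taylor_term_def)
next
  case False
  define r where "r = 1 / (norm z + 1)"
  have pos: "0 < norm z + 1" by (simp add: add_nonneg_pos)
  have r: "r * norm z \<le> 1" "0 < r" using pos by (simp_all add: r_def)
  have "(deriv ^^ n) (\<lambda>w. HL0_apply f ((c * w) *\<^sub>C z)) 0 = c ^ n * (deriv ^^ n) (\<lambda>t. HL0_apply f (t *\<^sub>C z)) (c * 0)"
  proof (rule higher_deriv_compose_linear[where S = "ball 0 (r / norm c)"])
    show "(\<lambda>t. HL0_apply f (t *\<^sub>C z)) holomorphic_on ball 0 r" by (rule slice_holomorphic[OF r(1)])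
    show "c * w \<in> ball 0 r" if "w \<in> ball 0 (r / norm c)" for w
      using that False by (simp add: norm_mult less_divide_eq mult.commute)
  qed (use r False in auto)
  then show ?thesis by (simp add: taylor_term_def scaleC_scaleC mult.commute)
qed

text \<open>Cauchy's inequality on the unit circle for \<open>t \<mapsto> f (t z) - f (t w)\<close>, which is bounded there by
\<open>norm f * norm (z - w)\<close>.\<close>

lemma taylor_term_lipschitz:
  fixes f :: "('a::complex_normed_vector, complex) HL0"
  assumes z: "z \<in> ball 0 1" and w: "w \<in> ball 0 1"
  shows "norm (taylor_term f n z - taylor_term f n w) \<le> norm f * norm (z - w)"
proof -
  define r where "r = 2 / (1 + max (norm z) (norm w))"
  have pos: "0 < 1 + max (norm z) (norm w)" by (simp add: add_pos_nonneg le_max_iff_disj)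
  have r: "r * norm z \<le> 1" "r * norm w \<le> 1" "1 < r"
    using z w pos by (auto simp: r_def divide_le_eq less_divide_eq)
  let ?g = "\<lambda>t. HL0_apply f (t *\<^sub>C z) - HL0_apply f (t *\<^sub>C w)"
  have g: "?g holomorphic_on ball 0 r"
    by (intro holomorphic_on_diff slice_holomorphic r)
  have sub: "ball 0 1 \<subseteq> ball 0 r" "cball 0 1 \<subseteq> ball (0::complex) r" using r(3) by auto
  have "norm ((deriv ^^ n) ?g 0) \<le> fact n * (norm f * norm (z - w)) / 1 ^ n"
  proof (rule Cauchy_inequality)
    show "?g holomorphic_on ball 0 1" by (rule holomorphic_on_subset[OF g sub(1)])
    show "continuous_on (cball 0 1) ?g"
      by (rule holomorphic_on_imp_continuous_on[OF holomorphic_on_subset[OF g sub(2)]])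
    fix t :: complex assume t: "norm (0 - t) = 1"
    then have "t \<in> ball 0 r" using r(3) by simp
    then have "t *\<^sub>C z \<in> ball 0 1" "t *\<^sub>C w \<in> ball 0 1"
      using slice_in_ball r by blast+
    from HL0_norm_bound[OF this, of f] show "norm (?g t) \<le> norm f * norm (z - w)"
      using t by (simp add: norm_scaleC flip: complex_vector.scale_right_diff_distrib)
  qed simp
  moreover have "(deriv ^^ n) ?g 0 = (deriv ^^ n) (\<lambda>t. HL0_apply f (t *\<^sub>C z)) 0 - (deriv ^^ n) (\<lambda>t. HL0_apply f (t *\<^sub>C w)) 0"
    using r by (intro higher_deriv_diff[where S = "ball 0 r"] slice_holomorphic) auto
  moreover have "taylor_term f n z - taylor_term f n w = ((deriv ^^ n) (\<lambda>t. HL0_apply f (t *\<^sub>C z)) 0 - (deriv ^^ n) (\<lambda>t. HL0_apply f (t *\<^sub>C w)) 0) / fact n"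
    by (simp add: taylor_term_def diff_divide_distrib)
  ultimately show ?thesis
    by (simp add: norm_divide divide_le_eq mult.commute)
qed

lemma taylor_term_bound:
  fixes f :: "('a::complex_normed_vector, complex) HL0"
  assumes "z \<in> ball 0 1"
  shows "norm (taylor_term f n z) \<le> norm f"
proof -
  have "norm (taylor_term f n z) \<le> norm f * norm z"
    using taylor_term_lipschitz[OF assms, of 0 f n] by (simp add: taylor_term_zero)
  also have "\<dots> \<le> norm f * 1" using assms by (intro mult_left_mono) (auto simp: HL0_norm_nonneg)
  finally show ?thesis by simp
qed

text \<open>Frechet differentiability is the point. The term of order \<open>n\<close> is the limit, as \<open>c\<close> tends to 0, of
\<open>(f (c z) - (\<Sum>k<n. c ^ k * P k z)) / c ^ n\<close>. If the terms of lower order are holomorphic, these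
quotients are elements of \<open>HL0\<close>, bounded by a geometric series, and bounded pointwise limits
stay in \<open>HL0\<close>.\<close>

lemma taylor_term_HL0:
  fixes f :: "('a::complex_normed_vector, complex) HL0"
  obtains p where "\<And>z. z \<in> ball 0 1 \<Longrightarrow> HL0_apply p z = taylor_term f n z" "norm p \<le> norm f"
proof -
  have "\<exists>p. \<forall>z\<in>ball 0 1. HL0_apply p z = taylor_term f n z"
  proof (induction n rule: less_induct)
    case (less n)
    then have "\<forall>k. \<exists>p. k < n \<longrightarrow> (\<forall>z\<in>ball 0 1. HL0_apply p z = taylor_term f k z)" by metis
    then obtain p where p: "\<And>k z. k < n \<Longrightarrow> z \<in> ball 0 1 \<Longrightarrow> HL0_apply (p k) z = taylor_term f k z"
      by metis
    define c where "c m = complex_of_real (inverse (real (m + 2)))" for m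
    have c: "norm (c m) \<le> 1 / 2" "c m \<noteq> 0" for m
      unfolding c_def norm_of_real of_real_eq_0_iff by (simp_all add: field_simps)
    have c1: "norm (c m) \<le> 1" for m
      by (rule order_trans[OF c(1)]) simp
    have "\<exists>g. \<forall>z\<in>ball 0 1. HL0_apply g z = HL0_apply f (c m *\<^sub>C z)" for m
      using HL0_dilation[OF c1[of m], of f] by metis
    then obtain g where g: "\<And>m z. z \<in> ball 0 1 \<Longrightarrow> HL0_apply (g m) z = HL0_apply f (c m *\<^sub>C z)"
      by metis
    define F where "F m = (1 / c m ^ n) *\<^sub>C (g m - (\<Sum>k<n. c m ^ k *\<^sub>C p k))" for m
    have F: "(\<lambda>j. c m ^ j * taylor_term f (j + n) z) sums HL0_apply (F m) z" if z: "z \<in> ball 0 1" for m z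
    proof -
      have "(\<lambda>j. (1 / c m ^ n) * (c m ^ (j + n) * taylor_term f (j + n) z)) sums
          ((1 / c m ^ n) * (HL0_apply f (c m *\<^sub>C z) - (\<Sum>k<n. c m ^ k * taylor_term f k z)))"
        by (intro sums_mult sums_split_initial_segment taylor_term_sums z c1)
      moreover have "(1 / c m ^ n) * (c m ^ (j + n) * taylor_term f (j + n) z) = c m ^ j * taylor_term f (j + n) z" for j
        using c(2)[of m] by (simp add: power_add)
      moreover have "HL0_apply (F m) z = (1 / c m ^ n) * (HL0_apply f (c m *\<^sub>C z) - (\<Sum>k<n. c m ^ k * taylor_term f k z))"
        using z by (simp add: F_def scaleC_HL0.rep_eq HL0_apply_minus HL0_apply_sum scaleC_complex_def g p)
      ultimately show ?thesis by simp
    qed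
    have geometric: "(\<lambda>j. (1 / 2) ^ j * b) sums (2 * b)" for b :: real
      using sums_mult2[OF geometric_sums[of "1 / 2 :: real"], of b] by simp
    have "norm (F m) \<le> 2 * norm f" for m
    proof (rule HL0_norm_le)
      fix x y :: 'a assume xy: "x \<in> ball 0 1" "y \<in> ball 0 1"
      have "norm (HL0_apply (F m) x - HL0_apply (F m) y) \<le> 2 * (norm f * norm (x - y))"
      proof (rule norm_sums_le[OF sums_diff[OF F[OF xy(1)] F[OF xy(2)]] geometric])
        fix j
        have "norm (c m ^ j * taylor_term f (j + n) x - c m ^ j * taylor_term f (j + n) y)
            = norm (c m) ^ j * norm (taylor_term f (j + n) x - taylor_term f (j + n) y)"
          by (simp add: norm_mult norm_power flip: right_diff_distrib)
        also have "\<dots> \<le> (1 / 2) ^ j * (norm f * norm (x - y))"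
          by (intro mult_mono power_mono c taylor_term_lipschitz xy) auto
        finally show "norm (c m ^ j * taylor_term f (j + n) x - c m ^ j * taylor_term f (j + n) y)
            \<le> (1 / 2) ^ j * (norm f * norm (x - y))" .
      qed
      then show "norm (HL0_apply (F m) x - HL0_apply (F m) y) \<le> 2 * norm f * norm (x - y)"
        by (simp add: mult.assoc)
    qed (simp add: HL0_norm_nonneg)
    moreover have "(\<lambda>m. HL0_apply (F m) z) \<longlonglongrightarrow> taylor_term f n z" if z: "z \<in> ball 0 1" for z
    proof (rule LIM_zero_cancel, rule Lim_null_comparison)
      have "norm (HL0_apply (F m) z - taylor_term f n z) \<le> 2 * (norm (c m) * norm f)" for m
      proof (rule norm_sums_le[OF _ geometric])
        show "(\<lambda>j. c m ^ (j + 1) * taylor_term f (j + 1 + n) z) sums (HL0_apply (F m) z - taylor_term f n z)"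
          using sums_split_initial_segment[OF F[OF z, of m], of 1] by simp
        fix j
        have "norm (c m ^ (j + 1) * taylor_term f (j + 1 + n) z) = norm (c m) ^ j * (norm (c m) * norm (taylor_term f (j + 1 + n) z))"
          by (simp add: norm_mult norm_power)
        also have "\<dots> \<le> (1 / 2) ^ j * (norm (c m) * norm f)"
          by (intro mult_mono power_mono c taylor_term_bound z) auto
        finally show "norm (c m ^ (j + 1) * taylor_term f (j + 1 + n) z) \<le> (1 / 2) ^ j * (norm (c m) * norm f)" .
      qed
      then show "\<forall>\<^sub>F m in sequentially. norm (HL0_apply (F m) z - taylor_term f n z) \<le> 2 * (norm (c m) * norm f)"
        by simp
      have "(\<lambda>m. inverse (real (m + 2))) \<longlonglongrightarrow> 0"
        using LIMSEQ_ignore_initial_segment[OF lim_inverse_n, of 2] by (simp add: inverse_eq_divide)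
      then have "(\<lambda>m. 2 * (norm (c m) * norm f)) \<longlonglongrightarrow> 2 * (0 * norm f)"
        unfolding c_def norm_of_real by (intro tendsto_intros) (simp_all add: tendsto_rabs_zero)
      then show "(\<lambda>m. 2 * (norm (c m) * norm f)) \<longlonglongrightarrow> 0" by simp
    qed
    ultimately show ?case
      using HL0_pointwise_limit[of F "2 * norm f" "taylor_term f n"] by metis
  qed
  then obtain p where p: "\<And>z. z \<in> ball 0 1 \<Longrightarrow> HL0_apply p z = taylor_term f n z" by metis
  have "norm p \<le> norm f"
    by (rule HL0_norm_le) (simp_all add: p taylor_term_lipschitz HL0_norm_nonneg del: mem_ball)
  with p show ?thesis by (rule that)
qed

lemma taylor_term_rescale:
  fixes f :: "('a::complex_normed_vector, complex) HL0"
  assumes "0 < \<rho>"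
  shows "taylor_term f n z = of_real \<rho> ^ n * taylor_term f n (of_real (1 / \<rho>) *\<^sub>C z)"
  using taylor_term_scale[of f n "of_real \<rho>" "of_real (1 / \<rho>) *\<^sub>C z"] assms
  by (simp add: scaleC_scaleC scaleC_one)

lemma rescale_in_ball:
  fixes z :: "'a::complex_normed_vector"
  assumes "norm z < \<rho>"
  shows "complex_of_real (1 / \<rho>) *\<^sub>C z \<in> ball 0 1"
proof -
  have "0 < \<rho>" using assms norm_ge_zero[of z] by linarith
  then show ?thesis using assms by (simp add: norm_scaleC norm_divide)
qed

lemma taylor_term_holomorphic:
  fixes f :: "('a::complex_normed_vector, complex) HL0"
  shows "cfrechet_holomorphic_on (taylor_term f n) UNIV"
  unfolding cfrechet_holomorphic_on_def
proof
  fix z :: 'a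
  define \<rho> where "\<rho> = norm z + 1"
  have \<rho>: "0 < \<rho>" "z \<in> ball 0 \<rho>" by (auto simp: \<rho>_def add_nonneg_pos)
  obtain p where p: "\<And>z. z \<in> ball 0 1 \<Longrightarrow> HL0_apply p z = taylor_term f n z"
    using taylor_term_HL0[of f n] by metis
  have "cfrechet_holomorphic_on (\<lambda>z. HL0_apply p (complex_of_real (1 / \<rho>) *\<^sub>C z)) (ball 0 \<rho>)"
    by (rule cfrechet_holomorphic_on_compose_clinear[OF HL0_holomorphic bounded_clinear_scale])
      (rule rescale_in_ball, simp)
  then obtain D where D: "bounded_clinear D" "((\<lambda>z. HL0_apply p (complex_of_real (1 / \<rho>) *\<^sub>C z)) has_derivative D) (at z)"
    using \<rho>(2) unfolding cfrechet_holomorphic_on_def by metis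
  have "((\<lambda>z. of_real \<rho> ^ n *\<^sub>C HL0_apply p (complex_of_real (1 / \<rho>) *\<^sub>C z)) has_derivative (\<lambda>h. of_real \<rho> ^ n *\<^sub>C D h)) (at z)"
    by (rule bounded_linear.has_derivative[OF bounded_linear_scaleC D(2)])
  then have "(taylor_term f n has_derivative (\<lambda>h. of_real \<rho> ^ n *\<^sub>C D h)) (at z)"
  proof (rule has_derivative_transform_within_open[OF _ open_ball \<rho>(2)])
    fix x :: 'a assume "x \<in> ball 0 \<rho>"
    then have "complex_of_real (1 / \<rho>) *\<^sub>C x \<in> ball 0 1" by (intro rescale_in_ball) simp
    then show "of_real \<rho> ^ n *\<^sub>C HL0_apply p (complex_of_real (1 / \<rho>) *\<^sub>C x) = taylor_term f n x"
      using taylor_term_rescale[OF \<rho>(1), of f n x] by (simp add: p scaleC_complex_def del: mem_ball)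
  qed
  then show "\<exists>D. bounded_clinear D \<and> (taylor_term f n has_derivative D) (at z)"
    using bounded_clinear_scaleC[OF D(1)] by blast
qed

lemma taylor_term_lipschitz_ball:
  fixes f :: "('a::complex_normed_vector, complex) HL0"
  assumes "norm z < \<rho>" "norm w < \<rho>"
  shows "norm (taylor_term f n z - taylor_term f n w) \<le> \<rho> ^ n * norm f / \<rho> * norm (z - w)"
proof -
  have \<rho>: "0 < \<rho>" using assms(1) norm_ge_zero[of z] by linarith
  let ?c = "complex_of_real (1 / \<rho>)"
  have "taylor_term f n z - taylor_term f n w = of_real \<rho> ^ n * (taylor_term f n (?c *\<^sub>C z) - taylor_term f n (?c *\<^sub>C w))"
    using taylor_term_rescale[OF \<rho>, of f n z] taylor_term_rescale[OF \<rho>, of f n w]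
    by (simp add: right_diff_distrib)
  then have "norm (taylor_term f n z - taylor_term f n w) = \<rho> ^ n * norm (taylor_term f n (?c *\<^sub>C z) - taylor_term f n (?c *\<^sub>C w))"
    using \<rho> by (simp add: norm_mult norm_power)
  also have "\<dots> \<le> \<rho> ^ n * (norm f * norm (?c *\<^sub>C z - ?c *\<^sub>C w))"
    using \<rho> assms by (intro mult_left_mono taylor_term_lipschitz rescale_in_ball) auto
  also have "norm (?c *\<^sub>C z - ?c *\<^sub>C w) = norm (z - w) / \<rho>"
    using \<rho> by (simp add: norm_scaleC norm_divide flip: complex_vector.scale_right_diff_distrib)
  finally show ?thesis by simp
qed

text \<open>Homogeneity makes the term an entire function on each line, of growth of order \<open>n\<close>; by Liouville's
theorem it is a polynomial there.\<close>

lemma taylor_term_line_polynomial: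
  fixes f :: "('a::complex_normed_vector, complex) HL0"
  shows "\<exists>p. degree p \<le> n \<and> (\<forall>t. taylor_term f n (a + t *\<^sub>C b) = poly p t)"
proof -
  let ?g = "\<lambda>t. taylor_term f n (a + t *\<^sub>C b)"
  define B where "B = 2 ^ n * (norm a + norm b) ^ n * norm f"
  have growth: "norm (taylor_term f n v) \<le> (2 * norm v) ^ n * norm f" for v
  proof (cases "v = 0")
    case False
    then have v: "norm v < 2 * norm v" "0 < 2 * norm v" by simp_all
    have "norm (taylor_term f n v) = (2 * norm v) ^ n * norm (taylor_term f n (of_real (1 / (2 * norm v)) *\<^sub>C v))"
      by (subst taylor_term_rescale[OF v(2)]) (simp add: norm_mult norm_power)
    also have "\<dots> \<le> (2 * norm v) ^ n * norm f"
      by (intro mult_left_mono taylor_term_bound rescale_in_ball v) simp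
    finally show ?thesis .
  qed (simp add: taylor_term_zero HL0_norm_nonneg)
  define c where "c k = (deriv ^^ k) ?g 0 / fact k" for k
  have "?g t = (\<Sum>k\<le>n. c k * t ^ k)" for t
    unfolding c_def
  proof (rule Liouville_polynomial[where A = 1 and B = B])
    show "?g holomorphic_on UNIV"
      by (rule line_holomorphic[OF taylor_term_holomorphic]) simp
    fix t :: complex assume t: "1 \<le> norm t"
    have "norm (a + t *\<^sub>C b) \<le> norm t * (norm a + norm b)"
      using norm_triangle_ineq[of a "t *\<^sub>C b"] mult_right_mono[OF t norm_ge_zero[of a]]
      by (simp add: norm_scaleC distrib_left)
    then have "(2 * norm (a + t *\<^sub>C b)) ^ n * norm f \<le> (2 * (norm t * (norm a + norm b))) ^ n * norm f"
      by (intro mult_right_mono power_mono) (auto simp: HL0_norm_nonneg)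
    also have "\<dots> = B * norm t ^ n"
      by (simp only: B_def power_mult_distrib mult_ac)
    finally show "norm (?g t) \<le> B * norm t ^ n"
      using growth[of "a + t *\<^sub>C b"] by linarith
  qed
  then have "?g t = poly (\<Sum>k\<le>n. monom (c k) k) t" for t
    by (simp add: poly_sum poly_monom)
  moreover have "degree (\<Sum>k\<le>n. monom (c k) k) \<le> n"
    by (rule degree_sum_le) (simp_all add: le_trans[OF degree_monom_le])
  ultimately show ?thesis by blast
qed

text \<open>The point is that the basis polynomials depend on the degree bound alone, and not on the interpolated
polynomial: values at the nodes \<open>0, ..., n\<close> enter linearly.\<close>

lemma Lagrange_interpolation:
  obtains l :: "nat \<Rightarrow> complex poly" where
    "\<And>p t. degree p \<le> n \<Longrightarrow> poly p t = (\<Sum>i\<le>n. poly p (of_nat i) * poly (l i) t)"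
proof -
  define q :: "nat \<Rightarrow> complex poly" where "q i = (\<Prod>j\<in>{..n} - {i}. [:- of_nat j, 1:])" for i
  define l where "l i = smult (1 / poly (q i) (of_nat i)) (q i)" for i
  have q: "poly (q i) t = (\<Prod>j\<in>{..n} - {i}. t - of_nat j)" for i t
    by (simp add: q_def poly_prod algebra_simps)
  have l: "poly (l i) (of_nat j) = (if i = j then 1 else 0)" if "i \<le> n" "j \<le> n" for i j
  proof -
    have "poly (q i) (of_nat i) \<noteq> 0" by (simp add: q)
    moreover have "poly (q i) (of_nat j) = 0" if "i \<noteq> j"
      using \<open>j \<le> n\<close> that by (auto simp: q)
    ultimately show ?thesis by (cases "i = j") (simp_all add: l_def)
  qed
  have degree: "degree (l i) \<le> n" if "i \<le> n" for i
  proof -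
    have "degree (q i) \<le> (\<Sum>j\<in>{..n} - {i}. degree [:- of_nat j, 1 :: complex:])"
      unfolding q_def by (rule order_trans[OF degree_prod_sum_le]) (simp_all add: comp_def)
    also have "\<dots> = n" using that by simp
    finally show ?thesis unfolding l_def using degree_smult_le order_trans by blast
  qed
  show ?thesis
  proof (rule that)
    fix p :: "complex poly" and t assume p: "degree p \<le> n"
    have "p = (\<Sum>i\<le>n. smult (poly p (of_nat i)) (l i))"
    proof (rule poly_eqI_degree[where A = "of_nat ` {..n}"])
      fix x :: complex assume "x \<in> of_nat ` {..n}"
      then obtain j where "j \<le> n" "x = of_nat j" by auto
      moreover have "(\<Sum>i\<le>n. poly p (of_nat i) * poly (l i) (of_nat j))
          = (\<Sum>i\<le>n. if i = j then poly p (of_nat i) else 0)"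
        using l \<open>j \<le> n\<close> by (intro sum.cong) auto
      ultimately show "poly p x = poly (\<Sum>i\<le>n. smult (poly p (of_nat i)) (l i)) x"
        by (simp add: poly_sum)
    next
      have card: "card (of_nat ` {..n} :: complex set) = Suc n"
        by (subst card_image) (auto simp: inj_on_def)
      show "degree p < card (of_nat ` {..n} :: complex set)" using p card by simp
      have "degree (\<Sum>i\<le>n. smult (poly p (of_nat i)) (l i)) \<le> n"
        by (intro degree_sum_le order_trans[OF degree_smult_le] degree) auto
      then show "degree (\<Sum>i\<le>n. smult (poly p (of_nat i)) (l i)) < card (of_nat ` {..n} :: complex set)"
        using card by simp
    qed
    then have "poly p t = poly (\<Sum>i\<le>n. smult (poly p (of_nat i)) (l i)) t" by simp
    then show "poly p t = (\<Sum>i\<le>n. poly p (of_nat i) * poly (l i) t)"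
      by (simp add: poly_sum)
  qed
qed

section \<open>Characters in the predual are point evaluations\<close>

lemma bounded_clinear_bound:
  assumes "bounded_clinear w"
  obtains c where "0 \<le> c" "\<And>x. norm (w x) \<le> c * norm x"
  using assms bounded_linear.nonneg_bounded[of w] by (auto simp: bounded_clinear_def mult.commute)

lemma clinear_if_bounded: "bounded_clinear w \<Longrightarrow> clinear w"
  by (simp add: bounded_clinear_def)

lemma bounded_clinear_holomorphic:
  assumes "bounded_clinear w"
  shows "cfrechet_holomorphic_on w S"
  unfolding cfrechet_holomorphic_on_def
  using assms bounded_linear_imp_has_derivative[of w] by (auto simp: bounded_clinear_def)

lemma HL0_of_clinear:
  fixes w :: "'a::complex_normed_vector \<Rightarrow> complex"
  assumes w: "clinear w" and "0 \<le> c" and le: "\<And>x. norm (w x) \<le> c * norm x"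
  shows "x \<in> ball 0 1 \<Longrightarrow> HL0_apply (HL0_of w) x = w x" and "norm (HL0_of w) \<le> c"
proof -
  have lip: "norm (w x - w y) \<le> c * norm (x - y)" for x y
    using le[of "x - y"] by (simp add: clinear_diff[OF w])
  note * = HL0_of_Lipschitz_holomorphic[OF clinear_zero[OF w] \<open>0 \<le> c\<close> lip bounded_clinear_holomorphic[OF bounded_clinearI[OF w le]]]
  show "x \<in> ball 0 1 \<Longrightarrow> HL0_apply (HL0_of w) x = w x" and "norm (HL0_of w) \<le> c"
    using * by blast+
qed

lemma HL0_of_bounded_clinear:
  fixes w :: "'a::complex_normed_vector \<Rightarrow> complex"
  assumes "bounded_clinear w" "x \<in> ball 0 1"
  shows "HL0_apply (HL0_of w) x = w x"
  using bounded_clinear_bound[OF assms(1)] HL0_of_clinear(1)[OF clinear_if_bounded[OF assms(1)]] assms(2)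
  by metis

text \<open>A combination of evaluations with coefficients \<open>a i\<close> at points \<open>z i\<close> has the barycentre
\<open>\<Sum>i. a i * z i\<close>. Norming functionals show that this assignment is a contraction, so it extends to
the closure by completeness of the space.\<close>

lemma G0_barycenter:
  fixes \<nu> :: "('a::cbanach, complex) HL0 \<Rightarrow>\<^sub>L complex"
  assumes "\<nu> \<in> G0"
  obtains x where "\<And>w. bounded_clinear w \<Longrightarrow> w x = blinfun_apply \<nu> (HL0_of w)"
proof -
  have finite: "\<exists>x. \<forall>w. bounded_clinear w \<longrightarrow> w x = blinfun_apply \<mu> (HL0_of w)"
    if "\<mu> \<in> cspan (delta ` ball 0 1)" for \<mu> :: "('a, complex) HL0 \<Rightarrow>\<^sub>L complex"
    using that
  proof (induction rule: complex_vector.span_induct_alt)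
    case base
    show ?case
      by (rule exI[of _ 0]) (simp add: clinear_zero clinear_if_bounded)
  next
    case (step a \<phi> \<mu>)
    obtain z where z: "\<phi> = delta z" "z \<in> ball 0 1" using step(1) by auto
    obtain x where x: "\<And>w. bounded_clinear w \<Longrightarrow> w x = blinfun_apply \<mu> (HL0_of w)" using step(2) by blast
    have "w (a *\<^sub>C z + x) = blinfun_apply (a *\<^sub>C \<phi> + \<mu>) (HL0_of w)" if w: "bounded_clinear w" for w
      using x[OF w] HL0_of_bounded_clinear[OF w z(2)] clinear_if_bounded[OF w]
      by (simp add: z(1) clinear_add clinear_scaleC blinfun.add_left scaleC_blinfun.rep_eq delta.rep_eq)
    then show ?case by blast
  qed
  obtain m where m: "\<And>n. m n \<in> cspan (delta ` ball 0 1)" "m \<longlonglongrightarrow> \<nu>"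
    using assms unfolding G0_def closure_sequential by metis
  have "\<forall>n. \<exists>x. \<forall>w. bounded_clinear w \<longrightarrow> w x = blinfun_apply (m n) (HL0_of w)"
    using finite[OF m(1)] by blast
  then obtain x where x: "\<And>n w. bounded_clinear w \<Longrightarrow> w (x n) = blinfun_apply (m n) (HL0_of w)" by metis
  have contraction: "norm (x i - x j) \<le> norm (m i - m j)" for i j
  proof (rule norming_functional_bound)
    fix w :: "'a \<Rightarrow> complex" assume w: "clinear w" "\<And>z. norm (w z) \<le> norm z"
    have bw: "bounded_clinear w" using bounded_clinearI[OF w(1), of 1] w(2) by simp
    have "norm (HL0_of w) \<le> 1" using HL0_of_clinear(2)[OF w(1), of 1] w(2) by simp
    then have "norm (m i - m j) * norm (HL0_of w) \<le> norm (m i - m j) * 1"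
      by (intro mult_left_mono) auto
    moreover have "w (x i - x j) = blinfun_apply (m i - m j) (HL0_of w)"
      by (simp add: clinear_diff[OF w(1)] x[OF bw] blinfun.diff_left)
    ultimately show "norm (w (x i - x j)) \<le> norm (m i - m j)"
      using norm_blinfun[of "m i - m j" "HL0_of w"] by simp
  qed
  have "Cauchy x"
  proof (rule CauchyI)
    fix e :: real assume "0 < e"
    then obtain N where "\<And>i j. i \<ge> N \<Longrightarrow> j \<ge> N \<Longrightarrow> norm (m i - m j) < e"
      using CauchyD[OF LIMSEQ_imp_Cauchy[OF m(2)]] by metis
    then show "\<exists>N. \<forall>i\<ge>N. \<forall>j\<ge>N. norm (x i - x j) < e"
      using contraction le_less_trans by blast
  qed
  then obtain x0 where x0: "x \<longlonglongrightarrow> x0" by (auto simp: Cauchy_convergent_iff convergent_def)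
  show ?thesis
  proof (rule that[of x0])
    fix w :: "'a \<Rightarrow> complex" assume w: "bounded_clinear w"
    then have "(\<lambda>n. w (x n)) \<longlonglongrightarrow> w x0"
      using bounded_linear.tendsto[OF _ x0] by (auto simp: bounded_clinear_def)
    moreover have "(\<lambda>n. w (x n)) \<longlonglongrightarrow> blinfun_apply \<nu> (HL0_of w)"
      unfolding x[OF w] by (intro blinfun.tendsto m(2) tendsto_const)
    ultimately show "w x0 = blinfun_apply \<nu> (HL0_of w)" by (rule LIMSEQ_unique)
  qed
qed

text \<open>Induction on the size of the spanning set \<open>B\<close>. A norming functional \<open>\<psi>\<close> of some \<open>b\<close> in \<open>B\<close> splits off
the component of \<open>S\<close> along \<open>b\<close>; the remaining part takes its values in the span of the projections of
the other elements of \<open>B\<close>. All coefficients are automatically bounded functionals.\<close>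

lemma finite_rank_representation:
  fixes S :: "'a::complex_normed_vector \<Rightarrow> 'b::complex_normed_vector"
  assumes "bounded_clinear S" "finite B" "range S \<subseteq> cspan B"
  shows "\<exists>xs. (\<forall>(w, v)\<in>set xs. bounded_clinear w) \<and> (\<forall>z. S z = (\<Sum>(w, v)\<leftarrow>xs. w z *\<^sub>C v))"
  using assms
proof (induction "card B" arbitrary: B S rule: less_induct)
  case less
  show ?case
  proof (cases "B \<subseteq> {0}")
    case True
    then have "cspan B \<subseteq> cspan {0}" by (rule complex_vector.span_mono)
    also have "cspan {0} = {0 :: 'b}" by simp
    finally have "S z = 0" for z using less.prems(3) by blast
    then show ?thesis by (intro exI[of _ "[]"]) simp
  next
    case False
    then obtain b where b: "b \<in> B" "b \<noteq> 0" by blast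
    obtain \<psi> :: "'b \<Rightarrow> complex" where \<psi>: "clinear \<psi>" "\<And>x. norm (\<psi> x) \<le> norm x" "\<psi> b = norm b"
      using norming_functional[of b] by blast
    have \<psi>_bounded: "bounded_clinear \<psi>" using bounded_clinearI[OF \<psi>(1), of 1] \<psi>(2) by simp
    define e where "e z = (1 / norm b) *\<^sub>C \<psi> (S z)" for z
    have "bounded_clinear (\<lambda>z. \<psi> (S z))"
      using \<psi>_bounded less.prems(1)
      by (auto simp: bounded_clinear_def clinear_iff intro: bounded_linear_compose)
    then have e: "bounded_clinear e" unfolding e_def by (rule bounded_clinear_scaleC)
    define \<pi> where "\<pi> y = y - (\<psi> y / norm b) *\<^sub>C b" for y
    have \<pi>: "clinear \<pi>"
      unfolding clinear_iff \<pi>_def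
      by (simp add: clinear_add[OF \<psi>(1)] clinear_scaleC[OF \<psi>(1)] scaleC_complex_def add_divide_distrib
          scaleC_add_left complex_vector.scale_right_diff_distrib scaleC_scaleC)
    have "\<pi> b = 0" using b(2) by (simp add: \<pi>_def \<psi>(3) scaleC_one)
    define S' where "S' z = \<pi> (S z)" for z
    have "\<exists>xs. (\<forall>(w, v)\<in>set xs. bounded_clinear w) \<and> (\<forall>z. S' z = (\<Sum>(w, v)\<leftarrow>xs. w z *\<^sub>C v))"
    proof (rule less.hyps)
      show "card (\<pi> ` (B - {b})) < card B"
        using card_image_le[of "B - {b}" \<pi>] less.prems(2) b(1) card_Diff1_less[of B b] by simp
      show "finite (\<pi> ` (B - {b}))" using less.prems(2) by simp
      have "bounded_clinear (\<lambda>y. (\<psi> y / norm b) *\<^sub>C b)"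
      proof (rule bounded_clinearI[where c = 1])
        show "clinear (\<lambda>y. (\<psi> y / norm b) *\<^sub>C b)"
          by (simp add: clinear_iff clinear_add[OF \<psi>(1)] clinear_scaleC[OF \<psi>(1)] scaleC_complex_def
              add_divide_distrib scaleC_add_left scaleC_scaleC)
        show "norm ((\<psi> y / norm b) *\<^sub>C b) \<le> 1 * norm y" for y
          using b(2) \<psi>(2)[of y] by (simp add: norm_scaleC norm_divide)
      qed
      then have "bounded_linear \<pi>"
        unfolding \<pi>_def by (intro bounded_linear_sub bounded_linear_ident) (simp add: bounded_clinear_def)
      then show "bounded_clinear S'"
        using \<pi> less.prems(1) unfolding S'_def bounded_clinear_def
        by (auto simp: clinear_iff intro: bounded_linear_compose)
      let ?W = "cspan (\<pi> ` (B - {b}))"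
      have "cspan B \<subseteq> {y. \<pi> y \<in> ?W}"
      proof (rule complex_vector.span_minimal)
        show "B \<subseteq> {y. \<pi> y \<in> ?W}"
        proof
          fix y assume y: "y \<in> B"
          show "y \<in> {y. \<pi> y \<in> ?W}"
          proof (cases "y = b")
            case True
            then show ?thesis by (simp add: \<open>\<pi> b = 0\<close> complex_vector.span_zero)
          next
            case False
            with y have "\<pi> y \<in> \<pi> ` (B - {b})" by blast
            then show ?thesis by (simp add: complex_vector.span_base)
          qed
        qed
        show "complex_vector.subspace {y. \<pi> y \<in> ?W}"
          unfolding complex_vector.subspace_def
          by (simp add: clinear_zero[OF \<pi>] clinear_add[OF \<pi>] clinear_scaleC[OF \<pi>]
              complex_vector.span_zero complex_vector.span_add complex_vector.span_scale)
      qed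
      then show "range S' \<subseteq> ?W"
        using less.prems(3) unfolding S'_def by blast
    qed
    then obtain xs where xs: "\<forall>(w, v)\<in>set xs. bounded_clinear w" "\<And>z. S' z = (\<Sum>(w, v)\<leftarrow>xs. w z *\<^sub>C v)"
      by blast
    have "S z = (\<Sum>(w, v)\<leftarrow>(e, b) # xs. w z *\<^sub>C v)" for z
      using xs(2)[of z] by (simp add: S'_def \<pi>_def e_def scaleC_complex_def diff_eq_eq add.commute)
    then show ?thesis
      using xs(1) e by (intro exI[of _ "(e, b) # xs"]) auto
  qed
qed

text \<open>The functional \<open>\<nu>\<close> acts on the functions \<open>c + h\<close> with \<open>h\<close> in \<open>HL0\<close> by \<open>c + h \<mapsto> c + \<nu> h\<close>. The
functions on which this unital extension is evaluation at \<open>x\<close> form an algebra if \<open>\<nu>\<close> is complex-linear and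
multiplicative.
The constant \<open>c\<close> has to be carried along because \<open>HL0\<close> has no unit.\<close>

definition evaluates_at :: "('a::complex_normed_vector, complex) HL0 \<Rightarrow>\<^sub>L complex \<Rightarrow> 'a \<Rightarrow> ('a \<Rightarrow> complex) \<Rightarrow> bool"
  where "evaluates_at \<nu> x g \<longleftrightarrow>
    (\<exists>c h. (\<forall>z\<in>ball 0 1. g z = c + HL0_apply h z) \<and> g x = c + blinfun_apply \<nu> h)"

lemma evaluates_at_const: "evaluates_at \<nu> x (\<lambda>z. c)"
  unfolding evaluates_at_def
  by (rule exI[of _ c], rule exI[of _ 0]) (simp add: zero_HL0.rep_eq)

lemma evaluates_at_add:
  assumes "evaluates_at \<nu> x f" "evaluates_at \<nu> x g"
  shows "evaluates_at \<nu> x (\<lambda>z. f z + g z)"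
proof -
  obtain c h where f: "\<And>z. z \<in> ball 0 1 \<Longrightarrow> f z = c + HL0_apply h z" "f x = c + blinfun_apply \<nu> h"
    using assms(1) unfolding evaluates_at_def by metis
  obtain d k where g: "\<And>z. z \<in> ball 0 1 \<Longrightarrow> g z = d + HL0_apply k z" "g x = d + blinfun_apply \<nu> k"
    using assms(2) unfolding evaluates_at_def by metis
  show ?thesis
    unfolding evaluates_at_def
    by (rule exI[of _ "c + d"], rule exI[of _ "h + k"])
      (simp add: f g plus_HL0.rep_eq blinfun.add_right del: mem_ball)
qed

lemma evaluates_at_mult:
  assumes \<nu>: "clinear (blinfun_apply \<nu>)"
    and mult: "\<And>f g. blinfun_apply \<nu> (HL0_mult f g) = blinfun_apply \<nu> f * blinfun_apply \<nu> g"
    and "evaluates_at \<nu> x f" "evaluates_at \<nu> x g"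
  shows "evaluates_at \<nu> x (\<lambda>z. f z * g z)"
proof -
  obtain c h where f: "\<And>z. z \<in> ball 0 1 \<Longrightarrow> f z = c + HL0_apply h z" "f x = c + blinfun_apply \<nu> h"
    using assms(3) unfolding evaluates_at_def by metis
  obtain d k where g: "\<And>z. z \<in> ball 0 1 \<Longrightarrow> g z = d + HL0_apply k z" "g x = d + blinfun_apply \<nu> k"
    using assms(4) unfolding evaluates_at_def by metis
  show ?thesis
    unfolding evaluates_at_def
    by (rule exI[of _ "c * d"], rule exI[of _ "c *\<^sub>C k + d *\<^sub>C h + HL0_mult h k"])
      (simp add: f g plus_HL0.rep_eq scaleC_HL0.rep_eq HL0_mult.rep_eq scaleC_complex_def
        clinear_add[OF \<nu>] clinear_scaleC[OF \<nu>] mult algebra_simps del: mem_ball)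
qed

lemma evaluates_at_sum:
  "(\<And>i. i \<in> S \<Longrightarrow> evaluates_at \<nu> x (f i)) \<Longrightarrow> evaluates_at \<nu> x (\<lambda>z. \<Sum>i\<in>S. f i z)"
  by (induction S rule: infinite_finite_induct)
    (simp_all add: evaluates_at_const evaluates_at_add)

lemma evaluates_at_poly:
  assumes \<nu>: "clinear (blinfun_apply \<nu>)"
    and mult: "\<And>f g. blinfun_apply \<nu> (HL0_mult f g) = blinfun_apply \<nu> f * blinfun_apply \<nu> g"
    and e: "evaluates_at \<nu> x e"
  shows "evaluates_at \<nu> x (\<lambda>z. poly p (e z))"
  by (induction p) (simp_all add: evaluates_at_const evaluates_at_add evaluates_at_mult[OF \<nu> mult] e)

text \<open>\<open>P\<close> composed with a map of finite rank is a polynomial in finitely many functions \<open>w\<close>. This is seen one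
function at a time: by Lagrange interpolation along the line in direction \<open>v\<close>, the dependence on
\<open>w z\<close> is split off as a polynomial factor, and what remains are functions of the same shape, with
fewer summands and other base points.\<close>

lemma evaluates_at_linewise_polynomial:
  assumes \<nu>: "clinear (blinfun_apply \<nu>)"
    and mult: "\<And>f g. blinfun_apply \<nu> (HL0_mult f g) = blinfun_apply \<nu> f * blinfun_apply \<nu> g"
    and poly: "\<And>a b. \<exists>p. degree p \<le> n \<and> (\<forall>t. P (a + t *\<^sub>C b) = poly p t)"
    and "\<And>w v. (w, v) \<in> set xs \<Longrightarrow> evaluates_at \<nu> x w"
  shows "evaluates_at \<nu> x (\<lambda>z. P (a + (\<Sum>(w, v)\<leftarrow>xs. w z *\<^sub>C v)))"
  using assms(4)
proof (induction xs arbitrary: a)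
  case Nil
  show ?case by (simp add: evaluates_at_const)
next
  case (Cons wv xs)
  obtain w v where wv: "wv = (w, v)" by force
  have w: "evaluates_at \<nu> x w" using Cons.prems[of w v] wv by simp
  obtain l :: "nat \<Rightarrow> complex poly"
    where l: "\<And>p t. degree p \<le> n \<Longrightarrow> poly p t = (\<Sum>i\<le>n. poly p (of_nat i) * poly (l i) t)"
    using Lagrange_interpolation by blast
  define R where "R z = (\<Sum>(w, v)\<leftarrow>xs. w z *\<^sub>C v)" for z
  have "P (a + (\<Sum>(w, v)\<leftarrow>wv # xs. w z *\<^sub>C v)) = (\<Sum>i\<le>n. P ((a + of_nat i *\<^sub>C v) + R z) * poly (l i) (w z))" for z
  proof -
    obtain p where p: "degree p \<le> n" "\<And>t. P ((a + R z) + t *\<^sub>C v) = poly p t" using poly by blast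
    have "P (a + (\<Sum>(w, v)\<leftarrow>wv # xs. w z *\<^sub>C v)) = poly p (w z)"
      by (simp add: wv R_def algebra_simps flip: p(2))
    also have "\<dots> = (\<Sum>i\<le>n. poly p (of_nat i) * poly (l i) (w z))" by (rule l[OF p(1)])
    also have "\<dots> = (\<Sum>i\<le>n. P ((a + of_nat i *\<^sub>C v) + R z) * poly (l i) (w z))"
      by (simp add: algebra_simps flip: p(2))
    finally show ?thesis .
  qed
  moreover have "evaluates_at \<nu> x (\<lambda>z. P ((a + of_nat i *\<^sub>C v) + R z))" for i
    unfolding R_def by (rule Cons.IH) (use Cons.prems in auto)
  ultimately show ?case
    by (simp only:) (intro evaluates_at_sum evaluates_at_mult[OF \<nu> mult] evaluates_at_poly[OF \<nu> mult] w)
qed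

text \<open>For \<open>S\<close> of finite rank the identity holds for \<open>P \<circ> S\<close> in place of the Taylor term \<open>P\<close>. If \<open>S\<close> has norm
at most \<open>M\<close>, then \<open>P \<circ> S\<close> has a norm in \<open>HL0\<close> bounded in terms of \<open>M\<close>. So if \<open>S\<close> is close to the
identity at finitely many points, then \<open>\<nu>\<close> takes nearby values at \<open>P \<circ> S\<close> and at \<open>P\<close>; taking \<open>x\<close> as
a further such point, \<open>P (S x)\<close> is close to \<open>P x\<close>.\<close>

lemma taylor_term_evaluated:
  fixes \<nu> :: "('a::cbanach, complex) HL0 \<Rightarrow>\<^sub>L complex"
  assumes bap: "bounded_approximation_property TYPE('a)" and \<nu>: "\<nu> \<in> G0"
    and mult: "\<And>f g. blinfun_apply \<nu> (HL0_mult f g) = blinfun_apply \<nu> f * blinfun_apply \<nu> g"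
    and x: "\<And>w. bounded_clinear w \<Longrightarrow> w x = blinfun_apply \<nu> (HL0_of w)" and "norm x < 1"
    and p: "\<And>z. z \<in> ball 0 1 \<Longrightarrow> HL0_apply p z = taylor_term f n z"
  shows "blinfun_apply \<nu> p = taylor_term f n x"
proof -
  note lin = G0_clinear[OF \<nu>]
  let ?P = "taylor_term f n"
  obtain M where M: "0 < M" and approx: "\<And>K \<epsilon>. compact K \<Longrightarrow> 0 < \<epsilon> \<Longrightarrow>
      \<exists>S :: 'a \<Rightarrow> 'a. bounded_clinear S \<and> (\<exists>B. finite B \<and> range S \<subseteq> cspan B) \<and>
        onorm S \<le> M \<and> (\<forall>x\<in>K. norm (S x - x) < \<epsilon>)"
    using bap unfolding bounded_approximation_property_def by metis
  \<comment> \<open>Radius of a ball that contains the image of the unit ball under every operator of norm at most \<open>M\<close>.\<close>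
  define \<rho> where "\<rho> = M + 1"
  define L where "L = \<rho> ^ n * norm f / \<rho>"
  have \<rho>: "1 < \<rho>" using M by (simp add: \<rho>_def)
  have L: "0 \<le> L" using \<rho> by (simp add: L_def HL0_norm_nonneg)
  have lip: "norm (?P z - ?P w) \<le> L * norm (z - w)" if "norm z < \<rho>" "norm w < \<rho>" for z w
    unfolding L_def using that by (rule taylor_term_lipschitz_ball)
  have "norm (blinfun_apply \<nu> p - ?P x) \<le> 0"
  proof (rule field_le_epsilon)
    fix e :: real assume "0 < e"
    define C where "C = L * M + norm p"
    have "0 \<le> C" using L M by (simp add: C_def HL0_norm_nonneg)
    obtain F d where F: "finite F" "F \<subseteq> ball 0 1" "0 < d"
      "\<And>g. norm g \<le> C \<Longrightarrow> (\<And>z. z \<in> F \<Longrightarrow> norm (HL0_apply g z) \<le> d) \<Longrightarrow> norm (blinfun_apply \<nu> g) < e / 2"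
      using G0_pointwise_small[OF \<nu>, of "e / 2" C] \<open>0 < e\<close> \<open>0 \<le> C\<close> by (metis half_gt_zero)
    define \<eta> where "\<eta> = min d (e / 2) / (L + 1)"
    have \<eta>: "0 < \<eta>" using F(3) \<open>0 < e\<close> L by (simp add: \<eta>_def)
    have L\<eta>: "L * \<eta> \<le> min d (e / 2)"
    proof -
      have "L * \<eta> \<le> (L + 1) * \<eta>" using \<eta> by simp
      also have "\<dots> = min d (e / 2)" using L by (simp add: \<eta>_def)
      finally show ?thesis .
    qed
    have "compact (insert x F)" using F(1) by (simp add: finite_imp_compact)
    from approx[OF this \<eta>] obtain S B where S: "bounded_clinear S" "finite B" "range S \<subseteq> cspan B"
      "onorm S \<le> M" "\<And>z. z \<in> insert x F \<Longrightarrow> norm (S z - z) < \<eta>"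
      by metis
    have S_le: "norm (S z) \<le> M * norm z" for z
      using onorm[of S z] mult_right_mono[OF S(4) norm_ge_zero[of z]] S(1)
      by (simp add: bounded_clinear_def)
    have S_\<rho>: "norm (S z) < \<rho>" if "norm z < 1" for z
    proof -
      have "M * norm z \<le> M * 1" using that M by (intro mult_left_mono) auto
      then show ?thesis using S_le[of z] by (simp add: \<rho>_def)
    qed
    have P0: "?P (S 0) = 0"
      by (simp add: clinear_zero[OF clinear_if_bounded[OF S(1)]] taylor_term_zero)
    have PS_lip: "norm (?P (S z) - ?P (S w)) \<le> L * M * norm (z - w)" if zw: "z \<in> ball 0 1" "w \<in> ball 0 1" for z w
    proof -
      have "norm (?P (S z) - ?P (S w)) \<le> L * norm (S z - S w)"
        using zw by (intro lip S_\<rho>) auto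
      also have "\<dots> \<le> L * (M * norm (z - w))"
        using S_le[of "z - w"] L by (intro mult_left_mono) (simp_all add: clinear_diff[OF clinear_if_bounded[OF S(1)]])
      finally show ?thesis by (simp add: mult.assoc)
    qed
    have hol: "cfrechet_holomorphic_on (\<lambda>z. ?P (S z)) (ball 0 1)"
      by (rule cfrechet_holomorphic_on_compose_clinear[OF taylor_term_holomorphic S(1)]) simp
    have LM: "0 \<le> L * M" using L M by simp
    define h where "h = HL0_of (\<lambda>z. ?P (S z))"
    have h: "\<And>z. z \<in> ball 0 1 \<Longrightarrow> HL0_apply h z = ?P (S z)" "norm h \<le> L * M"
      unfolding h_def using HL0_of_Lipschitz_holomorphic[OF P0 LM PS_lip hol] by blast+
    obtain xs where xs: "\<forall>(w, v)\<in>set xs. bounded_clinear w" "\<And>z. S z = (\<Sum>(w, v)\<leftarrow>xs. w z *\<^sub>C v)"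
      using finite_rank_representation[OF S(1-3)] by blast
    have functional: "evaluates_at \<nu> x w" if w: "bounded_clinear w" for w
      unfolding evaluates_at_def
      by (rule exI[of _ 0], rule exI[of _ "HL0_of w"]) (simp add: HL0_of_bounded_clinear[OF w] x[OF w] del: mem_ball)
    have "evaluates_at \<nu> x (\<lambda>z. ?P (0 + (\<Sum>(w, v)\<leftarrow>xs. w z *\<^sub>C v)))"
      using xs(1) by (intro evaluates_at_linewise_polynomial[OF lin mult taylor_term_line_polynomial] functional) auto
    then have "evaluates_at \<nu> x (\<lambda>z. ?P (S z))" by (simp add: xs(2))
    then obtain c k where k: "\<And>z. z \<in> ball 0 1 \<Longrightarrow> ?P (S z) = c + HL0_apply k z" "?P (S x) = c + blinfun_apply \<nu> k"
      unfolding evaluates_at_def by metis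
    \<comment> \<open>At the origin both \<open>P \<circ> S\<close> and the part in \<open>HL0\<close> vanish, so the constant does.\<close>
    have "c = 0" using k(1)[of 0] P0 by simp
    moreover have "k = h"
      by (rule HL0_eqI) (use k(1) h(1) \<open>c = 0\<close> in simp)
    ultimately have \<nu>h: "blinfun_apply \<nu> h = ?P (S x)" using k(2) by simp
    have "norm (blinfun_apply \<nu> (h - p)) < e / 2"
    proof (rule F(4))
      show "norm (h - p) \<le> C" using norm_triangle_ineq4[of h p] h(2) by (simp add: C_def)
      fix z assume z: "z \<in> F"
      then have zb: "z \<in> ball 0 1" using F(2) by blast
      have "norm (HL0_apply (h - p) z) = norm (?P (S z) - ?P z)"
        by (simp add: HL0_apply_minus h(1)[OF zb] p[OF zb])
      also have "\<dots> \<le> L * norm (S z - z)" using zb \<rho> by (intro lip S_\<rho>) auto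
      also have "\<dots> \<le> L * \<eta>" using S(5)[of z] z L by (intro mult_left_mono) auto
      finally show "norm (HL0_apply (h - p) z) \<le> d" using L\<eta> by simp
    qed
    moreover have "norm (?P (S x) - ?P x) \<le> e / 2"
    proof -
      have "norm (?P (S x) - ?P x) \<le> L * norm (S x - x)"
        using \<open>norm x < 1\<close> \<rho> by (intro lip S_\<rho>) auto
      also have "\<dots> \<le> L * \<eta>" using S(5)[of x] L by (intro mult_left_mono) auto
      finally show ?thesis using L\<eta> by simp
    qed
    ultimately show "norm (blinfun_apply \<nu> p - ?P x) \<le> 0 + e"
      using norm_triangle_ineq4[of "?P (S x) - ?P x" "blinfun_apply \<nu> (h - p)"]
      by (simp add: blinfun.diff_right \<nu>h)
  qed
  then show ?thesis by simp
qed

text \<open>For \<open>r < 1\<close> the partial sums of the Taylor series of \<open>f (r z)\<close> are bounded in \<open>HL0\<close> by a geometric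
series, while those of \<open>f\<close> itself need not be; this is why the dilations \<open>f (r z)\<close> come between \<open>f\<close> and
its Taylor terms.\<close>

theorem G0_character_is_evaluation:
  fixes \<nu> :: "('a::cbanach, complex) HL0 \<Rightarrow>\<^sub>L complex"
  assumes bap: "bounded_approximation_property TYPE('a)" and \<nu>: "\<nu> \<in> G0"
    and mult: "\<And>f g. blinfun_apply \<nu> (HL0_mult f g) = blinfun_apply \<nu> f * blinfun_apply \<nu> g"
    and x: "\<And>w. bounded_clinear w \<Longrightarrow> w x = blinfun_apply \<nu> (HL0_of w)" and "norm x < 1"
  shows "blinfun_apply \<nu> f = HL0_apply f x"
proof -
  have xb: "x \<in> ball 0 1" using \<open>norm x < 1\<close> by simp
  note lin = G0_clinear[OF \<nu>]
  have dilated: "blinfun_apply \<nu> g = HL0_apply f (of_real r *\<^sub>C x)"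
    if r: "0 \<le> r" "r < 1" and g: "\<And>z. z \<in> ball 0 1 \<Longrightarrow> HL0_apply g z = HL0_apply f (of_real r *\<^sub>C z)" for r g
  proof -
    have "\<exists>p. (\<forall>z\<in>ball 0 1. HL0_apply p z = taylor_term f n z) \<and> norm p \<le> norm f" for n
      using taylor_term_HL0[of f n] by metis
    then obtain p where p: "\<And>n z. z \<in> ball 0 1 \<Longrightarrow> HL0_apply (p n) z = taylor_term f n z" "\<And>n. norm (p n) \<le> norm f"
      by metis
    let ?c = "complex_of_real r"
    have c: "norm ?c \<le> 1" using r by simp
    define G where "G N = (\<Sum>n<N. ?c ^ n *\<^sub>C p n)" for N
    have "norm (G N) \<le> norm f / (1 - r)" for N
    proof -
      have "norm (G N) \<le> (\<Sum>n<N. r ^ n * norm f)"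
        unfolding G_def using r p(2)
        by (intro order_trans[OF norm_sum] sum_mono) (simp add: norm_scaleC norm_power mult_left_mono)
      also have "\<dots> = (\<Sum>n<N. r ^ n) * norm f" by (simp add: sum_distrib_right)
      also have "\<dots> \<le> 1 / (1 - r) * norm f"
        using r sum_le_suminf[OF summable_geometric[of r], of "{..<N}"]
        by (intro mult_right_mono) (auto simp: suminf_geometric HL0_norm_nonneg)
      finally show ?thesis by simp
    qed
    moreover have "(\<lambda>N. HL0_apply (G N) z) \<longlonglongrightarrow> HL0_apply g z" if z: "z \<in> ball 0 1" for z
      using taylor_term_sums[OF z c, of f]
      by (simp add: sums_def G_def HL0_apply_sum scaleC_HL0.rep_eq scaleC_complex_def p(1)[OF z] g[OF z])
    ultimately have "(\<lambda>N. blinfun_apply \<nu> (G N)) \<longlonglongrightarrow> blinfun_apply \<nu> g"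
      by (rule G0_tendsto[OF \<nu>])
    moreover have "blinfun_apply \<nu> (G N) = (\<Sum>n<N. ?c ^ n * taylor_term f n x)" for N
    proof -
      have "blinfun_apply \<nu> (p n) = taylor_term f n x" for n
        by (rule taylor_term_evaluated[OF bap \<nu> mult x \<open>norm x < 1\<close> p(1)])
      then show ?thesis
        by (simp add: G_def blinfun.sum_right clinear_scaleC[OF lin] scaleC_complex_def)
    qed
    ultimately have "(\<lambda>n. ?c ^ n * taylor_term f n x) sums blinfun_apply \<nu> g"
      by (simp add: sums_def)
    with taylor_term_sums[OF xb c, of f] show ?thesis by (rule sums_unique2[symmetric])
  qed
  define r where "r m = 1 - inverse (real (Suc m))" for m
  have r: "0 \<le> r m" "r m < 1" for m
    by (simp_all add: r_def field_simps)
  have rlim: "r \<longlonglongrightarrow> 1"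
    using tendsto_diff[OF tendsto_const[of 1] LIMSEQ_inverse_real_of_nat] by (simp add: r_def[abs_def])
  have "norm (complex_of_real (r m)) \<le> 1" for m using r[of m] by simp
  then have "\<exists>g. (\<forall>z\<in>ball 0 1. HL0_apply g z = HL0_apply f (of_real (r m) *\<^sub>C z)) \<and> norm g \<le> norm f" for m
    using HL0_dilation[of "of_real (r m)" f] by metis
  then obtain g where g: "\<And>m z. z \<in> ball 0 1 \<Longrightarrow> HL0_apply (g m) z = HL0_apply f (of_real (r m) *\<^sub>C z)"
    "\<And>m. norm (g m) \<le> norm f" by metis
  have radial: "(\<lambda>m. HL0_apply f (of_real (r m) *\<^sub>C z)) \<longlonglongrightarrow> HL0_apply f z" if z: "z \<in> ball 0 1" for z
  proof -
    have "continuous_on (ball 0 1) (HL0_apply f)"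
      using HL0_lipschitz lipschitz_on_continuous_on by metis
    then have "isCont (HL0_apply f) z" using z by (simp add: continuous_on_eq_continuous_at)
    moreover have "(\<lambda>m. of_real (r m) *\<^sub>C z) \<longlonglongrightarrow> z"
      using tendsto_scaleR[OF rlim tendsto_const[of z]] by (simp flip: scaleR_scaleC)
    ultimately show ?thesis by (rule isCont_tendsto_compose)
  qed
  have "(\<lambda>m. blinfun_apply \<nu> (g m)) \<longlonglongrightarrow> blinfun_apply \<nu> f"
    by (rule G0_tendsto[OF \<nu> g(2)]) (simp add: g(1) radial del: mem_ball)
  then have "(\<lambda>m. HL0_apply f (of_real (r m) *\<^sub>C x)) \<longlonglongrightarrow> blinfun_apply \<nu> f"
    using dilated[OF r g(1)] by simp
  with radial[OF xb] show ?thesis by (rule LIMSEQ_unique[symmetric])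
qed

section \<open>Multiplicative operators\<close>

text \<open>The power \<open>w ^ n\<close> has Lipschitz constant at most \<open>n\<close> on the ball, so \<open>(A w)(y) ^ n = (A (w ^ n))(y)\<close>
grows at most linearly in \<open>n\<close>.\<close>

lemma multiplicative_contractive:
  fixes A :: "('x::complex_normed_vector, complex) HL0 \<Rightarrow> ('y::complex_normed_vector, complex) HL0"
  assumes mult: "HL0_multiplicative A" and "0 \<le> C" and bounded: "\<And>f. norm (A f) \<le> C * norm f"
    and w: "clinear w" "\<And>x. norm (w x) \<le> norm x" and y: "y \<in> ball 0 1"
  shows "norm (HL0_apply (A (HL0_of w)) y) \<le> 1"
proof (rule ccontr)
  let ?f = "HL0_of w"
  define a where "a = norm (HL0_apply (A ?f) y)"
  assume "\<not> ?thesis"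
  then have a: "1 < a" by (simp add: a_def)
  define F where "F n = ((\<lambda>g. HL0_mult g ?f) ^^ n) ?f" for n
  have F_0: "F 0 = ?f" and F_Suc: "\<And>n. F (Suc n) = HL0_mult (F n) ?f"
    by (simp_all add: F_def)
  have F_apply: "HL0_apply (F n) x = w x ^ Suc n" if "x \<in> ball 0 1" for n x
    using HL0_of_clinear(1)[OF w(1), of 1 x] w(2) that
    by (induction n) (simp_all add: F_0 F_Suc HL0_mult.rep_eq mult_ac)
  have F_norm: "norm (F n) \<le> real (Suc n)" for n
  proof (rule HL0_norm_le)
    fix x z :: 'x assume xz: "x \<in> ball 0 1" "z \<in> ball 0 1"
    have "norm (w x) \<le> 1" "norm (w z) \<le> 1"
      using w(2)[of x] w(2)[of z] xz by simp_all
    then have "norm (w x ^ Suc n - w z ^ Suc n) \<le> real (Suc n) * norm (w x - w z)"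
      by (rule norm_power_diff)
    also have "\<dots> \<le> real (Suc n) * norm (x - z)"
      using w(2)[of "x - z"] by (intro mult_left_mono) (simp_all add: clinear_diff[OF w(1)])
    finally show "norm (HL0_apply (F n) x - HL0_apply (F n) z) \<le> real (Suc n) * norm (x - z)"
      using xz by (simp only: F_apply)
  qed simp
  have AF: "HL0_apply (A (F n)) y = HL0_apply (A ?f) y ^ Suc n" for n
    using mult by (induction n) (simp_all add: F_0 F_Suc HL0_multiplicative_def HL0_mult.rep_eq mult_ac)
  have growth: "a ^ Suc n \<le> C * real (Suc n)" for n
  proof -
    have "a ^ Suc n = norm (HL0_apply (A (F n)) y)"
      by (simp only: AF norm_power a_def)
    also have "\<dots> \<le> norm (A (F n)) * norm y" by (rule HL0_apply_bound)
    also have "\<dots> \<le> norm (A (F n)) * 1"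
      using y by (intro mult_left_mono) auto
    also have "\<dots> \<le> C * norm (F n)" using bounded by simp
    also have "\<dots> \<le> C * real (Suc n)" using F_norm \<open>0 \<le> C\<close> by (rule mult_left_mono)
    finally show ?thesis .
  qed
  have "(\<lambda>n. real n * (1 / a) ^ n) \<longlonglongrightarrow> 0"
    using powser_times_n_limit_0[of "1 / a"] a by simp
  then have "(\<lambda>n. C * (real (Suc n) * (1 / a) ^ Suc n)) \<longlonglongrightarrow> C * 0"
    by (intro tendsto_intros) (rule LIMSEQ_Suc)
  then have "1 \<le> C * 0"
  proof (rule LIMSEQ_le_const, intro exI allI impI)
    fix n
    show "1 \<le> C * (real (Suc n) * (1 / a) ^ Suc n)"
      using growth[of n] a by (simp add: power_one_over divide_inverse[symmetric] del: power_Suc of_nat_Suc)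
  qed
  then show False by simp
qed

text \<open>Schwarz lemma for \<open>A w\<close> on the complex line through \<open>y\<close>. The factor \<open>\<kappa>\<close> provides the strict bound that
the lemma asks for; any \<open>\<kappa>\<close> close to 1 serves to keep \<open>\<kappa> * norm y\<close> below 1.\<close>

lemma multiplicative_Schwarz:
  fixes A :: "('x::complex_normed_vector, complex) HL0 \<Rightarrow> ('y::complex_normed_vector, complex) HL0"
  assumes mult: "HL0_multiplicative A" and "0 \<le> C" and bounded: "\<And>f. norm (A f) \<le> C * norm f"
    and w: "clinear w" "\<And>x. norm (w x) \<le> norm x" and y: "y \<in> ball 0 1" and "1 < \<kappa>"
  shows "norm (HL0_apply (A (HL0_of w)) y) \<le> \<kappa> * norm y"
proof (cases "y = 0")
  case False
  let ?g = "HL0_apply (A (HL0_of w))"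
  define u where "u = of_real (1 / norm y) *\<^sub>C y"
  have u: "norm u = 1" using False by (simp add: u_def norm_scaleC norm_divide)
  have yu: "of_real (norm y) *\<^sub>C u = y" using False by (simp add: u_def scaleC_scaleC scaleC_one)
  have "norm (?g (of_real (norm y) *\<^sub>C u) / of_real \<kappa>) \<le> norm (complex_of_real (norm y))"
  proof (rule Schwarz_Lemma(1)[where f = "\<lambda>t. ?g (t *\<^sub>C u) / of_real \<kappa>"])
    show "(\<lambda>t. ?g (t *\<^sub>C u) / of_real \<kappa>) holomorphic_on ball 0 1"
      using \<open>1 < \<kappa>\<close> by (intro holomorphic_on_divide slice_holomorphic holomorphic_on_const) (simp_all add: u)
    fix t :: complex assume "norm t < 1"
    then have "t *\<^sub>C u \<in> ball 0 1" by (simp add: norm_scaleC u)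
    from multiplicative_contractive[OF mult \<open>0 \<le> C\<close> bounded w this]
    show "norm (?g (t *\<^sub>C u) / of_real \<kappa>) < 1"
      using \<open>1 < \<kappa>\<close> by (simp add: norm_divide)
  qed (use y in simp_all)
  then show ?thesis
    using \<open>1 < \<kappa>\<close> by (simp add: yu norm_divide divide_le_eq mult.commute)
qed simp

text \<open>The symbol \<open>\<phi>\<close> maps \<open>y\<close> to the barycentre of \<open>f \<mapsto> (A f)(y)\<close>. Boundedness of \<open>A\<close> gives the common bound
on the functions \<open>w \<circ> \<phi> = A w\<close> from which \<open>\<phi>\<close> inherits holomorphy and the Lipschitz property.\<close>

theorem composition_operator_if_evaluations_in_G0:
  fixes A :: "('x::cbanach, complex) HL0 \<Rightarrow> ('y::complex_normed_vector, complex) HL0"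
  assumes A: "clinear A" and mult: "HL0_multiplicative A" and bap: "bounded_approximation_property TYPE('x)"
    and ev: "\<forall>y\<in>ball 0 1. \<exists>\<nu>\<in>G0. \<forall>f. HL0_apply (A f) y = blinfun_apply \<nu> f"
  shows "composition_operator A"
proof -
  have "\<forall>y. \<exists>\<nu>. y \<in> ball 0 1 \<longrightarrow> \<nu> \<in> G0 \<and> (\<forall>f. HL0_apply (A f) y = blinfun_apply \<nu> f)"
    using ev by metis
  then obtain \<nu> where \<nu>: "\<And>y. y \<in> ball 0 1 \<Longrightarrow> \<nu> y \<in> G0"
    "\<And>y f. y \<in> ball 0 1 \<Longrightarrow> HL0_apply (A f) y = blinfun_apply (\<nu> y) f"
    by metis
  have "continuous_on UNIV (\<lambda>f. HL0_apply (A f) y)" if "y \<in> ball 0 1" for y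
    unfolding \<nu>(2)[OF that] by (rule linear_continuous_on) (rule blinfun.bounded_linear_right)
  then obtain C where C: "0 \<le> C" "\<And>f. norm (A f) \<le> C * norm f"
    using clinear_bounded_if_pointwise_bounded[OF A] by blast
  have "\<exists>x. y \<in> ball 0 1 \<longrightarrow> (\<forall>w. bounded_clinear w \<longrightarrow> w x = blinfun_apply (\<nu> y) (HL0_of w))" for y
    using G0_barycenter[of "\<nu> y"] \<nu>(1)[of y] by metis
  then obtain \<phi> where \<phi>: "\<And>y w. y \<in> ball 0 1 \<Longrightarrow> bounded_clinear w \<Longrightarrow> w (\<phi> y) = blinfun_apply (\<nu> y) (HL0_of w)"
    by metis
  have weak: "bounded_clinear w" "norm (HL0_of w) \<le> 1" if "clinear w" "\<And>x. norm (w x) \<le> norm x"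
    for w :: "'x \<Rightarrow> complex"
    using bounded_clinearI[of w 1] HL0_of_clinear(2)[of w 1] that by auto
  have \<phi>_le: "norm (\<phi> y) \<le> \<kappa> * norm y" if y: "y \<in> ball 0 1" and "1 < \<kappa>" for y \<kappa>
  proof (rule norming_functional_bound)
    fix w :: "'x \<Rightarrow> complex" assume w: "clinear w" "\<And>x. norm (w x) \<le> norm x"
    show "norm (w (\<phi> y)) \<le> \<kappa> * norm y"
      using multiplicative_Schwarz[OF mult C w y \<open>1 < \<kappa>\<close>]
      by (simp only: \<nu>(2)[OF y] \<phi>[OF y weak(1)[OF w]])
  qed
  have \<phi>_ball: "norm (\<phi> y) < 1" if y: "y \<in> ball 0 1" for y
  proof -
    have pos: "0 < 1 + norm y" by (simp add: add_pos_nonneg)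
    \<comment> \<open>With \<open>\<kappa> = 2 / (1 + norm y)\<close> the bound \<open>\<kappa> * norm y\<close> is still below 1.\<close>
    have "1 < 2 / (1 + norm y)" using y pos by (simp add: less_divide_eq)
    from \<phi>_le[OF y this] have "norm (\<phi> y) \<le> 2 / (1 + norm y) * norm y" .
    also have "\<dots> < 1" using y pos by (simp add: divide_less_eq)
    finally show ?thesis .
  qed
  have "\<phi> 0 = 0" using \<phi>_le[of 0 2] by simp
  have weakly: "\<exists>f. norm f \<le> C \<and> (\<forall>y\<in>ball 0 1. HL0_apply f y = w (\<phi> y))"
    if w: "clinear w" "\<And>x. norm (w x) \<le> norm x" for w :: "'x \<Rightarrow> complex"
  proof (intro exI conjI ballI)
    show "norm (A (HL0_of w)) \<le> C"
      using C(2)[of "HL0_of w"] mult_left_mono[OF weak(2)[OF w] C(1)] by simp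
    show "HL0_apply (A (HL0_of w)) y = w (\<phi> y)" if "y \<in> ball 0 1" for y
      using \<nu>(2)[OF that] \<phi>[OF that weak(1)[OF w]] by simp
  qed
  obtain \<Phi> :: "('y, 'x) HL0" where \<Phi>: "\<And>y. y \<in> ball 0 1 \<Longrightarrow> HL0_apply \<Phi> y = \<phi> y"
    using weakly_HL0[of \<phi> C, OF \<open>\<phi> 0 = 0\<close> C(1) weakly] by blast
  have "HL0_apply (A f) y = HL0_apply f (HL0_apply \<Phi> y)" if y: "y \<in> ball 0 1" for f y
  proof -
    have "blinfun_apply (\<nu> y) (HL0_mult f g) = blinfun_apply (\<nu> y) f * blinfun_apply (\<nu> y) g" for f g
      using mult by (simp add: HL0_multiplicative_def HL0_mult.rep_eq flip: \<nu>(2)[OF y])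
    from G0_character_is_evaluation[OF bap \<nu>(1)[OF y] this \<phi>[OF y] \<phi>_ball[OF y]]
    show ?thesis by (simp add: \<nu>(2)[OF y] \<Phi>[OF y])
  qed
  moreover have "HL0_apply \<Phi> ` ball 0 1 \<subseteq> ball 0 1"
    using \<Phi> \<phi>_ball by force
  ultimately show ?thesis unfolding composition_operator_def by blast
qed

theorem theorem3p12:
  fixes A :: "('x::cbanach, complex) HL0 \<Rightarrow> ('y::cbanach, complex) HL0"
  assumes "clinear A"
    and "HL0_multiplicative A"
  shows
    "(composition_operator A \<longrightarrow>
       (\<exists>T. continuous_linear_G0 T \<and> is_adjoint_of A T) \<and>
       continuous_map tau0 tau0 A \<and> continuous_map taup taup A) \<and>
     (continuous_map tau0 tau0 A \<longrightarrow> (\<exists>T. continuous_linear_G0 T \<and> is_adjoint_of A T)) \<and>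
     (continuous_map taup taup A \<longrightarrow> (\<exists>T. continuous_linear_G0 T \<and> is_adjoint_of A T)) \<and>
     (bounded_approximation_property TYPE('x) \<longrightarrow>
       (composition_operator A \<longleftrightarrow> (\<exists>T. continuous_linear_G0 T \<and> is_adjoint_of A T)) \<and>
       (composition_operator A \<longleftrightarrow> continuous_map tau0 tau0 A) \<and>
       (composition_operator A \<longleftrightarrow> continuous_map taup taup A))"
proof -
  let ?ev = "\<forall>y\<in>ball 0 1. \<exists>\<nu>\<in>G0. \<forall>f. HL0_apply (A f) y = blinfun_apply \<nu> f"
  have "composition_operator A \<Longrightarrow> ?ev \<and> continuous_map tau0 tau0 A \<and> continuous_map taup taup A"
    using composition_operator_continuity by metis
  moreover have "continuous_map tau0 tau0 A \<Longrightarrow> ?ev"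
    using evaluation_in_G0_if_tau0_continuous[OF assms(1)] by metis
  moreover have "continuous_map taup taup A \<Longrightarrow> ?ev"
    using evaluation_in_G0_if_taup_continuous[OF assms(1)] by metis
  moreover have "bounded_approximation_property TYPE('x) \<Longrightarrow> ?ev \<Longrightarrow> composition_operator A"
    by (rule composition_operator_if_evaluations_in_G0[OF assms])
  ultimately show ?thesis
    unfolding adjoint_iff_evaluations_in_G0[OF assms(1)] by argo
qed

end
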